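(* Let $(X,S,\phi)$ be a system such that $\phi$ is irreducibly quantified, and assume that either $X$ is transferable, or $\phi$ is simple and $X$ is weakly transferable. Suppose that $X$ has a free action of $G=\mathbb Z^d$, and fix a fundamental domain $\Lambda_0$ of $X$ for the action of $G$. Assume that $c_\phi=\dim_{\mathbb R}\mathrm{Consv}^\phi(S)$ is finite and fix a basis $\xi^{(1)},\dots,\xi^{(c_\phi)}$ of $\mathrm{Consv}^\phi(S)$. Let $\omega=(\omega_e)\in\prod_{e\in E}C_{\mathrm{loc}}(S^X)$ be a shift-invariant closed uniform form. Then there exist $a_{ij}\in\mathbb R$ for $i=1,\dots,c_\phi$ and $j=1,\dots,d$ and a shift-invariant uniform function $F\in C^0_{\mathrm{unif}}(S^X)$ such that $$\omega=\partial\Bigl(F+\sum_{i=1}^{c_\phi}\sum_{j=1}^d a_{ij}\Bigl(\sum_{\tau\in G}\tau_j\,\xi^{(i)}_{\tau(\Lambda_0)}\Bigr)\Bigr),$$ where $\tau=(\tau_j)\in\mathbb Z^d$ and $\xi_W=\sum_{x\in W}\xi_x\in C^0_{\mathrm{unif}}(S^X)$ for any conserved quantity $\xi$ and $W\subset X$.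
   Context: Locales. A locale $X=(X,E)$, $E\subset X\times X$, is a directed graph that is symmetric ($(x,y)\in E\Rightarrow(y,x)\in E$), simple ($(x,x)\notin E$), locally finite (each vertex lies on finitely many edges) and connected. Write $e=(o(e),t(e))$, $\bar e=(t(e),o(e))$. Paths are finite sequences of consecutive edges (length $0$ allowed); $d_X$ is the graph distance; a subset of $X$ is connected if the induced subgraph is connected. A ball is a set $B(x,R)=\{x'\in X: d_X(x,x')\le R\}$ with $x\in X$, $R>0$ ($R$ is its radius); $B(\Lambda,R)=\bigcup_{x\in\Lambda}B(x,R)$, and $B(e,R)=B(o(e),R)\cup B(t(e),R)$. $X$ is weakly transferable if for every ball $B$ the complement $X\setminus B$ is a nonempty finite disjoint union of connected infinite graphs. $X$ is transferable if it is weakly transferable and either (a) there is a ball $B$ such that $X\setminus B$ has three or more connected components, or (b) for any $r\in\mathbb N$ there is a ball $B$ of radius at least $r$ with $X\setminus B$ connected. Systems. $S$ is a nonempty set with a designated base state $*\in S$. An interaction is a map $\phi\colon S\times S\to S\times S$ such that $\hat\imath\circ\phi\circ\hat\imath\circ\phi(s_1,s_2)=(s_1,s_2)$ whenever $\phi(s_1,s_2)\ne(s_1,s_2)$, where $\hat\imath$ swaps the components. A system is a triple $(X,S,\phi)$ of a locale, a set of states and an interaction. $S^X=\prod_{x\in X}S$; $\star$ is the configuration with all components $*$; $S^X_*$ is the set of $\eta=(\eta_x)\in S^X$ with $\eta_x=*$ for all but finitely many $x$. For $e\in E$, $\eta^e$ is obtained from $\eta$ by replacing $(\eta_{o(e)},\eta_{t(e)})$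 by $\phi(\eta_{o(e)},\eta_{t(e)})$. $\Phi=\{(\eta,\eta^e):\eta\in S^X,e\in E\}$, $\Phi_*=\Phi\cap(S^X_*\times S^X_* )$; $(S^X,\Phi)$ and $(S^X_*,\Phi_* )$ are symmetric directed graphs. Conserved quantities. A conserved quantity is $\xi\colon S\to\mathbb R$ with $\xi( * )=0$ and $\xi(s_1)+\xi(s_2)=\xi(s_1')+\xi(s_2')$ for all $(s_1,s_2)$, where $(s_1',s_2')=\phi(s_1,s_2)$; $\mathrm{Consv}^\phi(S)$ is the $\mathbb R$-linear space of these, $c_\phi$ its dimension. $\xi_x(\eta)=\xi(\eta_x)$, and for $W\subset X$, $\xi_W(\eta)=\sum_{x\in W}\xi(\eta_x)$ for $\eta\in S^X_*$. $\phi$ is irreducibly quantified if for any finite locale $Y$ and $\eta,\eta'\in S^Y$ with $\xi_Y(\eta)=\xi_Y(\eta')$ for all $\xi\in\mathrm{Consv}^\phi(S)$ there is a finite path from $\eta$ to $\eta'$ in $(S^Y,\Phi)$. $\phi$ is simple if $c_\phi=1$ and for any nonzero $\xi\in\mathrm{Consv}^\phi(S)$ the additive submonoid of $\mathbb R$ generated by $\xi(S)$ is isomorphic to $\mathbb N=\{0,1,\dots\}$ or $\mathbb Z$. Functions and forms. $C(A)$ is the space of functions $A\to\mathbb R$. For finite $\Lambda\subset X$, $C(S^\Lambda)$ is regarded as the subspace of $C(S^X_* )$ of functions depending only on $\eta|_\Lambda$; $C_{\mathrm{loc}}(S^X)$ is the union of these over finite $\Lambda$; $C_\Lambda(S^X)$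 is the space of $f\in C(S^\Lambda)$ with $f(\eta)=0$ whenever $\eta_x=*$ for some $x\in\Lambda$. Every $f\in C(S^X_* )$ has a unique expansion $f=\sum_{\Lambda\subset X,|\Lambda|<\infty}f_\Lambda$ with $f_\Lambda\in C_\Lambda(S^X)$; $f$ is uniform if there is $R>0$ with $f_\Lambda=0$ whenever $\mathrm{diam}(\Lambda)=\sup_{x,x'\in\Lambda}d_X(x,x')>R$. $C^0_{\mathrm{unif}}(S^X)$ is the space of uniform $f$ with $f(\star)=0$. A form is a function $\omega\colon\Phi_*\to\mathbb R$ with $\omega(\bar\varphi)=-\omega(\varphi)$ ($\bar\varphi$ the reversed transition), identified with $(\omega_e)_{e\in E}$, $\omega_e(\eta)=\omega((\eta,\eta^e))$. It is closed if its sum along every closed path of $(S^X_*,\Phi_* )$ is $0$, and uniform if there is $R>0$ such that $\omega_e\in C(S^{B(e,R)})$ for all $e\in E$. $\partial f=(\nabla_ef)_{e\in E}$, $\nabla_ef(\eta)=f(\eta^e)-f(\eta)$. Group action. An action of $G$ on $X$ is a homomorphism from $G$ to the group of bijections $X\to X$ preserving $E$; it is free if $\sigma(x)=\tau(x)$ for some $x\in X$ implies $\sigma=\tau$. A fundamental domain is a subset $\Lambda_0\subset X$ containing exactly one vertex of each $G$-orbit. $G$ acts by $\eta^\sigma=(\eta_{\sigma(x)})_{x}$, $(\sigma f)(\eta)=f(\eta^\sigma)$, and $(\sigma\omega)((\eta,\eta'))=\omega((\eta^\sigma,\eta'^\sigma))$; shift-invariant means $G$-invariant. *)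

theory Defs
  imports
    "HOL-Analysis.Infinite_Sum"
    "HOL-Algebra.Product_Groups"
    "HOL-Algebra.Group_Action"
    "HOL-Library.Function_Algebras"
    "HOL-Library.Disjoint_Sets"
begin

section \<open>Graphs\<close>

text \<open>A directed graph is given by a vertex set \<open>V\<close> and an edge relation \<open>E\<close>; an edge \<open>e\<close> has origin
  \<open>fst e\<close> and target \<open>snd e\<close>.\<close>

definition induced :: "('v \<times> 'v) set \<Rightarrow> 'v set \<Rightarrow> ('v \<times> 'v) set" where
  "induced E W = E \<inter> W \<times> W"

definition connected_subset :: "('v \<times> 'v) set \<Rightarrow> 'v set \<Rightarrow> bool" where
  "connected_subset E W \<longleftrightarrow> (\<forall>x\<in>W. \<forall>y\<in>W. (x, y) \<in> (induced E W)\<^sup>*)"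

definition components_of_subset :: "('v \<times> 'v) set \<Rightarrow> 'v set \<Rightarrow> 'v set set" where
  "components_of_subset E W = W // (induced E W)\<^sup>*"

definition is_locale :: "'v set \<Rightarrow> ('v \<times> 'v) set \<Rightarrow> bool" where
  "is_locale V E \<longleftrightarrow>
     E \<subseteq> V \<times> V \<and> sym E \<and> irrefl E \<and>
     (\<forall>x\<in>V. finite {e \<in> E. fst e = x \<or> snd e = x}) \<and>
     connected_subset E V"

text \<open>The infinite locale \<open>X\<close> is modelled with a whole type as its vertex set, so that its structure
  is just the relation \<open>E\<close>. The graph distance is the least length of a path.\<close>

definition gdist :: "('x \<times> 'x) set \<Rightarrow> 'x \<Rightarrow> 'x \<Rightarrow> nat" where
  "gdist E x y = (LEAST n. (x, y) \<in> E ^^ n)"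

definition gball :: "('x \<times> 'x) set \<Rightarrow> 'x \<Rightarrow> real \<Rightarrow> 'x set" where
  "gball E x R = {y. real (gdist E x y) \<le> R}"

definition edge_ball :: "('x \<times> 'x) set \<Rightarrow> 'x \<times> 'x \<Rightarrow> real \<Rightarrow> 'x set" where
  "edge_ball E e R = gball E (fst e) R \<union> gball E (snd e) R"

text \<open>Only used for finite \<open>\<Lambda>\<close>; the supremum of the empty set of natural numbers is \<open>0\<close>.\<close>

definition gdiam :: "('x \<times> 'x) set \<Rightarrow> 'x set \<Rightarrow> nat" where
  "gdiam E \<Lambda> = (SUP (x, y)\<in>\<Lambda> \<times> \<Lambda>. gdist E x y)"

text \<open>The last conjunct says that the union is one of graphs: no edge joins two different parts.\<close>

definition finite_union_of_infinite_connected :: "('x \<times> 'x) set \<Rightarrow> 'x set \<Rightarrow> bool" where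
  "finite_union_of_infinite_connected E W \<longleftrightarrow>
     (\<exists>P. finite P \<and> P \<noteq> {} \<and> partition_on W P \<and>
          (\<forall>C\<in>P. connected_subset E C \<and> infinite C) \<and>
          induced E W = (\<Union>C\<in>P. induced E C))"

definition weakly_transferable :: "('x \<times> 'x) set \<Rightarrow> bool" where
  "weakly_transferable E \<longleftrightarrow>
     (\<forall>x R. R > 0 \<longrightarrow> finite_union_of_infinite_connected E (- gball E x R))"

text \<open>In the first alternative the set of components is finite by weak transferability.\<close>

definition transferable :: "('x \<times> 'x) set \<Rightarrow> bool" where
  "transferable E \<longleftrightarrow> weakly_transferable E \<and>
     ((\<exists>x R. R > 0 \<and> card (components_of_subset E (- gball E x R)) \<ge> 3) \<or>
      (\<forall>r::nat. \<exists>x R. R > 0 \<and> R \<ge> real r \<and> connected_subset E (- gball E x R)))"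


section \<open>Interactions and configurations\<close>

definition is_interaction :: "('s \<times> 's \<Rightarrow> 's \<times> 's) \<Rightarrow> bool" where
  "is_interaction \<phi> \<longleftrightarrow>
     (\<forall>p. \<phi> p \<noteq> p \<longrightarrow> prod.swap (\<phi> (prod.swap (\<phi> p))) = p)"

text \<open>\<open>step \<phi> e \<eta>\<close> is the configuration written \<open>\<eta>\<^sup>e\<close> in the literature.\<close>

definition step :: "('s \<times> 's \<Rightarrow> 's \<times> 's) \<Rightarrow> 'v \<times> 'v \<Rightarrow> ('v \<Rightarrow> 's) \<Rightarrow> ('v \<Rightarrow> 's)" where
  "step \<phi> e \<eta> = (let (s, t) = \<phi> (\<eta> (fst e), \<eta> (snd e)) in \<eta>(fst e := s, snd e := t))"

text \<open>Configurations on \<open>V\<close> are extensional functions; for \<open>V = UNIV\<close> these are all functions.\<close>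

definition transitions ::
    "'v set \<Rightarrow> ('v \<times> 'v) set \<Rightarrow> ('s \<times> 's \<Rightarrow> 's \<times> 's) \<Rightarrow> (('v \<Rightarrow> 's) \<times> ('v \<Rightarrow> 's)) set" where
  "transitions V E \<phi> = {(\<eta>, step \<phi> e \<eta>) | \<eta> e. \<eta> \<in> V \<rightarrow>\<^sub>E UNIV \<and> e \<in> E}"

definition fin_configs :: "'s \<Rightarrow> ('x \<Rightarrow> 's) set" where
  "fin_configs b = {\<eta>. finite {x. \<eta> x \<noteq> b}}"

definition fin_transitions ::
    "'s \<Rightarrow> ('x \<times> 'x) set \<Rightarrow> ('s \<times> 's \<Rightarrow> 's \<times> 's) \<Rightarrow> (('x \<Rightarrow> 's) \<times> ('x \<Rightarrow> 's)) set" where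
  "fin_transitions b E \<phi> = transitions UNIV E \<phi> \<inter> fin_configs b \<times> fin_configs b"


section \<open>Conserved quantities\<close>

definition Consv :: "'s \<Rightarrow> ('s \<times> 's \<Rightarrow> 's \<times> 's) \<Rightarrow> ('s \<Rightarrow> real) set" where
  "Consv b \<phi> = {\<xi>. \<xi> b = 0 \<and>
     (\<forall>s1 s2. \<xi> s1 + \<xi> s2 = \<xi> (fst (\<phi> (s1, s2))) + \<xi> (snd (\<phi> (s1, s2))))}"

definition fun_scale :: "real \<Rightarrow> ('s \<Rightarrow> real) \<Rightarrow> ('s \<Rightarrow> real)" where
  "fun_scale r f = (\<lambda>s. r * f s)"

global_interpretation fun_vs: vector_space fun_scale
  by standard (auto simp: fun_scale_def fun_eq_iff algebra_simps)

text \<open>The dimension of the library is \<open>0\<close> for spaces that are not finite-dimensional.\<close>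

definition consv_dim :: "'s \<Rightarrow> ('s \<times> 's \<Rightarrow> 's \<times> 's) \<Rightarrow> nat" where
  "consv_dim b \<phi> = fun_vs.dim (Consv b \<phi>)"

definition consv_finite_dim :: "'s \<Rightarrow> ('s \<times> 's \<Rightarrow> 's \<times> 's) \<Rightarrow> bool" where
  "consv_finite_dim b \<phi> \<longleftrightarrow> (\<exists>B. finite B \<and> fun_vs.span B = Consv b \<phi>)"

definition consv_basis ::
    "'s \<Rightarrow> ('s \<times> 's \<Rightarrow> 's \<times> 's) \<Rightarrow> 'i set \<Rightarrow> ('i \<Rightarrow> 's \<Rightarrow> real) \<Rightarrow> bool" where
  "consv_basis b \<phi> I \<xi> \<longleftrightarrow>
     inj_on \<xi> I \<and> \<not> fun_vs.dependent (\<xi> ` I) \<and> fun_vs.span (\<xi> ` I) = Consv b \<phi>"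

text \<open>For a conserved quantity and a configuration with finite support, only finitely many terms of
  the sum are nonzero, even if \<open>W\<close> is infinite.\<close>

definition consv_sum :: "('s \<Rightarrow> real) \<Rightarrow> 'v set \<Rightarrow> ('v \<Rightarrow> 's) \<Rightarrow> real" where
  "consv_sum \<xi> W \<eta> = (\<Sum>\<^sub>\<infinity>x\<in>W. \<xi> (\<eta> x))"

text \<open>Every finite locale is isomorphic to one whose vertices are natural numbers.\<close>

definition irreducibly_quantified :: "'s \<Rightarrow> ('s \<times> 's \<Rightarrow> 's \<times> 's) \<Rightarrow> bool" where
  "irreducibly_quantified b \<phi> \<longleftrightarrow>
     (\<forall>(Y :: nat set) E. finite Y \<and> is_locale Y E \<longrightarrow>
        (\<forall>\<eta> \<in> Y \<rightarrow>\<^sub>E UNIV. \<forall>\<eta>' \<in> Y \<rightarrow>\<^sub>E UNIV.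
           (\<forall>\<xi>\<in>Consv b \<phi>. consv_sum \<xi> Y \<eta> = consv_sum \<xi> Y \<eta>') \<longrightarrow>
           (\<eta>, \<eta>') \<in> (transitions Y E \<phi>)\<^sup>*))"

definition add_submonoid_generated :: "real set \<Rightarrow> real set" where
  "add_submonoid_generated A = (\<lambda>M. 0 \<in> M \<and> (\<forall>x\<in>M. \<forall>y\<in>M. x + y \<in> M)) hull A"

definition add_monoid_on :: "'a::monoid_add set \<Rightarrow> 'a monoid" where
  "add_monoid_on M = \<lparr>carrier = M, monoid.mult = (+), one = 0\<rparr>"

definition simple_interaction :: "'s \<Rightarrow> ('s \<times> 's \<Rightarrow> 's \<times> 's) \<Rightarrow> bool" where
  "simple_interaction b \<phi> \<longleftrightarrow> consv_dim b \<phi> = 1 \<and>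
     (\<forall>\<xi>\<in>Consv b \<phi>. \<xi> \<noteq> (\<lambda>_. 0) \<longrightarrow>
        add_monoid_on (add_submonoid_generated (range \<xi>)) \<cong> add_monoid_on (UNIV :: nat set) \<or>
        add_monoid_on (add_submonoid_generated (range \<xi>)) \<cong> add_monoid_on (UNIV :: int set))"


section \<open>Functions and forms\<close>

text \<open>Functions on the configurations of finite support are represented by total functions, of which
  only the values on \<open>fin_configs b\<close> matter.\<close>

definition C_on :: "'s \<Rightarrow> 'x set \<Rightarrow> (('x \<Rightarrow> 's) \<Rightarrow> real) set" where
  "C_on b \<Lambda> = {f. \<forall>\<eta>\<in>fin_configs b. \<forall>\<eta>'\<in>fin_configs b.
     (\<forall>x\<in>\<Lambda>. \<eta> x = \<eta>' x) \<longrightarrow> f \<eta> = f \<eta>'}"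

definition C_loc :: "'s \<Rightarrow> (('x \<Rightarrow> 's) \<Rightarrow> real) set" where
  "C_loc b = (\<Union>\<Lambda>\<in>{\<Lambda>. finite \<Lambda>}. C_on b \<Lambda>)"

definition C_exact :: "'s \<Rightarrow> 'x set \<Rightarrow> (('x \<Rightarrow> 's) \<Rightarrow> real) set" where
  "C_exact b \<Lambda> = {f \<in> C_on b \<Lambda>. \<forall>\<eta>\<in>fin_configs b. (\<exists>x\<in>\<Lambda>. \<eta> x = b) \<longrightarrow> f \<eta> = 0}"

text \<open>The sum is finite at each \<open>\<eta>\<close>: a term is zero unless \<open>\<Lambda>\<close> is contained in the support of \<open>\<eta>\<close>.
  Every \<open>f\<close> has exactly one expansion (up to values outside \<open>fin_configs b\<close>).\<close>

definition is_expansion ::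
    "'s \<Rightarrow> (('x \<Rightarrow> 's) \<Rightarrow> real) \<Rightarrow> ('x set \<Rightarrow> ('x \<Rightarrow> 's) \<Rightarrow> real) \<Rightarrow> bool" where
  "is_expansion b f c \<longleftrightarrow>
     (\<forall>\<Lambda>. finite \<Lambda> \<longrightarrow> c \<Lambda> \<in> C_exact b \<Lambda>) \<and>
     (\<forall>\<eta>\<in>fin_configs b. f \<eta> = (\<Sum>\<^sub>\<infinity>\<Lambda>\<in>{\<Lambda>. finite \<Lambda>}. c \<Lambda> \<eta>))"

definition uniform_function :: "'s \<Rightarrow> ('x \<times> 'x) set \<Rightarrow> (('x \<Rightarrow> 's) \<Rightarrow> real) \<Rightarrow> bool" where
  "uniform_function b E f \<longleftrightarrow>
     (\<exists>c. is_expansion b f c \<and>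
       (\<exists>R::real. R > 0 \<and>
         (\<forall>\<Lambda>. finite \<Lambda> \<and> real (gdiam E \<Lambda>) > R \<longrightarrow> (\<forall>\<eta>\<in>fin_configs b. c \<Lambda> \<eta> = 0))))"

definition C0_unif :: "'s \<Rightarrow> ('x \<times> 'x) set \<Rightarrow> (('x \<Rightarrow> 's) \<Rightarrow> real) set" where
  "C0_unif b E = {f. uniform_function b E f \<and> f (\<lambda>_. b) = 0}"

definition is_form ::
    "'s \<Rightarrow> ('x \<times> 'x) set \<Rightarrow> ('s \<times> 's \<Rightarrow> 's \<times> 's) \<Rightarrow> (('x \<Rightarrow> 's) \<times> ('x \<Rightarrow> 's) \<Rightarrow> real) \<Rightarrow> bool" where
  "is_form b E \<phi> \<omega> \<longleftrightarrow> (\<forall>p\<in>fin_transitions b E \<phi>. \<omega> (prod.swap p) = - \<omega> p)"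

definition form_component ::
    "('s \<times> 's \<Rightarrow> 's \<times> 's) \<Rightarrow> (('x \<Rightarrow> 's) \<times> ('x \<Rightarrow> 's) \<Rightarrow> real) \<Rightarrow> 'x \<times> 'x \<Rightarrow> ('x \<Rightarrow> 's) \<Rightarrow> real" where
  "form_component \<phi> \<omega> e \<eta> = \<omega> (\<eta>, step \<phi> e \<eta>)"

text \<open>\<open>is_path T x p y\<close>: the list \<open>p\<close> of consecutive edges of the relation \<open>T\<close> leads from \<open>x\<close> to \<open>y\<close>.\<close>

fun is_path :: "('a \<times> 'a) set \<Rightarrow> 'a \<Rightarrow> ('a \<times> 'a) list \<Rightarrow> 'a \<Rightarrow> bool" where
  "is_path T x [] y \<longleftrightarrow> x = y"
| "is_path T x (e # p) y \<longleftrightarrow> e \<in> T \<and> fst e = x \<and> is_path T (snd e) p y"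

definition closed_form ::
    "'s \<Rightarrow> ('x \<times> 'x) set \<Rightarrow> ('s \<times> 's \<Rightarrow> 's \<times> 's) \<Rightarrow> (('x \<Rightarrow> 's) \<times> ('x \<Rightarrow> 's) \<Rightarrow> real) \<Rightarrow> bool" where
  "closed_form b E \<phi> \<omega> \<longleftrightarrow>
     (\<forall>\<eta>\<in>fin_configs b. \<forall>p. is_path (fin_transitions b E \<phi>) \<eta> p \<eta> \<longrightarrow> sum_list (map \<omega> p) = 0)"

definition uniform_form ::
    "'s \<Rightarrow> ('x \<times> 'x) set \<Rightarrow> ('s \<times> 's \<Rightarrow> 's \<times> 's) \<Rightarrow> (('x \<Rightarrow> 's) \<times> ('x \<Rightarrow> 's) \<Rightarrow> real) \<Rightarrow> bool" where
  "uniform_form b E \<phi> \<omega> \<longleftrightarrow>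
     (\<exists>R::real. R > 0 \<and> (\<forall>e\<in>E. form_component \<phi> \<omega> e \<in> C_on b (edge_ball E e R)))"

definition nabla ::
    "('s \<times> 's \<Rightarrow> 's \<times> 's) \<Rightarrow> 'x \<times> 'x \<Rightarrow> (('x \<Rightarrow> 's) \<Rightarrow> real) \<Rightarrow> ('x \<Rightarrow> 's) \<Rightarrow> real" where
  "nabla \<phi> e f \<eta> = f (step \<phi> e \<eta>) - f \<eta>"


section \<open>Group actions\<close>

text \<open>The group \<open>\<int>\<^sup>d\<close>, with coordinates indexed by \<open>1, \<dots>, d\<close>.\<close>

definition Zpow :: "nat \<Rightarrow> (nat \<Rightarrow> int) monoid" where
  "Zpow d = product_group {1..d} (\<lambda>_. integer_group)"

definition acts_on_graph :: "('g, 'm) monoid_scheme \<Rightarrow> ('x \<times> 'x) set \<Rightarrow> ('g \<Rightarrow> 'x \<Rightarrow> 'x) \<Rightarrow> bool" where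
  "acts_on_graph G E \<alpha> \<longleftrightarrow> group_action G UNIV \<alpha> \<and>
     (\<forall>g\<in>carrier G. \<forall>(x, y)\<in>E. (\<alpha> g x, \<alpha> g y) \<in> E)"

definition free_action :: "('g, 'm) monoid_scheme \<Rightarrow> ('g \<Rightarrow> 'x \<Rightarrow> 'x) \<Rightarrow> bool" where
  "free_action G \<alpha> \<longleftrightarrow>
     (\<forall>g\<in>carrier G. \<forall>h\<in>carrier G. (\<exists>x. \<alpha> g x = \<alpha> h x) \<longrightarrow> g = h)"

definition fundamental_domain ::
    "('g, 'm) monoid_scheme \<Rightarrow> ('g \<Rightarrow> 'x \<Rightarrow> 'x) \<Rightarrow> 'x set \<Rightarrow> bool" where
  "fundamental_domain G \<alpha> \<Lambda>0 \<longleftrightarrow> (\<forall>Q\<in>orbits G UNIV \<alpha>. \<exists>!x. x \<in> \<Lambda>0 \<and> x \<in> Q)"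

definition shift_invariant_function ::
    "('g, 'm) monoid_scheme \<Rightarrow> ('g \<Rightarrow> 'x \<Rightarrow> 'x) \<Rightarrow> 's \<Rightarrow> (('x \<Rightarrow> 's) \<Rightarrow> real) \<Rightarrow> bool" where
  "shift_invariant_function G \<alpha> b f \<longleftrightarrow>
     (\<forall>g\<in>carrier G. \<forall>\<eta>\<in>fin_configs b. f (\<eta> \<circ> \<alpha> g) = f \<eta>)"

definition shift_invariant_form ::
    "('g, 'm) monoid_scheme \<Rightarrow> ('g \<Rightarrow> 'x \<Rightarrow> 'x) \<Rightarrow> 's \<Rightarrow> ('x \<times> 'x) set \<Rightarrow> ('s \<times> 's \<Rightarrow> 's \<times> 's) \<Rightarrow>
      (('x \<Rightarrow> 's) \<times> ('x \<Rightarrow> 's) \<Rightarrow> real) \<Rightarrow> bool" where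
  "shift_invariant_form G \<alpha> b E \<phi> \<omega> \<longleftrightarrow>
     (\<forall>g\<in>carrier G. \<forall>(\<eta>, \<eta>')\<in>fin_transitions b E \<phi>. \<omega> (\<eta> \<circ> \<alpha> g, \<eta>' \<circ> \<alpha> g) = \<omega> (\<eta>, \<eta>'))"

end

theory Submission
  imports Defs "HOL-Library.Multiset"
begin

text \<open>
  A closed form has a potential \<open>f\<close> on the configurations of finite support, because its sums along
  closed paths vanish.  The work is to correct \<open>f\<close> by a function of the conserved quantities so that
  it becomes uniform, and then by first moments of conserved quantities so that it becomes
  invariant.

  \<^bold>\<open>Uniformity.\<close>  By irreducible quantification, a configuration supported in a connected set can be
  moved inside this set to any other one with the same conserved quantities.  Such a move changes
  \<open>f\<close> by an amount that depends only on what happens near the set (\<open>move_difference\<close>).  Hence, for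
  two configurations far apart, the excess \<open>f (\<eta> + \<zeta>) - f \<eta> - f \<zeta>\<close> depends only on their conserved
  quantities, provided that \<open>\<zeta>\<close> escapes to a fixed end of the graph; this is the pairing at that end,
  a 2-cocycle on multisets of states.  An end is used, rather than a pair of disjoint regions,
  because any finite configuration can be pushed into any end, so that the pairing is defined
  on all multisets.

  If the pairing is symmetric and the same at all ends, it is the coboundary of a function \<open>g\<close> of
  the conserved quantities (\<open>symmetric_cocycle_splits\<close>; the reals are divisible), and \<open>f\<close> minus
  \<open>g\<close> of the conserved quantities is additive at every end.  Symmetry and independence come from
  the geometry.  For two ends in different components of the complement of a ball, either of two
  configurations may be regarded as the one that escapes, so one pairing is the transpose of the
  other (\<open>pairing_separated\<close>).  With three components this forces both properties.  With
  arbitrarily large balls of connected complement, a configuration inside such a ball does not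
  notice to which end the other one escapes, and the pairings agree; symmetry follows by comparison
  with a separated end or, if no ball disconnects the graph, because both configurations can escape
  from each other.  For a simple interaction the conserved quantities have values in a copy of the
  natural numbers or of the integers, where every cocycle is symmetric because its commutator is
  biadditive and alternating, and transposition then makes the pairings at separated ends equal.

  Finally, a function that is additive at the ends and has a local gradient reacts to a change of
  the state at \<open>x\<close> only through the states in a ball around \<open>x\<close>: the rest of the configuration can
  be carried off to the ends inside the components of the complement of the ball
  (\<open>site_localI\<close>).  In the canonical expansion, which is an inclusion-exclusion sum, this makes the
  terms of large diameter cancel (\<open>site_local_C0_unif\<close>).

  \<^bold>\<open>Invariance.\<close>  For a uniform potential \<open>f\<close> of an invariant form, the difference of the translate of
  \<open>f\<close> by \<open>\<sigma>\<close> and \<open>f\<close> has zero gradient, so it is the sum over all sites of a conserved quantity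
  \<open>X \<sigma>\<close> (\<open>invariant_is_conserved\<close>), and \<open>X\<close> is a homomorphism from \<open>\<int>\<^sup>d\<close> (\<open>shift_cocycle\<close>).
  Let \<open>\<kappa> x\<close> be the group element that carries the fundamental domain to \<open>x\<close>.  Adding
  the function that sums \<open>X (\<kappa> x)\<close> at the state of \<open>x\<close> over all sites \<open>x\<close> makes \<open>f\<close> invariant, and
  in terms of a basis of conserved quantities and of the coordinates of \<open>\<kappa> x\<close> this function is a
  linear combination of the first moments in the theorem.
\<close>


section \<open>Splitting symmetric cocycles\<close>

text \<open>The reals are divisible, hence injective as an abelian group.  In a rational vector space no
transfinite extension is needed beyond the existence of bases: prescribe the values on a maximal
independent subset of the subgroup.  Every other element of the subgroup has a positive multiple
that is an integral combination of basis elements, which determines the value there.\<close>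

lemma additive_extension:
  fixes sc :: "rat \<Rightarrow> 'v::ab_group_add \<Rightarrow> 'v" and K :: "'v set" and l :: "'v \<Rightarrow> real"
  assumes "vector_space sc"
    and ne: "K \<noteq> {}" and diff: "\<And>u v. u \<in> K \<Longrightarrow> v \<in> K \<Longrightarrow> u - v \<in> K"
    and add: "\<And>u v. u \<in> K \<Longrightarrow> v \<in> K \<Longrightarrow> l (u + v) = l u + l v"
  obtains L where "\<And>u v. L (u + v) = L u + L v" "\<And>u. u \<in> K \<Longrightarrow> L u = l u"
proof -
  interpret vs: vector_space sc by fact
  interpret vr: vector_space "\<lambda>(q::rat) (x::real). of_rat q * x"
    by standard (auto simp: algebra_simps of_rat_add of_rat_mult)
  interpret vp: vector_space_pair sc "\<lambda>(q::rat) (x::real). of_rat q * x" ..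
  have zero: "0 \<in> K" using ne diff by (metis all_not_in_conv diff_self)
  have uminus: "- u \<in> K" if "u \<in> K" for u using diff[OF zero that] by simp
  have plus: "u + v \<in> K" if "u \<in> K" "v \<in> K" for u v
    using diff[OF that(1) uminus[OF that(2)]] by simp
  have l0: "l 0 = 0" using add[OF zero zero] by simp
  have l_uminus: "l (- u) = - l u" if "u \<in> K" for u
    using add[OF that uminus[OF that]] l0 by simp
  have nmult: "sc (of_nat n) u \<in> K \<and> l (sc (of_nat n) u) = of_nat n * l u" if "u \<in> K" for u n
  proof (induction n)
    case 0
    then show ?case using zero l0 by simp
  next
    case (Suc n)
    have "sc (of_nat (Suc n)) u = u + sc (of_nat n) u"
      by (simp add: vs.scale_left_distrib)
    then show ?case using Suc that plus[of u "sc (of_nat n) u"] add[of u "sc (of_nat n) u"] by (simp add: algebra_simps)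
  qed
  have imult: "sc (of_int n) u \<in> K \<and> l (sc (of_int n) u) = of_int n * l u" if "u \<in> K" for u n
  proof (cases n rule: int_cases2)
    case (nonneg k) then show ?thesis using nmult[OF that, of k] by simp
  next
    case (nonpos k)
    then show ?thesis using nmult[OF that, of k] uminus l_uminus by simp
  qed
  obtain B where B: "B \<subseteq> K" "vs.independent B" "K \<subseteq> vs.span B"
    using vs.maximal_independent_subset[of K] by blast
  obtain L where L: "Vector_Spaces.linear sc (\<lambda>q x. of_rat q * x) L" "\<forall>x\<in>B. L x = l x"
    using vp.linear_independent_extend[OF B(2), of l] by blast
  interpret L: Vector_Spaces.linear sc "\<lambda>q x. of_rat q * x" L by (fact L(1))
  \<comment> \<open>The vectors with a positive integral multiple in \<open>K\<close> on which \<open>l\<close> and \<open>L\<close> agree form a subspace that contains the basis.\<close>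
  define K' where "K' = {v. \<exists>N::int. N > 0 \<and> sc (of_int N) v \<in> K \<and> l (sc (of_int N) v) = of_int N * L v}"
  have "vs.subspace K'"
  proof (rule vs.subspaceI)
    show "0 \<in> K'" unfolding K'_def using zero l0 L.zero
      by (intro CollectI exI[of _ 1]) simp
  next
    fix v w assume "v \<in> K'" "w \<in> K'"
    then obtain N M where N: "N > 0" "sc (of_int N) v \<in> K" "l (sc (of_int N) v) = of_int N * L v"
      and M: "M > 0" "sc (of_int M) w \<in> K" "l (sc (of_int M) w) = of_int M * L w"
      unfolding K'_def by blast
    have e: "sc (of_int (N * M)) (v + w) = sc (of_int M) (sc (of_int N) v) + sc (of_int N) (sc (of_int M) w)"
      by (simp add: vs.scale_right_distrib mult.commute)
    have "l (sc (of_int (N * M)) (v + w)) = of_int (N * M) * L (v + w)"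
      unfolding e using add[of "sc (of_int M) (sc (of_int N) v)" "sc (of_int N) (sc (of_int M) w)"]
        imult[OF N(2), of M] imult[OF M(2), of N] N(3) M(3)
      by (simp add: L.add distrib_left mult.commute mult.left_commute del: vs.scale_scale)
    moreover have "sc (of_int (N * M)) (v + w) \<in> K"
      unfolding e using plus imult[OF N(2), of M] imult[OF M(2), of N] by blast
    ultimately show "v + w \<in> K'" unfolding K'_def using N(1) M(1)
      by (intro CollectI exI[of _ "N * M"]) simp
  next
    fix q :: rat and v assume "v \<in> K'"
    then obtain N where N: "N > 0" "sc (of_int N) v \<in> K" "l (sc (of_int N) v) = of_int N * L v"
      unfolding K'_def by blast
    obtain p t :: int where pt: "q = of_int p / of_int t" "t > 0"
      using quotient_of_denom_pos[of q] quotient_of_div[of q] by (cases "quotient_of q") blast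
    have e: "sc (of_int (N * t)) (sc q v) = sc (of_int p) (sc (of_int N) v)"
    proof -
      have "of_int (N * t) * q = of_int p * of_int N" using pt by simp
      then show ?thesis by (simp only: vs.scale_scale)
    qed
    have "L (sc q v) = of_rat q * L v" by (rule L.scale)
    then have "l (sc (of_int (N * t)) (sc q v)) = of_int (N * t) * L (sc q v)"
      unfolding e using imult[OF N(2), of p] N(3) pt by (simp add: of_rat_divide)
    moreover have "sc (of_int (N * t)) (sc q v) \<in> K" unfolding e using imult[OF N(2)] by blast
    moreover have "N * t > 0" using N(1) pt(2) by simp
    ultimately show "sc q v \<in> K'" unfolding K'_def by blast
  qed
  moreover have "B \<subseteq> K'" unfolding K'_def using B(1) L(2)
    by (auto intro!: exI[of _ 1])
  ultimately have "K \<subseteq> K'" using B(3) vs.span_minimal by blast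
  have "L u = l u" if u: "u \<in> K" for u
  proof -
    obtain N::int where N: "N > 0" "l (sc (of_int N) u) = of_int N * L u"
      using \<open>K \<subseteq> K'\<close> u unfolding K'_def by blast
    then show ?thesis using imult[OF u, of N] by simp
  qed
  then show ?thesis using that L.add by blast
qed

text \<open>Free commutative monoids have no second cohomology: the cocycle identity dictates how the primitive
\<open>G\<close> grows when one element is added, and symmetry makes the result independent of the order of the
elements.  The fold carries the current multiset along with the value.\<close>

lemma symmetric_cocycle_splits_freely:
  fixes H :: "'s multiset \<Rightarrow> 's multiset \<Rightarrow> real"
  assumes sym: "\<And>m n. H m n = H n m" and zero: "\<And>m. H m {#} = 0"
    and coc: "\<And>m n k. H m n + H (m + n) k = H n k + H m (n + k)"
  obtains G where "\<And>m n. H m n = G (m + n) - G m - G n"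
proof -
  define st where "st = (\<lambda>s (p :: 's multiset \<times> real). (add_mset s (fst p), snd p + H (fst p) {#s#}))"
  interpret comp_fun_commute st
  proof
    fix s t
    \<comment> \<open>Both sides equal \<open>H {#s#} {#t#} + H m {#s, t#}\<close>.\<close>
    have "H m {#s#} + H (add_mset s m) {#t#} = H m {#t#} + H (add_mset t m) {#s#}" for m
      using coc[of m "{#s#}" "{#t#}"] coc[of m "{#t#}" "{#s#}"] sym[of "{#s#}" "{#t#}"]
      by (simp add: add_mset_commute)
    then show "st t \<circ> st s = st s \<circ> st t"
      by (auto simp: st_def fun_eq_iff add_mset_commute add.assoc)
  qed
  define A where "A = fold_mset st ({#}, 0)"
  have A: "A (add_mset s m) = st s (A m)" for s m by (simp add: A_def)
  have fstA: "fst (A m) = m" for m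
    by (induction m) (simp_all add: A st_def, simp add: A_def)
  define G where "G m = snd (A m)" for m
  have G0: "G {#} = 0" by (simp add: G_def A_def)
  have G: "G (add_mset s m) = G m + H m {#s#}" for s m by (simp add: G_def A) (simp add: st_def fstA)
  have "H m n = G (m + n) - G m - G n" for m n
  proof (induction n)
    case empty then show ?case by (simp add: zero G0)
  next
    case (add s n)
    have "H m (add_mset s n) = H m n + H (m + n) {#s#} - H n {#s#}" using coc[of m n "{#s#}"] by simp
    then show ?case using add by (simp add: G)
  qed
  then show ?thesis using that by blast
qed

text \<open>The relation \<open>eqv\<close> stands for having the same conserved quantities.  On the free monoid of
multisets the cocycle has a primitive \<open>G\<close>, which need not respect \<open>eqv\<close>; but its variation over
\<open>eqv\<close>-classes defines an additive function on the group of differences of equivalent multisets.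
Extending this function additively and subtracting it from \<open>G\<close> leaves the coboundary unchanged and
makes \<open>G\<close> constant on classes.\<close>

lemma symmetric_cocycle_splits:
  fixes H :: "'s multiset \<Rightarrow> 's multiset \<Rightarrow> real" and eqv :: "'s multiset \<Rightarrow> 's multiset \<Rightarrow> bool"
  assumes sym: "\<And>m n. H m n = H n m" and zero: "\<And>m. H m {#} = 0"
    and coc: "\<And>m n k. H m n + H (m + n) k = H n k + H m (n + k)"
    and resp: "\<And>m m' n. eqv m m' \<Longrightarrow> H m n = H m' n"
    and refl: "\<And>m. eqv m m" and eqv_sym: "\<And>m n. eqv m n \<Longrightarrow> eqv n m"
    and eqv_add: "\<And>m m' n n'. eqv m m' \<Longrightarrow> eqv n n' \<Longrightarrow> eqv (m + n) (m' + n')"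
  obtains g where "\<And>m n. H m n = g (m + n) - g m - g n" "\<And>m n. eqv m n \<Longrightarrow> g m = g n"
proof -
  obtain G where G: "\<And>m n. H m n = G (m + n) - G m - G n"
    using symmetric_cocycle_splits_freely[OF sym zero coc] by blast
  define dl where "dl m = (\<lambda>s. rat_of_nat (count m s))" for m :: "'s multiset"
  have dl_add: "dl (m + n) = dl m + dl n" for m n by (simp add: dl_def fun_eq_iff)
  define K where "K = {dl m - dl n | m n. eqv m n}"
  define P where "P u mn \<longleftrightarrow> eqv (fst mn) (snd mn) \<and> u = dl (fst mn) - dl (snd mn)" for u mn
  define l where "l u = (let mn = (SOME mn. P u mn) in G (fst mn) - G (snd mn))" for u
  have wd: "G m - G n = G m' - G n'" if "eqv m n" "eqv m' n'" "dl m - dl n = dl m' - dl n'" for m n m' n'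
  proof -
    have "count (m + n') s = count (m' + n) s" for s
    proof -
      have "rat_of_nat (count m s) - rat_of_nat (count n s) = rat_of_nat (count m' s) - rat_of_nat (count n' s)"
        using fun_cong[OF that(3), of s] by (simp only: dl_def minus_apply)
      then have "rat_of_nat (count m s + count n' s) = rat_of_nat (count m' s + count n s)"
        unfolding of_nat_add by linarith
      then show ?thesis by (simp only: of_nat_eq_iff count_union)
    qed
    then have "m + n' = m' + n" by (rule multiset_eqI)
    moreover have "H m n' = H m' n" using resp[OF that(1), of n'] resp[OF that(2), of n] sym by metis
    ultimately show ?thesis using G[of m n'] G[of m' n] by simp
  qed
  have l: "l (dl m - dl n) = G m - G n" if "eqv m n" for m n
  proof -
    have "P (dl m - dl n) (m, n)" using that by (simp add: P_def)
    then have "P (dl m - dl n) (SOME mn. P (dl m - dl n) mn)" by (rule someI)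
    then obtain p where p: "p = (SOME mn. P (dl m - dl n) mn)" "eqv (fst p) (snd p)"
        "dl (fst p) - dl (snd p) = dl m - dl n"
      unfolding P_def by metis
    show ?thesis using wd[OF p(2) that p(3)] by (simp add: l_def Let_def flip: p(1))
  qed
  obtain L where L: "\<And>u v. L (u + v) = L u + L v" "\<And>u. u \<in> K \<Longrightarrow> L u = l u"
  proof (rule additive_extension[of "\<lambda>q f s. q * f s" K l])
    show "vector_space (\<lambda>(q::rat) (f :: 's \<Rightarrow> rat) s. q * f s)"
      by standard (auto simp: fun_eq_iff algebra_simps)
  next
    show "K \<noteq> {}" unfolding K_def using refl by blast
  next
    fix u v assume "u \<in> K" "v \<in> K"
    then obtain m n m' n' where h: "eqv m n" "u = dl m - dl n" "eqv m' n'" "v = dl m' - dl n'"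
      unfolding K_def by blast
    have "u - v = dl (m + n') - dl (n + m')" by (simp add: h dl_add algebra_simps)
    then show "u - v \<in> K" unfolding K_def using eqv_add[OF h(1) eqv_sym[OF h(3)]] by blast
    have "u + v = dl (m + m') - dl (n + n')" by (simp add: h dl_add algebra_simps)
    moreover have "H m m' = H n n'" using resp[OF h(1), of m'] resp[OF h(3), of n] sym by metis
    ultimately show "l (u + v) = l u + l v"
      using l[OF h(1)] l[OF h(3)] l[OF eqv_add[OF h(1,3)]] G[of m m'] G[of n n'] h(2,4) by simp
  qed (use that in blast)
  define g where "g m = G m - L (dl m)" for m
  have "g m = g n" if "eqv m n" for m n
  proof -
    have "dl m - dl n \<in> K" unfolding K_def using that by blast
    then have "L (dl m - dl n) = G m - G n" using L(2) l[OF that] by simp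
    moreover have "L (dl m) = L (dl m - dl n) + L (dl n)" using L(1)[of "dl m - dl n" "dl n"] by simp
    ultimately show ?thesis by (simp add: g_def)
  qed
  moreover have "H m n = g (m + n) - g m - g n" for m n
    by (simp add: g_def G dl_add L(1))
  ultimately show ?thesis using that by blast
qed

text \<open>The commutator pairing of the central extension that belongs to the cocycle.\<close>

lemma cocycle_commutator_additive:
  fixes H :: "'a::comm_monoid_add \<Rightarrow> 'a \<Rightarrow> real"
  assumes coc: "\<And>m n k. H m n + H (m + n) k = H n k + H m (n + k)"
  shows "H m (n + k) - H (n + k) m = (H m n - H n m) + (H m k - H k m)"
  using coc[of m n k] coc[of n k m] coc[of n m k] by (simp add: algebra_simps)


section \<open>Balls, components and ends of a graph\<close>

definition reach :: "('x \<times> 'x) set \<Rightarrow> 'x set \<Rightarrow> 'x \<Rightarrow> 'x set" where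
  "reach E W x = {y. (x, y) \<in> (induced E W)\<^sup>*}"

definition nball :: "('x \<times> 'x) set \<Rightarrow> 'x \<Rightarrow> nat \<Rightarrow> 'x set" where
  "nball E x k = {y. gdist E x y \<le> k}"

lemma rtrancl_induced_in: "(x, y) \<in> (induced E W)\<^sup>* \<Longrightarrow> x \<in> W \<Longrightarrow> y \<in> W"
  by (induction rule: rtrancl_induct) (auto simp: induced_def)

lemma sym_induced: "sym E \<Longrightarrow> sym (induced E W)"
  by (auto simp: sym_def induced_def)

lemma induced_mono: "W \<subseteq> W' \<Longrightarrow> induced E W \<subseteq> induced E W'"
  by (auto simp: induced_def)

lemma gball_nball: "R \<ge> 0 \<Longrightarrow> gball E x R = nball E x (nat \<lfloor>R\<rfloor>)"
  by (auto simp: gball_def nball_def le_nat_iff le_floor_iff)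

locale connected_graph =
  fixes E :: "('x \<times> 'x) set"
  assumes loc: "is_locale UNIV E"
begin

lemma symE: "sym E" and irreflE: "(x, x) \<notin> E" and connE: "(x, y) \<in> E\<^sup>*"
  using loc by (auto simp: is_locale_def irrefl_def connected_subset_def induced_def)

lemma gdist_relpow: "(x, y) \<in> E ^^ gdist E x y"
  unfolding gdist_def using connE[of x y] by (metis LeastI rtrancl_power)

lemma gdist_le: "(x, y) \<in> E ^^ n \<Longrightarrow> gdist E x y \<le> n"
  unfolding gdist_def by (rule Least_le)

lemma gdist_self [simp]: "gdist E x x = 0"
  using gdist_le[of x x 0] by simp

lemma gdist_triangle: "gdist E x z \<le> gdist E x y + gdist E y z"
  by (rule gdist_le) (metis gdist_relpow relcompI relpow_add)

lemma relpow_sym: "(x, y) \<in> E ^^ n \<Longrightarrow> (y, x) \<in> E ^^ n"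
proof (induction n arbitrary: y)
  case (Suc n)
  then obtain z where "(x, z) \<in> E ^^ n" "(z, y) \<in> E" by auto
  then show ?case using Suc.IH symE by (meson relpow_Suc_I2 symD)
qed simp

lemma gdist_commute: "gdist E x y = gdist E y x"
  by (meson antisym gdist_le gdist_relpow relpow_sym)

lemma gdist_edge: "(x, y) \<in> E \<Longrightarrow> gdist E x y \<le> 1"
  by (rule gdist_le) simp

lemma gdist_pred:
  assumes "gdist E x z = Suc k"
  obtains y where "gdist E x y = k" "(y, z) \<in> E"
proof -
  have "(x, z) \<in> E ^^ Suc k" using gdist_relpow[of x z] assms by simp
  then obtain y where y: "(x, y) \<in> E ^^ k" "(y, z) \<in> E" by auto
  then have "gdist E x y \<le> k" "Suc k \<le> gdist E x y + 1"
    using gdist_le gdist_triangle[of x z y] gdist_edge assms by fastforce+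
  then show ?thesis using that y by force
qed

lemma gdist_eq_0: "gdist E x y = 0 \<Longrightarrow> x = y"
  using gdist_relpow[of x y] by simp

lemma finite_neighbours: "finite {y. (x, y) \<in> E}"
proof -
  have "finite {e \<in> E. fst e = x \<or> snd e = x}" using loc by (auto simp: is_locale_def)
  then have "finite (snd ` {e \<in> E. fst e = x \<or> snd e = x})" by (rule finite_imageI)
  then show ?thesis by (rule rev_finite_subset) force
qed

lemma finite_nball: "finite (nball E x k)"
proof (induction k)
  case 0
  have "nball E x 0 \<subseteq> {x}" using gdist_eq_0 by (auto simp: nball_def)
  then show ?case using finite_subset by blast
next
  case (Suc k)
  have "nball E x (Suc k) \<subseteq> nball E x k \<union> (\<Union>y\<in>nball E x k. {z. (y, z) \<in> E})"
  proof
    fix z assume z: "z \<in> nball E x (Suc k)"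
    show "z \<in> nball E x k \<union> (\<Union>y\<in>nball E x k. {z. (y, z) \<in> E})"
    proof (cases "gdist E x z = Suc k")
      case True
      then obtain y where "gdist E x y = k" "(y, z) \<in> E" using gdist_pred by blast
      then show ?thesis by (auto simp: nball_def)
    qed (use z in \<open>auto simp: nball_def\<close>)
  qed
  then show ?case using Suc finite_neighbours by (meson finite_UN finite_Un finite_subset)
qed

lemma nball_mono: "k \<le> l \<Longrightarrow> nball E x k \<subseteq> nball E x l"
  by (auto simp: nball_def)

lemma finite_in_nball:
  assumes "finite A" obtains k where "A \<subseteq> nball E x k"
proof -
  have "A \<subseteq> nball E x (Max (gdist E x ` A))"
    using assms by (auto simp: nball_def)
  then show ?thesis using that by blast
qed

lemma connected_reach: "connected_subset E (reach E W x)" (is ?c)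
  and reach_subset: "x \<in> W \<Longrightarrow> reach E W x \<subseteq> W"
  and reach_self: "x \<in> reach E W x"
proof -
  have *: "(x, y) \<in> (induced E (reach E W x))\<^sup>*" if "(x, y) \<in> (induced E W)\<^sup>*" for y
    using that
  proof (induction rule: rtrancl_induct)
    case (step y z)
    have "(y, z) \<in> induced E (reach E W x)"
      using step.hyps by (auto simp: induced_def reach_def intro: rtrancl_into_rtrancl)
    then show ?case using step.IH by simp
  qed simp
  have "sym ((induced E (reach E W x))\<^sup>*)"
    by (intro sym_rtrancl sym_induced symE)
  then show ?c unfolding connected_subset_def
    using * by (metis (no_types, lifting) mem_Collect_eq reach_def rtrancl_trans symD)
qed (auto simp: reach_def dest: rtrancl_induced_in)

lemma connected_subset_reach:
  assumes "connected_subset E C" "C \<subseteq> W" "x \<in> C" shows "C \<subseteq> reach E W x"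
  using assms rtrancl_mono[OF induced_mono[OF assms(2)]]
  unfolding connected_subset_def reach_def by blast

lemma reach_mono: "W \<subseteq> W' \<Longrightarrow> reach E W x \<subseteq> reach E W' x"
  unfolding reach_def using rtrancl_mono[OF induced_mono] by blast

lemma reach_eq: "y \<in> reach E W x \<Longrightarrow> reach E W y = reach E W x"
  unfolding reach_def using sym_rtrancl[OF sym_induced[OF symE]]
  by (auto intro: rtrancl_trans dest: symD)

lemma reach_step: "y \<in> reach E W x \<Longrightarrow> x \<in> W \<Longrightarrow> (y, z) \<in> E \<Longrightarrow> z \<in> W \<Longrightarrow> z \<in> reach E W x"
  using rtrancl_induced_in[of x y E W] unfolding reach_def induced_def
  by (auto intro: rtrancl_into_rtrancl)

lemma connected_nball: "connected_subset E (nball E x k)"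
proof -
  have "y \<in> reach E (nball E x k) x" if "gdist E x y = j" "j \<le> k" for y j
    using that
  proof (induction j arbitrary: y)
    case 0
    then show ?case using gdist_eq_0 reach_self by metis
  next
    case (Suc j)
    then obtain z where "gdist E x z = j" "(z, y) \<in> E" using gdist_pred by blast
    then show ?case using Suc reach_step[of z "nball E x k" x y] by (auto simp: nball_def)
  qed
  then have "nball E x k \<subseteq> reach E (nball E x k) x" by (auto simp: nball_def)
  moreover have "reach E (nball E x k) x \<subseteq> nball E x k" by (rule reach_subset) (simp add: nball_def)
  ultimately show ?thesis using connected_reach[of "nball E x k" x] by simp
qed

lemma connected_UNIV: "connected_subset E UNIV"
  using connE by (simp add: connected_subset_def induced_def)

text \<open>Irreducible quantification speaks of finite graphs; this lemma makes it available on infinite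
connected sets.\<close>

lemma finite_connected_superset:
  assumes "connected_subset E W" "finite A" "A \<subseteq> W"
  obtains Y where "finite Y" "A \<subseteq> Y" "Y \<subseteq> W" "connected_subset E Y"
proof (cases "A = {}")
  case True
  then show ?thesis using that[of "{}"] by (simp add: connected_subset_def)
next
  case False
  then obtain a where a: "a \<in> A" by blast
  have ex: "\<exists>Y. finite Y \<and> Y \<subseteq> W \<and> a \<in> Y \<and> y \<in> reach E Y a" if y: "y \<in> W" for y
  proof -
    have "(a, y) \<in> (induced E W)\<^sup>*" using assms a y by (auto simp: connected_subset_def)
    then show ?thesis
    proof (induction rule: rtrancl_induct)
      case base
      then show ?case using a assms reach_self by (intro exI[of _ "{a}"]) auto
    next
      case (step y z)
      then obtain Y where Y: "finite Y" "Y \<subseteq> W" "a \<in> Y" "y \<in> reach E Y a" by blast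
      have "y \<in> reach E (insert z Y) a" using Y(4) reach_mono[of Y "insert z Y"] by blast
      then have "z \<in> reach E (insert z Y) a"
        by (rule reach_step) (use step.hyps Y(3) in \<open>auto simp: induced_def\<close>)
      then show ?case using Y step.hyps by (intro exI[of _ "insert z Y"]) (auto simp: induced_def)
    qed
  qed
  define P where "P y = (SOME Y. finite Y \<and> Y \<subseteq> W \<and> a \<in> Y \<and> y \<in> reach E Y a)" for y
  have P: "finite (P y) \<and> P y \<subseteq> W \<and> a \<in> P y \<and> y \<in> reach E (P y) a" if "y \<in> W" for y
    unfolding P_def by (rule someI_ex[OF ex[OF that]])
  define Y where "Y = (\<Union>y\<in>A. reach E (P y) a)"
  have sub: "reach E (P y) a \<subseteq> P y" if "y \<in> A" for y
    using P that assms(3) by (intro reach_subset) auto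
  have "Y \<subseteq> reach E Y a"
  proof
    fix z assume "z \<in> Y"
    then obtain y where y: "y \<in> A" "z \<in> reach E (P y) a" unfolding Y_def by blast
    have "reach E (P y) a \<subseteq> reach E Y a"
      using connected_subset_reach[OF connected_reach[of "P y" a], of Y a] y(1) reach_self Y_def by blast
    then show "z \<in> reach E Y a" using y(2) by blast
  qed
  moreover have aY: "a \<in> Y" unfolding Y_def using a reach_self by blast
  moreover have "reach E Y a \<subseteq> Y" using reach_subset[OF aY] .
  ultimately have "connected_subset E Y" using connected_reach[of Y a] by simp
  moreover have "finite Y" unfolding Y_def using assms(2,3) P sub
    by (intro finite_UN_I) (auto intro: finite_subset[OF sub])
  moreover have "A \<subseteq> Y" unfolding Y_def using P assms(3) by blast
  moreover have "Y \<subseteq> W" unfolding Y_def using sub P assms(3) by blast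
  ultimately show ?thesis using that by blast
qed

end

locale wt_graph = connected_graph E for E :: "('x \<times> 'x) set" +
  assumes wt: "weakly_transferable E"
begin

lemma infinite_reach:
  assumes "y \<notin> nball E x k" shows "infinite (reach E (- nball E x k) y)"
proof -
  obtain R where R: "R > 0" "gball E x R = nball E x k"
  proof (cases "k = 0")
    case True then show ?thesis using that[of "1/2"] gball_nball[of "1/2" E x] by simp
  next
    case False then show ?thesis using that[of "real k"] gball_nball[of "real k" E x] by simp
  qed
  then have "finite_union_of_infinite_connected E (- nball E x k)"
    using wt unfolding weakly_transferable_def by metis
  then obtain P where P: "partition_on (- nball E x k) P" "\<forall>C\<in>P. connected_subset E C \<and> infinite C"
    unfolding finite_union_of_infinite_connected_def by blast
  obtain C where C: "C \<in> P" "y \<in> C" "C \<subseteq> - nball E x k"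
    using P(1) assms unfolding partition_on_def by blast
  then show ?thesis using connected_subset_reach P(2) by (metis finite_subset)
qed

lemma outside_nball: obtains y where "y \<notin> nball E x k"
proof -
  have "finite_union_of_infinite_connected E (- gball E x (real (Suc k)))"
    using wt unfolding weakly_transferable_def by simp
  then obtain P C where "partition_on (- gball E x (real (Suc k))) P" "C \<in> P"
    unfolding finite_union_of_infinite_connected_def by blast
  then obtain y where "y \<notin> gball E x (real (Suc k))"
    unfolding partition_on_def by (metis ComplD UnionI all_not_in_conv)
  then have "y \<notin> nball E x k" by (auto simp: gball_def nball_def)
  then show ?thesis using that by blast
qed

lemma infinite_UNIV: "infinite (UNIV :: 'x set)"
  using outside_nball infinite_reach by (metis finite_subset subset_UNIV)

lemma card_nball: "card (nball E x k) > k"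
proof -
  have "\<exists>y. gdist E x y = j" for j
  proof -
    obtain y where y: "y \<notin> nball E x j" using outside_nball by blast
    have "\<exists>y. gdist E x y = j" if "gdist E x y = j + i" for i y
      using that
    proof (induction i arbitrary: y)
      case (Suc i)
      then show ?case using gdist_pred[of x y "j + i"] by (metis add_Suc_right)
    qed auto
    then show ?thesis using y by (metis le_add_diff_inverse linorder_not_less nball_def mem_Collect_eq order_less_imp_le)
  qed
  then obtain p where p: "\<And>j. gdist E x (p j) = j" by metis
  then have "inj p" by (metis injI)
  then have "card (p ` {..k}) = Suc k" by (simp add: card_image inj_on_subset)
  moreover have "p ` {..k} \<subseteq> nball E x k" using p by (auto simp: nball_def)
  ultimately show ?thesis using card_mono[OF finite_nball] by (metis Suc_le_eq)
qed

text \<open>Decreasing connected sets, instead of compatible families of components of the complements of balls,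
allow an end to be prescribed inside any given component.\<close>

definition is_end :: "'x \<Rightarrow> (nat \<Rightarrow> 'x set) \<Rightarrow> bool" where
  "is_end x \<epsilon> \<longleftrightarrow> (\<forall>k. connected_subset E (\<epsilon> k) \<and> infinite (\<epsilon> k) \<and>
     \<epsilon> k \<inter> nball E x k = {} \<and> \<epsilon> (Suc k) \<subseteq> \<epsilon> k)"

lemma is_end_antimono: "is_end x \<epsilon> \<Longrightarrow> k \<le> l \<Longrightarrow> \<epsilon> l \<subseteq> \<epsilon> k"
  by (rule lift_Suc_antimono_le) (auto simp: is_end_def)

text \<open>All components of complements of balls are infinite, so one can choose successively a component
inside the previous one outside ever larger balls.\<close>

lemma end_in_component:
  assumes "y \<notin> nball E z l"
  obtains \<epsilon> where "is_end x \<epsilon>" "\<And>k. \<epsilon> k \<subseteq> reach E (- nball E z l) y"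
proof -
  \<comment> \<open>Shifting the radii by \<open>K\<close> keeps the whole construction outside the given ball.\<close>
  obtain K where K: "nball E z l \<subseteq> nball E x K" using finite_in_nball[OF finite_nball] by blast
  define A where "A k = - nball E x (K + k)" for k
  have inf: "infinite (reach E (A k) v)" if "v \<in> A k" for k v
    using infinite_reach[of v x "K + k"] that by (simp add: A_def)
  have step: "\<exists>w. w \<in> reach E W v \<inter> A k" if "infinite (reach E W v)" for W v k
  proof (rule ccontr)
    assume "\<nexists>w. w \<in> reach E W v \<inter> A k"
    then have "reach E W v \<subseteq> nball E x (K + k)" by (auto simp: A_def)
    then show False using that finite_nball finite_subset by blast
  qed
  have "\<exists>v. \<forall>k. (v k \<in> A k \<and> (k = 0 \<longrightarrow> v k \<in> reach E (- nball E z l) y)) \<and> v (Suc k) \<in> reach E (A k) (v k)"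
  proof (rule dependent_nat_choice)
    show "\<exists>v. v \<in> A 0 \<and> (0 = 0 \<longrightarrow> v \<in> reach E (- nball E z l) y)"
      using step[OF infinite_reach[OF assms], of 0] by blast
  next
    fix v and k :: nat assume "v \<in> A k \<and> (k = 0 \<longrightarrow> v \<in> reach E (- nball E z l) y)"
    then show "\<exists>w. (w \<in> A (Suc k) \<and> (Suc k = 0 \<longrightarrow> w \<in> reach E (- nball E z l) y)) \<and> w \<in> reach E (A k) v"
      using step[OF inf, of v k "Suc k"] by blast
  qed
  then obtain v where v: "\<And>k. v k \<in> A k" "v 0 \<in> reach E (- nball E z l) y"
      "\<And>k. v (Suc k) \<in> reach E (A k) (v k)" by blast
  define \<epsilon> where "\<epsilon> k = reach E (A k) (v k)" for k
  have A: "A (Suc k) \<subseteq> A k" for k unfolding A_def using nball_mono[of "K + k" "K + Suc k"] by auto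
  have dec: "\<epsilon> (Suc k) \<subseteq> \<epsilon> k" for k
    unfolding \<epsilon>_def using reach_mono[OF A] reach_eq[OF v(3)] by metis
  have "\<epsilon> k \<inter> nball E x k = {}" for k
    using reach_subset[OF v(1)[of k]] nball_mono[of k "K + k" x] unfolding \<epsilon>_def A_def by auto
  then have "is_end x \<epsilon>" unfolding is_end_def
    using dec connected_reach inf[OF v(1)] by (simp add: \<epsilon>_def)
  moreover have "\<epsilon> k \<subseteq> reach E (- nball E z l) y" for k
  proof -
    have "\<epsilon> k \<subseteq> \<epsilon> 0" by (rule lift_Suc_antimono_le[of \<epsilon>, OF dec]) simp
    also have "\<dots> \<subseteq> reach E (- nball E z l) (v 0)"
      unfolding \<epsilon>_def by (rule reach_mono) (use K in \<open>auto simp: A_def\<close>)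
    also have "\<dots> = reach E (- nball E z l) y" using v(2) by (rule reach_eq)
    finally show ?thesis .
  qed
  ultimately show ?thesis using that by blast
qed

lemma end_exists: obtains \<epsilon> where "is_end x \<epsilon>"
  using outside_nball end_in_component by metis

lemma end_eventually_in_component:
  assumes "is_end x \<epsilon>"
  obtains y k where "y \<notin> nball E z l" "\<epsilon> k \<subseteq> reach E (- nball E z l) y"
proof -
  obtain k where k: "nball E z l \<subseteq> nball E x k" using finite_in_nball[OF finite_nball] by blast
  have e: "connected_subset E (\<epsilon> k)" "infinite (\<epsilon> k)" "\<epsilon> k \<inter> nball E x k = {}"
    using assms by (auto simp: is_end_def)
  then obtain y where y: "y \<in> \<epsilon> k" by fastforce
  have "\<epsilon> k \<subseteq> - nball E z l" using e(3) k by blast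
  then show ?thesis using that[of y k] connected_subset_reach[OF e(1) _ y] y by blast
qed

definition separated :: "nat \<Rightarrow> (nat \<Rightarrow> 'x set) \<Rightarrow> (nat \<Rightarrow> 'x set) \<Rightarrow> bool" where
  "separated r \<epsilon> \<epsilon>' \<longleftrightarrow> (\<exists>k. \<forall>y\<in>\<epsilon> k. \<forall>z\<in>\<epsilon>' k. gdist E y z > r)"

text \<open>A path that leaves a component of the complement of a ball passes through the ball.\<close>

lemma dist_component:
  assumes "u \<in> reach E (- nball E z l) y" "y \<notin> nball E z l"
    and "w \<notin> reach E (- nball E z l) y"
  shows "gdist E z u \<le> l + gdist E u w"
proof -
  have "\<exists>v\<in>nball E z l. gdist E u v \<le> n" if "(u, w) \<in> E ^^ n" "w \<notin> reach E (- nball E z l) y" for n w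
    using that
  proof (induction n arbitrary: w)
    case 0 then show ?case using assms(1) by simp
  next
    case (Suc n)
    then obtain w' where w': "(u, w') \<in> E ^^ n" "(w', w) \<in> E" by auto
    show ?case
    proof (cases "w' \<in> reach E (- nball E z l) y")
      case True
      then have "w \<in> nball E z l" using reach_step[OF True _ w'(2)] Suc.prems(2) assms(2) by blast
      then show ?thesis using gdist_le[OF Suc.prems(1)] by blast
    next
      case False
      then show ?thesis using Suc.IH[OF w'(1) False] le_SucI by blast
    qed
  qed
  then obtain v where "v \<in> nball E z l" "gdist E u v \<le> gdist E u w"
    using gdist_relpow assms(3) by blast
  then show ?thesis using gdist_triangle[of z u v] gdist_commute[of u v] by (auto simp: nball_def)
qed

text \<open>Far out in its component, the end \<open>\<epsilon>\<close> is far from the ball, and points outside the component are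
even further away.\<close>

lemma separated_if_components:
  assumes "is_end x \<epsilon>" "is_end x \<epsilon>'"
    and "\<epsilon> j \<subseteq> reach E (- nball E z l) y" "y \<notin> nball E z l"
    and "\<epsilon>' i \<inter> reach E (- nball E z l) y = {}"
  shows "separated r \<epsilon> \<epsilon>'"
proof -
  obtain K where K: "nball E z (l + r) \<subseteq> nball E x K" using finite_in_nball[OF finite_nball] by blast
  define k where "k = max K (max i j)"
  have sub: "\<epsilon> k \<subseteq> \<epsilon> j" "\<epsilon>' k \<subseteq> \<epsilon>' i" using assms(1,2) is_end_antimono by (auto simp: k_def)
  have "gdist E u w > r" if "u \<in> \<epsilon> k" "w \<in> \<epsilon>' k" for u w
  proof -
    have "u \<notin> nball E x k" using assms(1) that(1) by (auto simp: is_end_def)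
    moreover have "K \<le> k" by (simp add: k_def)
    ultimately have "u \<notin> nball E z (l + r)" using K nball_mono[of K k x] by blast
    then have "gdist E z u > l + r" by (simp add: nball_def)
    moreover have "gdist E z u \<le> l + gdist E u w"
      by (rule dist_component[where y = y]) (use assms sub that in auto)
    ultimately show ?thesis by simp
  qed
  then show ?thesis unfolding separated_def by blast
qed

end


section \<open>Configurations and moves\<close>

definition supp :: "'s \<Rightarrow> ('v \<Rightarrow> 's) \<Rightarrow> 'v set" where
  "supp b \<eta> = {x. \<eta> x \<noteq> b}"

text \<open>This plays the role of the sum of two configurations with disjoint supports.\<close>

definition merge :: "'s \<Rightarrow> ('v \<Rightarrow> 's) \<Rightarrow> ('v \<Rightarrow> 's) \<Rightarrow> 'v \<Rightarrow> 's" where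
  "merge b \<eta> \<theta> = (\<lambda>x. if \<eta> x = b then \<theta> x else \<eta> x)"

definition content :: "'s \<Rightarrow> ('v \<Rightarrow> 's) \<Rightarrow> 's multiset" where
  "content b \<eta> = image_mset \<eta> (mset_set (supp b \<eta>))"

definition cequiv :: "'s \<Rightarrow> ('s \<times> 's \<Rightarrow> 's \<times> 's) \<Rightarrow> 's multiset \<Rightarrow> 's multiset \<Rightarrow> bool" where
  "cequiv b \<phi> m n \<longleftrightarrow> (\<forall>\<xi>\<in>Consv b \<phi>. (\<Sum>s\<in>#m. \<xi> s) = (\<Sum>s\<in>#n. \<xi> s))"

lemma fin_configs_supp: "\<eta> \<in> fin_configs b \<longleftrightarrow> finite (supp b \<eta>)"
  by (simp add: fin_configs_def supp_def)

lemma supp_merge [simp]: "supp b (merge b \<eta> \<theta>) = supp b \<eta> \<union> supp b \<theta>"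
  by (auto simp: supp_def merge_def)

lemma supp_base [simp]: "supp b (\<lambda>_. b) = {}"
  by (simp add: supp_def)

lemma merge_base [simp]: "merge b \<eta> (\<lambda>_. b) = \<eta>" "merge b (\<lambda>_. b) \<eta> = \<eta>"
  by (auto simp: merge_def)

lemma merge_assoc: "merge b (merge b \<eta> \<theta>) \<zeta> = merge b \<eta> (merge b \<theta> \<zeta>)"
  by (auto simp: merge_def)

lemma merge_commute: "supp b \<eta> \<inter> supp b \<theta> = {} \<Longrightarrow> merge b \<eta> \<theta> = merge b \<theta> \<eta>"
  by (auto simp: merge_def supp_def fun_eq_iff)

lemma content_base [simp]: "content b (\<lambda>_. b) = {#}"
  by (simp add: content_def)

lemma content_merge:
  assumes "finite (supp b \<eta>)" "finite (supp b \<theta>)" "supp b \<eta> \<inter> supp b \<theta> = {}"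
  shows "content b (merge b \<eta> \<theta>) = content b \<eta> + content b \<theta>"
proof -
  have "image_mset (merge b \<eta> \<theta>) (mset_set (supp b \<eta>)) = image_mset \<eta> (mset_set (supp b \<eta>))"
    using assms by (intro image_mset_cong) (auto simp: merge_def supp_def)
  moreover have "image_mset (merge b \<eta> \<theta>) (mset_set (supp b \<theta>)) = image_mset \<theta> (mset_set (supp b \<theta>))"
    using assms by (intro image_mset_cong) (auto simp: merge_def supp_def)
  ultimately show ?thesis
    using assms by (simp add: content_def mset_set_Union)
qed

lemma content_sum:
  fixes \<xi> :: "'s \<Rightarrow> real"
  assumes "finite A" "supp b \<eta> \<subseteq> A" "\<xi> b = 0"
  shows "(\<Sum>s\<in>#content b \<eta>. \<xi> s) = (\<Sum>x\<in>A. \<xi> (\<eta> x))"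
proof -
  have "(\<Sum>s\<in>#content b \<eta>. \<xi> s) = (\<Sum>x\<in>supp b \<eta>. \<xi> (\<eta> x))"
    by (simp add: content_def image_mset.compositionality comp_def sum_unfold_sum_mset)
  also have "\<dots> = (\<Sum>x\<in>A. \<xi> (\<eta> x))"
    using assms by (intro sum.mono_neutral_left) (auto simp: supp_def)
  finally show ?thesis .
qed

lemma cequiv_refl [simp]: "cequiv b \<phi> m m"
  and cequiv_sym: "cequiv b \<phi> m n \<Longrightarrow> cequiv b \<phi> n m"
  and cequiv_trans: "cequiv b \<phi> m n \<Longrightarrow> cequiv b \<phi> n p \<Longrightarrow> cequiv b \<phi> m p"
  and cequiv_add: "cequiv b \<phi> m m' \<Longrightarrow> cequiv b \<phi> n n' \<Longrightarrow> cequiv b \<phi> (m + n) (m' + n')"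
  by (auto simp: cequiv_def)

lemma cequiv_content:
  assumes "finite A" "supp b \<eta> \<subseteq> A" "supp b \<eta>' \<subseteq> A"
  shows "cequiv b \<phi> (content b \<eta>) (content b \<eta>') \<longleftrightarrow>
    (\<forall>\<xi>\<in>Consv b \<phi>. (\<Sum>x\<in>A. \<xi> (\<eta> x)) = (\<Sum>x\<in>A. \<xi> (\<eta>' x)))"
proof -
  have "(\<Sum>s\<in>#content b \<eta>. \<xi> s) = (\<Sum>x\<in>A. \<xi> (\<eta> x))" "(\<Sum>s\<in>#content b \<eta>'. \<xi> s) = (\<Sum>x\<in>A. \<xi> (\<eta>' x))"
    if "\<xi> \<in> Consv b \<phi>" for \<xi>
    using content_sum[OF assms(1), of b _ \<xi>] assms(2,3) that by (auto simp: Consv_def)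
  then show ?thesis by (simp add: cequiv_def)
qed

lemma step_apply:
  "step \<phi> e \<eta> = \<eta>(fst e := fst (\<phi> (\<eta> (fst e), \<eta> (snd e))), snd e := snd (\<phi> (\<eta> (fst e), \<eta> (snd e))))"
  by (simp add: step_def split: prod.split)

lemma supp_step: "supp b (step \<phi> e \<eta>) \<subseteq> supp b \<eta> \<union> {fst e, snd e}"
  by (auto simp: step_apply supp_def split: if_splits)

lemma step_merge:
  assumes "fst e \<notin> supp b \<theta>" "snd e \<notin> supp b \<theta>"
  shows "step \<phi> e (merge b \<eta> \<theta>) = merge b (step \<phi> e \<eta>) \<theta>"
  using assms by (auto simp: step_apply merge_def supp_def fun_eq_iff)

lemma content_step:
  assumes "finite (supp b \<eta>)" "fst e \<noteq> snd e"
  shows "cequiv b \<phi> (content b (step \<phi> e \<eta>)) (content b \<eta>)"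
proof -
  define A where "A = supp b \<eta> \<union> {fst e, snd e}"
  have A: "finite A" "fst e \<in> A" "snd e \<in> A - {fst e}" using assms by (auto simp: A_def)
  have sums: "(\<Sum>x\<in>A. \<xi> (step \<phi> e \<eta> x)) = (\<Sum>x\<in>A. \<xi> (\<eta> x))" if \<xi>: "\<xi> \<in> Consv b \<phi>" for \<xi>
  proof -
    have split: "(\<Sum>x\<in>A. g x) = g (fst e) + (g (snd e) + (\<Sum>x\<in>A - {fst e} - {snd e}. g x))"
      for g :: "'a \<Rightarrow> real"
      using sum.remove[OF A(1,2), of g] sum.remove[OF _ A(3), of g] A(1) by simp
    have "(\<Sum>x\<in>A - {fst e} - {snd e}. \<xi> (step \<phi> e \<eta> x)) = (\<Sum>x\<in>A - {fst e} - {snd e}. \<xi> (\<eta> x))"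
      by (intro sum.cong) (auto simp: step_apply)
    moreover have "\<xi> (step \<phi> e \<eta> (fst e)) + \<xi> (step \<phi> e \<eta> (snd e)) = \<xi> (\<eta> (fst e)) + \<xi> (\<eta> (snd e))"
      using \<xi> assms(2) by (simp add: Consv_def step_apply)
    ultimately show ?thesis unfolding split by simp
  qed
  have sub: "supp b (step \<phi> e \<eta>) \<subseteq> A" "supp b \<eta> \<subseteq> A"
    unfolding A_def by (rule supp_step) auto
  show ?thesis using cequiv_content[OF A(1) sub] sums by simp
qed

lemma content_single: "s \<noteq> b \<Longrightarrow> content b ((\<lambda>_. b)(x := s)) = {#s#}"
proof -
  assume "s \<noteq> b"
  then have "supp b ((\<lambda>_. b)(x := s)) = {x}" by (auto simp: supp_def)
  then show ?thesis by (simp add: content_def)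
qed

lemma cequiv_single: "cequiv b \<phi> (content b ((\<lambda>_. b)(x := s))) {#s#}"
proof (cases "s = b")
  case True
  then have "(\<lambda>_. b)(x := s) = (\<lambda>_. b)" by auto
  then show ?thesis by (simp add: cequiv_def Consv_def True)
qed (simp add: content_single)

text \<open>Up to conserved quantities, a multiset can be laid out on any set with enough room.  Only
equivalence is claimed, because a multiset may contain the base state, which leaves no trace in a
configuration.\<close>

lemma realize_content:
  assumes "infinite W \<or> size m \<le> card W"
  obtains \<eta> where "supp b \<eta> \<subseteq> W" "finite (supp b \<eta>)" "cequiv b \<phi> (content b \<eta>) m"
proof -
  have "\<exists>\<eta>. supp b \<eta> \<subseteq> W \<and> finite (supp b \<eta>) \<and> card (supp b \<eta>) \<le> size m \<and> cequiv b \<phi> (content b \<eta>) m"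
    using assms
  proof (induction m)
    case empty
    then show ?case by (intro exI[of _ "\<lambda>_. b"]) simp
  next
    case (add s m)
    then obtain \<eta> where \<eta>: "supp b \<eta> \<subseteq> W" "finite (supp b \<eta>)" "card (supp b \<eta>) \<le> size m"
        "cequiv b \<phi> (content b \<eta>) m" by fastforce
    have "supp b \<eta> \<noteq> W" using add.prems \<eta>(2,3) by auto
    then obtain x where x: "x \<in> W" "x \<notin> supp b \<eta>" using \<eta>(1) by blast
    define \<zeta> where "\<zeta> = (\<lambda>_. b)(x := s)"
    have \<zeta>: "supp b \<zeta> \<subseteq> {x}" by (auto simp: \<zeta>_def supp_def)
    have dis: "supp b \<zeta> \<inter> supp b \<eta> = {}" using \<zeta> x by blast
    have "cequiv b \<phi> (content b (merge b \<zeta> \<eta>)) ({#s#} + m)"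
      unfolding content_merge[OF finite_subset[OF \<zeta>] \<eta>(2) dis, simplified]
      by (intro cequiv_add \<eta>(4)) (simp add: \<zeta>_def cequiv_single)
    moreover have "card (supp b (merge b \<zeta> \<eta>)) \<le> size (add_mset s m)"
    proof -
      have "card (supp b (merge b \<zeta> \<eta>)) \<le> card (insert x (supp b \<eta>))"
        using \<zeta> \<eta>(2) by (intro card_mono) auto
      also have "\<dots> \<le> size (add_mset s m)" using \<eta>(2,3) x by simp
      finally show ?thesis .
    qed
    moreover have "supp b (merge b \<zeta> \<eta>) \<subseteq> W" using \<zeta> x \<eta>(1) by auto
    moreover have "finite (supp b (merge b \<zeta> \<eta>))" using \<zeta> \<eta>(2) by (auto intro: finite_subset)
    ultimately show ?case by (intro exI[of _ "merge b \<zeta> \<eta>"]) simp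
  qed
  then show ?thesis using that by blast
qed

lemma cequiv_common: "cequiv b \<phi> m p \<Longrightarrow> cequiv b \<phi> n p \<Longrightarrow> cequiv b \<phi> m n"
  by (auto simp: cequiv_def)

locale system = wt_graph E for E :: "('x \<times> 'x) set" +
  fixes b :: 's and \<phi> :: "'s \<times> 's \<Rightarrow> 's \<times> 's"
  assumes irr: "irreducibly_quantified b \<phi>"
begin

abbreviation ceq (infix "\<sim>\<^sub>c" 50) where "m \<sim>\<^sub>c n \<equiv> cequiv b \<phi> m n"

definition moves :: "'x set \<Rightarrow> (('x \<Rightarrow> 's) \<times> ('x \<Rightarrow> 's)) set" where
  "moves W = {(\<eta>, step \<phi> e \<eta>) | \<eta> e. e \<in> induced E W \<and> finite (supp b \<eta>) \<and> supp b \<eta> \<subseteq> W}"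

lemma moves_mono: "W \<subseteq> W' \<Longrightarrow> moves W \<subseteq> moves W'"
  unfolding moves_def induced_def by blast

text \<open>The finite graph is transported to the natural numbers, where irreducible quantification is stated,
and the path found there is transported back.\<close>

lemma finite_moves_connect:
  assumes Y: "connected_subset E Y" "finite Y"
    and supp: "supp b \<eta> \<subseteq> Y" "supp b \<eta>' \<subseteq> Y"
    and ceq: "content b \<eta> \<sim>\<^sub>c content b \<eta>'"
  shows "(\<eta>, \<eta>') \<in> (moves Y)\<^sup>*"
proof -
  obtain g :: "'x \<Rightarrow> nat" where "bij_betw g Y {0..<card Y}"
    using ex_bij_betw_finite_nat[OF Y(2)] by blast
  then have g: "inj_on g Y" by (simp add: bij_betw_def)
  define V where "V = g ` Y"
  define E' where "E' = (\<lambda>(x, y). (g x, g y)) ` induced E Y"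
  define T where "T = transitions V E' \<phi>"
  define code where "code \<eta> = restrict (\<lambda>n. \<eta> (inv_into Y g n)) V" for \<eta> :: "'x \<Rightarrow> 's"
  define dec where "dec \<zeta> = (\<lambda>x. if x \<in> Y then \<zeta> (g x) else b)" for \<zeta> :: "nat \<Rightarrow> 's"
  have code_g: "code \<eta> (g x) = \<eta> x" if "x \<in> Y" for \<eta> x
    using that g by (simp add: code_def V_def)
  have dec_code: "dec (code \<eta>) = \<eta>" if "supp b \<eta> \<subseteq> Y" for \<eta>
    using that by (auto simp: dec_def code_g fun_eq_iff supp_def)
  have locV: "is_locale V E'"
    unfolding is_locale_def
  proof (intro conjI ballI)
    show "E' \<subseteq> V \<times> V" by (auto simp: E'_def V_def induced_def)
    show "sym E'" using sym_induced[OF symE, of Y] by (auto simp: E'_def sym_def)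
    show "irrefl E'"
      using irreflE inj_onD[OF g] by (fastforce simp: E'_def irrefl_def induced_def)
    have "finite E'" using Y(2) unfolding E'_def induced_def by auto
    then show "finite {e \<in> E'. fst e = n \<or> snd e = n}" for n by simp
    have "(g x, g y) \<in> (induced E' V)\<^sup>*" if "x \<in> Y" "y \<in> Y" for x y
    proof -
      have "(x, y) \<in> (induced E Y)\<^sup>*" using Y(1) that by (simp add: connected_subset_def)
      then show ?thesis
      proof (induction rule: rtrancl_induct)
        case (step y z)
        have "(g y, g z) \<in> induced E' V" using step.hyps(2) by (auto simp: E'_def V_def induced_def)
        then show ?case using step.IH by simp
      qed simp
    qed
    then show "connected_subset E' V" by (auto simp: connected_subset_def V_def)
  qed
  have finV: "finite V" using Y(2) by (simp add: V_def)
  have code: "code \<eta> \<in> V \<rightarrow>\<^sub>E UNIV" for \<eta> by (simp add: code_def)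
  have sums: "consv_sum \<xi> V (code \<eta>) = consv_sum \<xi> V (code \<eta>')" if "\<xi> \<in> Consv b \<phi>" for \<xi>
  proof -
    have "consv_sum \<xi> V (code \<eta>) = (\<Sum>x\<in>Y. \<xi> (\<eta> x))" for \<eta>
      using Y(2) g by (simp add: consv_sum_def infsum_finite V_def sum.reindex code_g)
    then show ?thesis using ceq that cequiv_content[OF Y(2) supp] by simp
  qed
  have path: "(code \<eta>, code \<eta>') \<in> T\<^sup>*"
    unfolding T_def
    by (rule irr[unfolded irreducibly_quantified_def, rule_format, OF _ code code sums])
      (auto intro: locV finV)
  have one: "(dec \<zeta>, dec \<zeta>') \<in> moves Y" if step: "(\<zeta>, \<zeta>') \<in> T" for \<zeta> \<zeta>'
  proof -
    obtain x y where xy: "(x, y) \<in> induced E Y" "\<zeta>' = step \<phi> (g x, g y) \<zeta>"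
      using step unfolding T_def transitions_def E'_def by auto
    have in_Y: "x \<in> Y" "y \<in> Y" using xy(1) by (auto simp: induced_def)
    have "dec \<zeta>' = step \<phi> (x, y) (dec \<zeta>)"
      using in_Y inj_on_eq_iff[OF g] by (auto simp: xy(2) step_apply dec_def fun_eq_iff)
    moreover have "supp b (dec \<zeta>) \<subseteq> Y" by (auto simp: supp_def dec_def)
    ultimately show ?thesis using xy(1) Y(2) finite_subset unfolding moves_def by blast
  qed
  have "(dec (code \<eta>), dec (code \<eta>')) \<in> (moves Y)\<^sup>*"
    using path
  proof (induction rule: rtrancl_induct)
    case (step \<zeta> \<zeta>')
    show ?case by (rule rtrancl_into_rtrancl[OF step.IH one[OF step.hyps(2)]])
  qed simp
  then show ?thesis by (simp add: dec_code supp)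
qed

lemma moves_connect:
  assumes W: "connected_subset E W"
    and fin: "finite (supp b \<eta>)" "finite (supp b \<eta>')"
    and supp: "supp b \<eta> \<subseteq> W" "supp b \<eta>' \<subseteq> W"
    and ceq: "content b \<eta> \<sim>\<^sub>c content b \<eta>'"
  shows "(\<eta>, \<eta>') \<in> (moves W)\<^sup>*"
proof -
  obtain Y where Y: "finite Y" "supp b \<eta> \<union> supp b \<eta>' \<subseteq> Y" "Y \<subseteq> W" "connected_subset E Y"
    using finite_connected_superset[OF W, of "supp b \<eta> \<union> supp b \<eta>'"] fin supp by auto
  then have "(\<eta>, \<eta>') \<in> (moves Y)\<^sup>*" using finite_moves_connect ceq by simp
  then show ?thesis using rtrancl_mono[OF moves_mono[OF Y(3)]] by blast
qed

text \<open>The gradient is that of a uniform form of radius \<open>r\<close>.\<close>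

definition local_gradient :: "nat \<Rightarrow> (('x \<Rightarrow> 's) \<Rightarrow> real) \<Rightarrow> bool" where
  "local_gradient r f \<longleftrightarrow> (\<forall>e\<in>E. \<forall>\<eta> \<eta>'. finite (supp b \<eta>) \<longrightarrow> finite (supp b \<eta>') \<longrightarrow>
     (\<forall>x. gdist E (fst e) x \<le> r \<or> gdist E (snd e) x \<le> r \<longrightarrow> \<eta> x = \<eta>' x) \<longrightarrow>
     nabla \<phi> e f \<eta> = nabla \<phi> e f \<eta>')"

text \<open>The changes along a path of moves inside \<open>W\<close> add up, and each of them sees only the states within
distance \<open>r\<close> of \<open>W\<close>.\<close>

lemma move_difference:
  assumes loc: "local_gradient r f" and W: "connected_subset E W"
    and fin: "finite (supp b \<eta>)" "finite (supp b \<eta>')"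
    and supp: "supp b \<eta> \<subseteq> W" "supp b \<eta>' \<subseteq> W"
    and ceq: "content b \<eta> \<sim>\<^sub>c content b \<eta>'"
    and \<theta>: "finite (supp b \<theta>)" "finite (supp b \<theta>')" "supp b \<theta> \<inter> W = {}" "supp b \<theta>' \<inter> W = {}"
    and near: "\<And>x y. y \<in> W \<Longrightarrow> gdist E y x \<le> r \<Longrightarrow> \<theta> x = \<theta>' x"
  shows "f (merge b \<eta>' \<theta>) - f (merge b \<eta> \<theta>) = f (merge b \<eta>' \<theta>') - f (merge b \<eta> \<theta>')"
  using moves_connect[OF W fin supp ceq]
proof (induction rule: rtrancl_induct)
  case (step \<zeta> \<zeta>')
  then obtain e where e: "e \<in> induced E W" "\<zeta>' = step \<phi> e \<zeta>" and \<zeta>: "finite (supp b \<zeta>)" "supp b \<zeta> \<subseteq> W"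
    unfolding moves_def by blast
  have eW: "e \<in> E" "fst e \<in> W" "snd e \<in> W" using e(1) by (auto simp: induced_def)
  have "nabla \<phi> e f (merge b \<zeta> \<theta>) = nabla \<phi> e f (merge b \<zeta> \<theta>')"
  proof (rule loc[unfolded local_gradient_def, rule_format])
    fix x assume "gdist E (fst e) x \<le> r \<or> gdist E (snd e) x \<le> r"
    then have "\<theta> x = \<theta>' x" using near eW by blast
    then show "merge b \<zeta> \<theta> x = merge b \<zeta> \<theta>' x" by (simp add: merge_def)
  qed (use eW \<zeta>(1) \<theta>(1,2) in simp_all)
  moreover have "step \<phi> e (merge b \<zeta> \<theta>) = merge b \<zeta>' \<theta>" "step \<phi> e (merge b \<zeta> \<theta>') = merge b \<zeta>' \<theta>'"
    using eW \<theta> unfolding e(2) by (auto intro!: step_merge)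
  ultimately show ?case using step.IH by (simp add: nabla_def)
qed simp

end


section \<open>The pairing at an end\<close>

locale local_potential = system E b \<phi>
  for E :: "('x \<times> 'x) set" and b :: 's and \<phi> +
  fixes f :: "('x \<Rightarrow> 's) \<Rightarrow> real" and r :: nat
  assumes local_f: "local_gradient r f" and f_base: "f (\<lambda>_. b) = 0"
begin

definition excess :: "('x \<Rightarrow> 's) \<Rightarrow> ('x \<Rightarrow> 's) \<Rightarrow> real" where
  "excess \<eta> \<zeta> = f (merge b \<eta> \<zeta>) - f \<eta> - f \<zeta>"

lemma excess_commute: "supp b \<eta> \<inter> supp b \<zeta> = {} \<Longrightarrow> excess \<eta> \<zeta> = excess \<zeta> \<eta>"
  using merge_commute[of b \<eta> \<zeta>] by (simp add: excess_def)

lemma excess_cocycle: "excess \<eta> \<zeta> + excess (merge b \<eta> \<zeta>) \<theta> = excess \<zeta> \<theta> + excess \<eta> (merge b \<zeta> \<theta>)"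
  by (simp add: excess_def merge_assoc)

text \<open>A special case of \<open>move_difference\<close>: the background is either \<open>\<eta>\<close> or empty.\<close>

lemma excess_move:
  assumes W: "connected_subset E W"
    and fin: "finite (supp b \<zeta>)" "finite (supp b \<zeta>')" "finite (supp b \<eta>)"
    and supp: "supp b \<zeta> \<subseteq> W" "supp b \<zeta>' \<subseteq> W"
    and ceq: "content b \<zeta> \<sim>\<^sub>c content b \<zeta>'"
    and far: "\<And>x y. y \<in> W \<Longrightarrow> x \<in> supp b \<eta> \<Longrightarrow> gdist E y x > r"
  shows "excess \<eta> \<zeta> = excess \<eta> \<zeta>'"
proof -
  have dis: "supp b \<eta> \<inter> W = {}" using far by fastforce
  have near: "\<eta> x = b" if "y \<in> W" "gdist E y x \<le> r" for x y
    using far[OF that(1), of x] that(2) by (force simp: supp_def)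
  have "f (merge b \<zeta>' \<eta>) - f (merge b \<zeta> \<eta>) = f (merge b \<zeta>' (\<lambda>_. b)) - f (merge b \<zeta> (\<lambda>_. b))"
    by (rule move_difference[OF local_f W fin(1,2) supp ceq fin(3)]) (use dis near in auto)
  moreover have "merge b \<zeta>' \<eta> = merge b \<eta> \<zeta>'" "merge b \<zeta> \<eta> = merge b \<eta> \<zeta>"
    using dis supp by (auto intro!: merge_commute)
  ultimately show ?thesis by (simp add: excess_def)
qed

text \<open>The configuration \<open>\<zeta>\<close> lies so far out in the end that moves inside the ball around \<open>\<eta>\<close> and moves
inside the end do not influence each other.\<close>

definition placed :: "'x \<Rightarrow> (nat \<Rightarrow> 'x set) \<Rightarrow> nat \<Rightarrow> ('x \<Rightarrow> 's) \<Rightarrow> ('x \<Rightarrow> 's) \<Rightarrow> bool" where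
  "placed x \<epsilon> k \<eta> \<zeta> \<longleftrightarrow> supp b \<eta> \<subseteq> nball E x k \<and> supp b \<zeta> \<subseteq> \<epsilon> (k + r) \<and> finite (supp b \<zeta>)"

text \<open>The value does not depend on the choices by \<open>pairing_eq\<close>, and a choice always exists since \<open>\<epsilon>\<close> has
room for any multiset.\<close>

definition pairing :: "'x \<Rightarrow> (nat \<Rightarrow> 'x set) \<Rightarrow> 's multiset \<Rightarrow> 's multiset \<Rightarrow> real" where
  "pairing x \<epsilon> m n = (SOME v. \<exists>k \<eta> \<zeta>. placed x \<epsilon> k \<eta> \<zeta> \<and> content b \<eta> \<sim>\<^sub>c m \<and> content b \<zeta> \<sim>\<^sub>c n \<and> v = excess \<eta> \<zeta>)"

lemma far_from_nball:
  assumes "is_end x \<epsilon>" "y \<in> \<epsilon> (k + r)" "z \<in> nball E x k"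
  shows "gdist E y z > r"
proof -
  have "y \<notin> nball E x (k + r)" using assms by (auto simp: is_end_def)
  then show ?thesis using assms(3) gdist_triangle[of x y z] gdist_commute[of y z]
    by (simp add: nball_def)
qed

text \<open>Both escaping configurations are replaced by a common one that lies out of reach of both balls;
then the other two configurations are moved into each other inside the larger ball.\<close>

lemma excess_placed_unique:
  assumes e: "is_end x \<epsilon>"
    and p: "placed x \<epsilon> k \<eta> \<zeta>" "placed x \<epsilon> k' \<eta>' \<zeta>'"
    and c: "content b \<eta> \<sim>\<^sub>c content b \<eta>'" "content b \<zeta> \<sim>\<^sub>c content b \<zeta>'"
  shows "excess \<eta> \<zeta> = excess \<eta>' \<zeta>'"
proof -
  \<comment> \<open>An auxiliary configuration \<open>\<theta>\<close>, equivalent to \<open>\<zeta>\<close> and out of reach of both balls.\<close>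
  define K where "K = max k k'"
  have inf: "infinite (\<epsilon> (K + r))" and conn: "connected_subset E (\<epsilon> j)" for j
    using e by (auto simp: is_end_def)
  obtain \<theta> where \<theta>: "supp b \<theta> \<subseteq> \<epsilon> (K + r)" "finite (supp b \<theta>)" "content b \<theta> \<sim>\<^sub>c content b \<zeta>"
    using realize_content[of "\<epsilon> (K + r)" "content b \<zeta>"] inf by blast
  have sub: "\<epsilon> (K + r) \<subseteq> \<epsilon> (k + r)" "\<epsilon> (K + r) \<subseteq> \<epsilon> (k' + r)"
    using is_end_antimono[OF e] by (auto simp: K_def)
  have fin: "finite (supp b \<eta>)" "finite (supp b \<zeta>)" "finite (supp b \<eta>')" "finite (supp b \<zeta>')"
    using p finite_nball finite_subset unfolding placed_def by blast+
  have sK: "supp b \<eta> \<subseteq> nball E x K" "supp b \<eta>' \<subseteq> nball E x K"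
    using p nball_mono[of k K x] nball_mono[of k' K x] by (auto simp: placed_def K_def)
  have "excess \<eta> \<zeta> = excess \<eta> \<theta>"
    using p(1) \<theta> fin sub far_from_nball[OF e] cequiv_sym[OF \<theta>(3)]
    by (intro excess_move[OF conn[of "k + r"]]) (auto simp: placed_def)
  moreover have "excess \<eta>' \<zeta>' = excess \<eta>' \<theta>"
    using p(2) \<theta> fin sub far_from_nball[OF e] cequiv_sym[OF cequiv_trans[OF \<theta>(3) c(2)]]
    by (intro excess_move[OF conn[of "k' + r"]]) (auto simp: placed_def)
  moreover have "excess \<theta> \<eta> = excess \<theta> \<eta>'"
  proof (rule excess_move[OF connected_nball[of x K] fin(1,3) \<theta>(2) sK c(1)])
    fix w y assume "y \<in> nball E x K" "w \<in> supp b \<theta>"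
    then have "gdist E w y > r" using far_from_nball[OF e] \<theta>(1) by blast
    then show "gdist E y w > r" by (simp add: gdist_commute)
  qed
  moreover have "supp b \<theta> \<inter> nball E x K = {}"
    using \<theta>(1) far_from_nball[OF e, of _ K] by fastforce
  then have "excess \<theta> \<eta> = excess \<eta> \<theta>" "excess \<theta> \<eta>' = excess \<eta>' \<theta>"
    using sK by (auto intro!: excess_commute)
  ultimately show ?thesis by simp
qed

lemma pairing_eq:
  assumes e: "is_end x \<epsilon>" and p: "placed x \<epsilon> k \<eta> \<zeta>"
    and c: "content b \<eta> \<sim>\<^sub>c m" "content b \<zeta> \<sim>\<^sub>c n"
  shows "pairing x \<epsilon> m n = excess \<eta> \<zeta>"
  unfolding pairing_def
proof (rule some_equality)
  fix v assume "\<exists>k \<eta> \<zeta>. placed x \<epsilon> k \<eta> \<zeta> \<and> content b \<eta> \<sim>\<^sub>c m \<and> content b \<zeta> \<sim>\<^sub>c n \<and> v = excess \<eta> \<zeta>"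
  then obtain k' \<eta>' \<zeta>' where *: "placed x \<epsilon> k' \<eta>' \<zeta>'" "content b \<eta>' \<sim>\<^sub>c m" "content b \<zeta>' \<sim>\<^sub>c n"
      "v = excess \<eta>' \<zeta>'" by blast
  show "v = excess \<eta> \<zeta>" unfolding *(4)
    by (rule excess_placed_unique[OF e *(1) p cequiv_common[OF *(2) c(1)] cequiv_common[OF *(3) c(2)]])
qed (use p c in blast)

lemma realize_finite:
  obtains \<eta> :: "'x \<Rightarrow> 's" where "finite (supp b \<eta>)" "content b \<eta> \<sim>\<^sub>c m"
  using realize_content[of UNIV m b \<phi>] infinite_UNIV by blast

lemma realize_end:
  assumes "is_end x \<epsilon>"
  obtains \<zeta> where "supp b \<zeta> \<subseteq> \<epsilon> k" "finite (supp b \<zeta>)" "content b \<zeta> \<sim>\<^sub>c m"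
  using realize_content[of "\<epsilon> k" m b \<phi>] assms by (auto simp: is_end_def)

lemma pairing_cong:
  assumes e: "is_end x \<epsilon>" and c: "m \<sim>\<^sub>c m'" "n \<sim>\<^sub>c n'"
  shows "pairing x \<epsilon> m n = pairing x \<epsilon> m' n'"
proof -
  obtain \<eta> :: "'x \<Rightarrow> 's" where \<eta>: "finite (supp b \<eta>)" "content b \<eta> \<sim>\<^sub>c m" by (rule realize_finite)
  obtain k where k: "supp b \<eta> \<subseteq> nball E x k" by (rule finite_in_nball[OF \<eta>(1)])
  obtain \<zeta> where \<zeta>: "supp b \<zeta> \<subseteq> \<epsilon> (k + r)" "finite (supp b \<zeta>)" "content b \<zeta> \<sim>\<^sub>c n" by (rule realize_end[OF e])
  have "placed x \<epsilon> k \<eta> \<zeta>" using k \<zeta> by (simp add: placed_def)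
  then show ?thesis
    using pairing_eq[OF e _ \<eta>(2) \<zeta>(3)] pairing_eq[OF e _ cequiv_trans[OF \<eta>(2) c(1)] cequiv_trans[OF \<zeta>(3) c(2)]]
    by simp
qed

lemma pairing_empty: assumes e: "is_end x \<epsilon>" shows "pairing x \<epsilon> m {#} = 0"
proof -
  obtain \<eta> :: "'x \<Rightarrow> 's" where \<eta>: "finite (supp b \<eta>)" "content b \<eta> \<sim>\<^sub>c m" by (rule realize_finite)
  obtain k where k: "supp b \<eta> \<subseteq> nball E x k" by (rule finite_in_nball[OF \<eta>(1)])
  have "placed x \<epsilon> k \<eta> (\<lambda>_. b)" using k by (simp add: placed_def)
  then show ?thesis using pairing_eq[OF e _ \<eta>(2), of k "\<lambda>_. b" "{#}"] f_base by (simp add: excess_def)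
qed

text \<open>Three configurations, each lying far out compared with the previous ones, compute all four terms at
once.\<close>

lemma pairing_cocycle:
  assumes e: "is_end x \<epsilon>"
  shows "pairing x \<epsilon> m n + pairing x \<epsilon> (m + n) p = pairing x \<epsilon> n p + pairing x \<epsilon> m (n + p)"
proof -
  obtain \<eta> :: "'x \<Rightarrow> 's" where \<eta>: "finite (supp b \<eta>)" "content b \<eta> \<sim>\<^sub>c m" by (rule realize_finite)
  obtain k where k: "supp b \<eta> \<subseteq> nball E x k" by (rule finite_in_nball[OF \<eta>(1)])
  obtain \<zeta> where \<zeta>: "supp b \<zeta> \<subseteq> \<epsilon> (k + r)" "finite (supp b \<zeta>)" "content b \<zeta> \<sim>\<^sub>c n" by (rule realize_end[OF e])
  obtain l0 where l0: "supp b \<zeta> \<subseteq> nball E x l0" by (rule finite_in_nball[OF \<zeta>(2)])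
  define l where "l = max k l0"
  have l: "supp b \<eta> \<subseteq> nball E x l" "supp b \<zeta> \<subseteq> nball E x l"
    using k l0 nball_mono[of k l x] nball_mono[of l0 l x] by (auto simp: l_def)
  obtain \<theta> where \<theta>: "supp b \<theta> \<subseteq> \<epsilon> (l + r)" "finite (supp b \<theta>)" "content b \<theta> \<sim>\<^sub>c p" by (rule realize_end[OF e])
  have sub: "\<epsilon> (l + r) \<subseteq> \<epsilon> (k + r)" using is_end_antimono[OF e] by (simp add: l_def)
  have d: "supp b \<eta> \<inter> supp b \<zeta> = {}" "supp b \<zeta> \<inter> supp b \<theta> = {}"
    using far_from_nball[OF e, of _ k] far_from_nball[OF e, of _ l] k l \<zeta>(1) \<theta>(1) by fastforce+
  have c: "content b (merge b \<eta> \<zeta>) \<sim>\<^sub>c m + n" "content b (merge b \<zeta> \<theta>) \<sim>\<^sub>c n + p"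
    using content_merge \<eta> \<zeta> \<theta> d cequiv_add by metis+
  have "pairing x \<epsilon> m n = excess \<eta> \<zeta>"
    by (rule pairing_eq[OF e _ \<eta>(2) \<zeta>(3), of k]) (use k \<zeta> in \<open>simp add: placed_def\<close>)
  moreover have "pairing x \<epsilon> (m + n) p = excess (merge b \<eta> \<zeta>) \<theta>"
    by (rule pairing_eq[OF e _ c(1) \<theta>(3), of l]) (use l \<theta> in \<open>simp add: placed_def\<close>)
  moreover have "pairing x \<epsilon> n p = excess \<zeta> \<theta>"
    by (rule pairing_eq[OF e _ \<zeta>(3) \<theta>(3), of l]) (use l \<theta> in \<open>simp add: placed_def\<close>)
  moreover have "pairing x \<epsilon> m (n + p) = excess \<eta> (merge b \<zeta> \<theta>)"
    by (rule pairing_eq[OF e _ \<eta>(2) c(2), of k]) (use k \<zeta> \<theta> sub in \<open>auto simp: placed_def\<close>)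
  ultimately show ?thesis using excess_cocycle by simp
qed

text \<open>The escaping configuration need not start at the end: it may start anywhere in a connected set that
contains the end and stays away from the other configuration.\<close>

lemma pairing_via_connected:
  assumes e: "is_end x \<epsilon>" and W: "connected_subset E W" and eW: "\<epsilon> j \<subseteq> W"
    and \<zeta>: "supp b \<zeta> \<subseteq> W" "finite (supp b \<zeta>)" "content b \<zeta> \<sim>\<^sub>c n"
    and \<eta>: "finite (supp b \<eta>)" "content b \<eta> \<sim>\<^sub>c m"
    and far: "\<And>y z. y \<in> W \<Longrightarrow> z \<in> supp b \<eta> \<Longrightarrow> gdist E y z > r"
  shows "pairing x \<epsilon> m n = excess \<eta> \<zeta>"
proof -
  obtain k0 where k0: "supp b \<eta> \<subseteq> nball E x k0" by (rule finite_in_nball[OF \<eta>(1)])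
  define k where "k = max j k0"
  obtain \<zeta>' where \<zeta>': "supp b \<zeta>' \<subseteq> \<epsilon> (k + r)" "finite (supp b \<zeta>')" "content b \<zeta>' \<sim>\<^sub>c n" by (rule realize_end[OF e])
  have sub: "\<epsilon> (k + r) \<subseteq> \<epsilon> j" using is_end_antimono[OF e] by (simp add: k_def)
  have "placed x \<epsilon> k \<eta> \<zeta>'"
    using k0 nball_mono[of k0 k x] \<zeta>' by (auto simp: placed_def k_def)
  then have "pairing x \<epsilon> m n = excess \<eta> \<zeta>'" using pairing_eq[OF e _ \<eta>(2) \<zeta>'(3)] by blast
  also have "\<dots> = excess \<eta> \<zeta>"
    by (rule excess_move[OF W \<zeta>'(2) \<zeta>(2) \<eta>(1) _ \<zeta>(1) cequiv_common[OF \<zeta>'(3) \<zeta>(3)] far])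
      (use \<zeta>'(1) sub eW in auto)
  finally show ?thesis .
qed

text \<open>Put \<open>\<eta>\<close> into one end and \<open>\<zeta>\<close> into the other.  Their excess is the pairing at the end of \<open>\<zeta>\<close>, since
\<open>\<zeta>\<close> can escape there while \<open>\<eta>\<close> is fixed, and also the pairing at the end of \<open>\<eta>\<close>, with the
arguments exchanged.\<close>

lemma pairing_separated:
  assumes e: "is_end x \<epsilon>" "is_end x \<epsilon>'" and sep: "separated r \<epsilon> \<epsilon>'"
  shows "pairing x \<epsilon>' m n = pairing x \<epsilon> n m"
proof -
  obtain K where K: "\<And>y z. y \<in> \<epsilon> K \<Longrightarrow> z \<in> \<epsilon>' K \<Longrightarrow> gdist E y z > r"
    using sep unfolding separated_def by blast
  obtain \<eta> where \<eta>: "supp b \<eta> \<subseteq> \<epsilon> K" "finite (supp b \<eta>)" "content b \<eta> \<sim>\<^sub>c m" by (rule realize_end[OF e(1)])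
  obtain \<zeta> where \<zeta>: "supp b \<zeta> \<subseteq> \<epsilon>' K" "finite (supp b \<zeta>)" "content b \<zeta> \<sim>\<^sub>c n" by (rule realize_end[OF e(2)])
  have conn: "connected_subset E (\<epsilon> K)" "connected_subset E (\<epsilon>' K)" using e by (auto simp: is_end_def)
  have "pairing x \<epsilon>' m n = excess \<eta> \<zeta>"
    by (rule pairing_via_connected[OF e(2) conn(2) order_refl \<zeta> \<eta>(2,3)])
      (metis K \<eta>(1) gdist_commute subsetD)
  moreover have "pairing x \<epsilon> n m = excess \<zeta> \<eta>"
    by (rule pairing_via_connected[OF e(1) conn(1) order_refl \<eta> \<zeta>(2,3)])
      (use K \<zeta>(1) in blast)
  moreover have "supp b \<eta> \<inter> supp b \<zeta> = {}" using \<eta>(1) \<zeta>(1) K by fastforce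
  ultimately show ?thesis using excess_commute by simp
qed


section \<open>Symmetry of the pairing and independence of the end\<close>

definition symmetric_end :: "'x \<Rightarrow> (nat \<Rightarrow> 'x set) \<Rightarrow> bool" where
  "symmetric_end x \<epsilon> \<longleftrightarrow> (\<forall>m n. pairing x \<epsilon> m n = pairing x \<epsilon> n m)"

lemma separated_if_different_components:
  assumes "is_end x \<epsilon>" "is_end x \<epsilon>'" "y \<notin> nball E z l" "y' \<notin> nball E z l"
    and "\<epsilon> i \<subseteq> reach E (- nball E z l) y" "\<epsilon>' j \<subseteq> reach E (- nball E z l) y'"
    and "reach E (- nball E z l) y \<noteq> reach E (- nball E z l) y'"
  shows "separated r \<epsilon> \<epsilon>'"
proof -
  have "reach E (- nball E z l) y' \<inter> reach E (- nball E z l) y = {}"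
    using assms(7) reach_eq by blast
  then have "\<epsilon>' j \<inter> reach E (- nball E z l) y = {}" using assms(6) by blast
  then show ?thesis using separated_if_components assms by blast
qed

text \<open>Passing from an end to a separated one transposes the pairing.  Three pairwise separated ends form
a cycle of odd length, so the pairing equals its own transpose.\<close>

lemma three_components_symmetric:
  assumes e: "is_end x \<epsilon>"
    and out: "Y \<subseteq> - nball E z l" and three: "card (reach E (- nball E z l) ` Y) \<ge> 3"
  shows "symmetric_end x \<epsilon>"
proof -
  define C where "C = reach E (- nball E z l)"
  obtain y i where y: "y \<notin> nball E z l" "\<epsilon> i \<subseteq> C y"
    using end_eventually_in_component[OF e] unfolding C_def by blast
  have "card (C ` Y - {C y}) \<ge> 2"
    using three diff_card_le_card_Diff[of "{C y}" "C ` Y"] by (simp add: C_def)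
  then obtain A where A: "A \<subseteq> C ` Y - {C y}" "card A = 2" by (rule obtain_subset_with_card_n)
  obtain c1 c2 where "A = {c1, c2}" "c1 \<noteq> c2" using A(2) unfolding card_2_iff by blast
  with A(1) have c12: "c1 \<in> C ` Y - {C y}" "c2 \<in> C ` Y - {C y}" "c1 \<noteq> c2" by blast+
  then obtain u v where "u \<in> Y" "v \<in> Y" "c1 = C u" "c2 = C v" by blast
  with c12 have uv: "u \<in> Y" "v \<in> Y" "C u \<noteq> C y" "C v \<noteq> C y" "C u \<noteq> C v" by simp_all
  obtain \<epsilon>1 where e1: "is_end x \<epsilon>1" "\<And>k. \<epsilon>1 k \<subseteq> C u"
    using end_in_component[of u z l x] uv(1) out unfolding C_def by blast
  obtain \<epsilon>2 where e2: "is_end x \<epsilon>2" "\<And>k. \<epsilon>2 k \<subseteq> C v"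
    using end_in_component[of v z l x] uv(2) out unfolding C_def by blast
  have uv': "u \<notin> nball E z l" "v \<notin> nball E z l" using uv(1,2) out by auto
  have "separated r \<epsilon> \<epsilon>1"
    using separated_if_different_components[OF e e1(1) y(1) uv'(1) y(2)[unfolded C_def] e1(2)[unfolded C_def]] uv(3)
    by (simp add: C_def)
  moreover have "separated r \<epsilon> \<epsilon>2"
    using separated_if_different_components[OF e e2(1) y(1) uv'(2) y(2)[unfolded C_def] e2(2)[unfolded C_def]] uv(4)
    by (simp add: C_def)
  moreover have "separated r \<epsilon>1 \<epsilon>2"
    using separated_if_different_components[OF e1(1) e2(1) uv' e1(2)[unfolded C_def] e2(2)[unfolded C_def]] uv(5)
    by (simp add: C_def)
  ultimately show ?thesis unfolding symmetric_end_def
    using pairing_separated[OF e e1(1)] pairing_separated[OF e e2(1)] pairing_separated[OF e1(1) e2(1)]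
    by simp
qed

text \<open>For separated ends equality is symmetry.  Two ends in the same component are compared through an
end in another one.\<close>

lemma disconnected_complement_pairing_eq:
  assumes sym: "\<And>\<epsilon>. is_end x \<epsilon> \<Longrightarrow> symmetric_end x \<epsilon>"
    and disc: "\<not> connected_subset E (- nball E z l)"
    and e: "is_end x \<epsilon>" "is_end x \<epsilon>'"
  shows "pairing x \<epsilon> = pairing x \<epsilon>'"
proof -
  define C where "C = reach E (- nball E z l)"
  have sep_eq: "pairing x \<epsilon>1 = pairing x \<epsilon>2"
    if "is_end x \<epsilon>1" "is_end x \<epsilon>2" "y1 \<notin> nball E z l" "y2 \<notin> nball E z l"
      "\<epsilon>1 i \<subseteq> C y1" "\<epsilon>2 j \<subseteq> C y2" "C y1 \<noteq> C y2" for \<epsilon>1 \<epsilon>2 y1 y2 i j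
  proof -
    have "separated r \<epsilon>1 \<epsilon>2" using separated_if_different_components[OF that(1-4)] that(5-7) unfolding C_def .
    then show ?thesis
      using pairing_separated[OF that(1,2)] sym[OF that(1)] by (simp add: fun_eq_iff symmetric_end_def)
  qed
  obtain y1 y2 where y12: "y1 \<notin> nball E z l" "y2 \<notin> nball E z l" "y2 \<notin> C y1"
    using disc unfolding connected_subset_def C_def reach_def by blast
  then have C12: "C y1 \<noteq> C y2" using reach_self unfolding C_def by blast
  obtain u i where u: "u \<notin> nball E z l" "\<epsilon> i \<subseteq> C u"
    using end_eventually_in_component[OF e(1)] unfolding C_def by blast
  obtain v j where v: "v \<notin> nball E z l" "\<epsilon>' j \<subseteq> C v"
    using end_eventually_in_component[OF e(2)] unfolding C_def by blast
  show ?thesis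
  proof (cases "C u = C v")
    case False
    then show ?thesis using sep_eq[OF e u(1) v(1) u(2) v(2)] by simp
  next
    case True
    obtain w where w: "w \<notin> nball E z l" "C w \<noteq> C u" using y12 C12 by metis
    obtain \<epsilon>1 where e1: "is_end x \<epsilon>1" "\<And>k. \<epsilon>1 k \<subseteq> C w"
      using end_in_component[OF w(1)] unfolding C_def by blast
    have "pairing x \<epsilon>1 = pairing x \<epsilon>" by (rule sep_eq[OF e1(1) e(1) w(1) u(1) e1(2) u(2) w(2)])
    moreover have "pairing x \<epsilon>1 = pairing x \<epsilon>'"
      by (rule sep_eq[OF e1(1) e(2) w(1) v(1) e1(2) v(2)]) (use True w in simp)
    ultimately show ?thesis by simp
  qed
qed

text \<open>The second alternative in transferability.\<close>

definition large_connected_complements :: bool where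
  "large_connected_complements \<longleftrightarrow> (\<forall>j. \<exists>z k. k \<ge> j \<and> connected_subset E (- nball E z k))"

text \<open>Put one configuration into a ball with connected complement, large enough to contain it with a
margin of width \<open>r\<close>.  The other one can then escape to either end.\<close>

lemma large_connected_pairing_eq:
  assumes lc: large_connected_complements and e: "is_end x \<epsilon>" "is_end x \<epsilon>'"
  shows "pairing x \<epsilon> = pairing x \<epsilon>'"
proof (intro ext)
  fix m n :: "'s multiset"
  obtain z k where k: "k \<ge> size m + r" "connected_subset E (- nball E z k)"
    using lc unfolding large_connected_complements_def by blast
  \<comment> \<open>A ball of radius \<open>i\<close> has more than \<open>i\<close> points, and its points have distance more than \<open>r\<close> from the complement of the ball of radius \<open>k\<close>.\<close>
  define i where "i = k - r"
  have i: "i + r = k" "size m \<le> i" using k(1) by (auto simp: i_def)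
  have "infinite (nball E z i) \<or> size m \<le> card (nball E z i)" using card_nball[of i z] i(2) by simp
  then obtain \<eta> where \<eta>: "supp b \<eta> \<subseteq> nball E z i" "finite (supp b \<eta>)" "content b \<eta> \<sim>\<^sub>c m"
    by (rule realize_content)
  have far: "gdist E u w > r" if "u \<in> - nball E z k" "w \<in> supp b \<eta>" for u w
  proof -
    have "gdist E z w \<le> i" using that(2) \<eta>(1) by (auto simp: nball_def)
    then show ?thesis using that(1) i(1) gdist_triangle[of z u w] gdist_commute[of u w] by (simp add: nball_def)
  qed
  obtain K where K: "nball E z k \<subseteq> nball E x K" by (rule finite_in_nball[OF finite_nball])
  have sub: "\<epsilon> K \<subseteq> - nball E z k" "\<epsilon>' K \<subseteq> - nball E z k" using K e unfolding is_end_def by blast+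
  obtain \<zeta> where \<zeta>: "supp b \<zeta> \<subseteq> \<epsilon> K" "finite (supp b \<zeta>)" "content b \<zeta> \<sim>\<^sub>c n" by (rule realize_end[OF e(1)])
  have "pairing x \<epsilon> m n = excess \<eta> \<zeta>"
    by (rule pairing_via_connected[OF e(1) k(2) sub(1) _ \<zeta>(2,3) \<eta>(2,3) far]) (use \<zeta>(1) sub in blast)
  moreover have "pairing x \<epsilon>' m n = excess \<eta> \<zeta>"
    by (rule pairing_via_connected[OF e(2) k(2) sub(2) _ \<zeta>(2,3) \<eta>(2,3) far]) (use \<zeta>(1) sub in blast)
  ultimately show "pairing x \<epsilon> m n = pairing x \<epsilon>' m n" by simp
qed

text \<open>Put the two configurations into two balls far apart.  The complement of each ball is connected, so
either configuration can escape to the end while the other one stays.\<close>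

lemma connected_complements_symmetric:
  assumes conn: "\<And>z k. connected_subset E (- nball E z k)" and e: "is_end x \<epsilon>"
  shows "symmetric_end x \<epsilon>"
  unfolding symmetric_end_def
proof (intro allI)
  fix m n :: "'s multiset"
  obtain \<eta> :: "'x \<Rightarrow> 's" where \<eta>: "finite (supp b \<eta>)" "content b \<eta> \<sim>\<^sub>c m" by (rule realize_finite)
  obtain k where k: "supp b \<eta> \<subseteq> nball E x k" by (rule finite_in_nball[OF \<eta>(1)])
  \<comment> \<open>The radii are chosen such that each configuration lies outside the \<open>r\<close>-neighbourhood of the ball that contains the other one.\<close>
  obtain y where y: "y \<notin> nball E x (k + r + (size n + r))" by (rule outside_nball)
  have "infinite (nball E y (size n)) \<or> size n \<le> card (nball E y (size n))"
    using card_nball[of "size n" y] by simp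
  then obtain \<zeta> where \<zeta>: "supp b \<zeta> \<subseteq> nball E y (size n)" "finite (supp b \<zeta>)" "content b \<zeta> \<sim>\<^sub>c n"
    by (rule realize_content)
  have out1: "supp b \<zeta> \<subseteq> - nball E x (k + r)"
  proof
    fix w assume "w \<in> supp b \<zeta>"
    then have "gdist E y w \<le> size n" using \<zeta>(1) by (auto simp: nball_def)
    then show "w \<in> - nball E x (k + r)"
      using y gdist_triangle[of x y w] gdist_commute[of y w] by (simp add: nball_def)
  qed
  have out2: "supp b \<eta> \<subseteq> - nball E y (size n + r)"
  proof
    fix w assume "w \<in> supp b \<eta>"
    then have "gdist E x w \<le> k" using k by (auto simp: nball_def)
    then show "w \<in> - nball E y (size n + r)"
      using y gdist_triangle[of x y w] gdist_commute[of y w] by (simp add: nball_def)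
  qed
  have far: "gdist E u w > r" if "u \<in> - nball E c (i + r)" "w \<in> nball E c i" for u w c i
    using that gdist_triangle[of c u w] gdist_commute[of u w] by (simp add: nball_def)
  obtain K where K: "nball E y (size n + r) \<subseteq> nball E x K" by (rule finite_in_nball[OF finite_nball])
  have sub: "\<epsilon> K \<subseteq> - nball E y (size n + r)" "\<epsilon> (k + r) \<subseteq> - nball E x (k + r)"
    using K e unfolding is_end_def by blast+
  have "pairing x \<epsilon> m n = excess \<eta> \<zeta>"
    by (rule pairing_via_connected[OF e conn sub(2) out1 \<zeta>(2,3) \<eta> far]) (use k in blast)+
  moreover have "pairing x \<epsilon> n m = excess \<zeta> \<eta>"
    by (rule pairing_via_connected[OF e conn sub(1) out2 \<eta> \<zeta>(2,3) far]) (use \<zeta>(1) in blast)+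
  moreover have "supp b \<eta> \<inter> supp b \<zeta> = {}"
    using k out1 nball_mono[of k "k + r" x] by auto
  ultimately show "pairing x \<epsilon> m n = pairing x \<epsilon> n m" using excess_commute by simp
qed

text \<open>If some ball disconnects the graph, there is an end separated from \<open>\<epsilon>\<close>; its pairing is equal to
that at \<open>\<epsilon>\<close> and to its transpose.\<close>

lemma large_connected_symmetric:
  assumes lc: large_connected_complements and e: "is_end x \<epsilon>"
  shows "symmetric_end x \<epsilon>"
proof (cases "\<forall>z k. connected_subset E (- nball E z k)")
  case True
  then show ?thesis using connected_complements_symmetric e by blast
next
  case False
  define C where "C z k = reach E (- nball E z k)" for z k
  obtain z l where "\<not> connected_subset E (- nball E z l)" using False by blast
  then obtain y1 y2 where y12: "y1 \<notin> nball E z l" "y2 \<notin> nball E z l" "C z l y1 \<noteq> C z l y2"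
    unfolding connected_subset_def C_def reach_def by blast
  obtain u i where u: "u \<notin> nball E z l" "\<epsilon> i \<subseteq> C z l u"
    using end_eventually_in_component[OF e] unfolding C_def by blast
  obtain w where w: "w \<notin> nball E z l" "C z l u \<noteq> C z l w" using y12 by metis
  obtain \<epsilon>1 where e1: "is_end x \<epsilon>1" "\<And>k. \<epsilon>1 k \<subseteq> C z l w"
    using end_in_component[OF w(1)] unfolding C_def by blast
  have "separated r \<epsilon> \<epsilon>1"
    using separated_if_different_components[OF e e1(1) u(1) w(1)] u(2) e1(2) w(2) unfolding C_def .
  then show ?thesis
    using pairing_separated[OF e e1(1)] large_connected_pairing_eq[OF lc e e1(1)]
    by (simp add: symmetric_end_def)
qed

end

lemma sum_mset_in_generated:
  "(\<Sum>s\<in>#m. \<xi> s) \<in> add_submonoid_generated (range \<xi>)"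
proof -
  have "(\<Sum>s\<in>#m. \<xi> s) \<in> M" if "0 \<in> M" "\<forall>x\<in>M. \<forall>y\<in>M. x + y \<in> M" "range \<xi> \<subseteq> M" for M
    using that by (induction m) auto
  then show ?thesis by (auto simp: add_submonoid_generated_def hull_def)
qed

text \<open>A generator \<open>\<xi>\<close> of the conserved quantities decides equivalence of multisets, and its sums lie in a
monoid that embeds into the integers.\<close>

lemma simple_interaction_rank_one:
  assumes "simple_interaction b \<phi>"
  obtains \<xi> and \<psi> :: "real \<Rightarrow> int"
  where "\<And>m n. cequiv b \<phi> m n \<longleftrightarrow> (\<Sum>s\<in>#m. \<xi> s) = (\<Sum>s\<in>#n. \<xi> s)"
    and "inj_on \<psi> (add_submonoid_generated (range \<xi>))"
    and "\<And>u v. u \<in> add_submonoid_generated (range \<xi>) \<Longrightarrow> v \<in> add_submonoid_generated (range \<xi>) \<Longrightarrow>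
      \<psi> (u + v) = \<psi> u + \<psi> v"
proof -
  obtain B where B: "B \<subseteq> Consv b \<phi>" "fun_vs.independent B" "Consv b \<phi> \<subseteq> fun_vs.span B"
      "card B = fun_vs.dim (Consv b \<phi>)"
    using fun_vs.basis_exists by blast
  then have "card B = 1" using assms by (simp add: simple_interaction_def consv_dim_def)
  then obtain \<xi> where \<xi>: "B = {\<xi>}" by (auto simp: card_1_singleton_iff)
  have "\<xi> \<noteq> 0" using B(2) fun_vs.dependent_zero \<xi> by blast
  then have \<xi>0: "\<xi> \<noteq> (\<lambda>_. 0)" by (simp add: zero_fun_def)
  have \<xi>C: "\<xi> \<in> Consv b \<phi>" using B(1) \<xi> by blast
  have ceq: "cequiv b \<phi> m n \<longleftrightarrow> (\<Sum>s\<in>#m. \<xi> s) = (\<Sum>s\<in>#n. \<xi> s)" for m n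
  proof
    assume eq: "(\<Sum>s\<in>#m. \<xi> s) = (\<Sum>s\<in>#n. \<xi> s)"
    have "(\<Sum>s\<in>#m. \<xi>' s) = (\<Sum>s\<in>#n. \<xi>' s)" if "\<xi>' \<in> Consv b \<phi>" for \<xi>'
    proof -
      have "\<xi>' \<in> range (\<lambda>k. fun_scale k \<xi>)"
        using B(3) that unfolding \<xi> fun_vs.span_singleton by blast
      then obtain c where c: "\<xi>' = fun_scale c \<xi>" by blast
      have "(\<Sum>s\<in>#k. \<xi>' s) = c * (\<Sum>s\<in>#k. \<xi> s)" for k
        by (simp add: c fun_scale_def sum_mset_distrib_left)
      then show ?thesis using eq by simp
    qed
    then show "cequiv b \<phi> m n" by (simp add: cequiv_def)
  qed (use \<xi>C in \<open>auto simp: cequiv_def\<close>)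
  define M where "M = add_submonoid_generated (range \<xi>)"
  have "add_monoid_on M \<cong> add_monoid_on (UNIV :: nat set) \<or> add_monoid_on M \<cong> add_monoid_on (UNIV :: int set)"
    using assms \<xi>C \<xi>0 by (simp add: simple_interaction_def M_def)
  then obtain \<psi> :: "real \<Rightarrow> int" where "inj_on \<psi> M" "\<And>u v. u \<in> M \<Longrightarrow> v \<in> M \<Longrightarrow> \<psi> (u + v) = \<psi> u + \<psi> v"
  proof
    assume "add_monoid_on M \<cong> add_monoid_on (UNIV :: nat set)"
    then obtain h :: "real \<Rightarrow> nat" where "h \<in> iso (add_monoid_on M) (add_monoid_on UNIV)"
      unfolding is_iso_def by blast
    then have "inj_on h M" "\<And>u v. u \<in> M \<Longrightarrow> v \<in> M \<Longrightarrow> h (u + v) = h u + h v"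
      by (auto simp: iso_def hom_def add_monoid_on_def bij_betw_def)
    then show thesis using that[of "int \<circ> h"] by (simp add: comp_inj_on)
  next
    assume "add_monoid_on M \<cong> add_monoid_on (UNIV :: int set)"
    then obtain h :: "real \<Rightarrow> int" where "h \<in> iso (add_monoid_on M) (add_monoid_on UNIV)"
      unfolding is_iso_def by blast
    then have "inj_on h M" "\<And>u v. u \<in> M \<Longrightarrow> v \<in> M \<Longrightarrow> h (u + v) = h u + h v"
      by (auto simp: iso_def hom_def add_monoid_on_def bij_betw_def)
    then show thesis using that[of h] by simp
  qed
  then show thesis using that[OF ceq] by (simp add: M_def)
qed

text \<open>The commutator of \<open>m\<close> and \<open>n\<close> is biadditive and alternating.  Since \<open>w m\<close> and \<open>w n\<close> are integers,
suitable multiples of \<open>m\<close> and \<open>n\<close> either are equivalent or add up to something trivial, and the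
commutator vanishes.\<close>

lemma rank_one_cocycle_symmetric:
  fixes H :: "'s multiset \<Rightarrow> 's multiset \<Rightarrow> real" and w :: "'s multiset \<Rightarrow> int"
  assumes coc: "\<And>m n k. H m n + H (m + n) k = H n k + H m (n + k)"
    and w_add: "\<And>m n. w (m + n) = w m + w n"
    and resp: "\<And>m m' n n'. w m = w m' \<Longrightarrow> w n = w n' \<Longrightarrow> H m n = H m' n'"
  shows "H m n = H n m"
proof -
  define c where "c m n = H m n - H n m" for m n
  have c_add: "c m (n + k) = c m n + c m k" for m n k
    unfolding c_def by (rule cocycle_commutator_additive[of H, OF coc])
  have c_resp: "c m n = c m' n'" if "w m = w m'" "w n = w n'" for m m' n n'
    unfolding c_def resp[OF that] resp[OF that(2,1)] ..
  have c_empty: "c m {#} = 0" "c {#} m = 0" for m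
  proof -
    show "c m {#} = 0" using c_add[of m "{#}" "{#}"] by simp
    then show "c {#} m = 0" by (simp add: c_def)
  qed
  have w0: "w {#} = 0" using w_add[of "{#}" "{#}"] by simp
  have c_rep: "c m (repeat_mset k n) = of_nat k * c m n" for k m n
    by (induction k) (simp_all add: c_empty c_add algebra_simps)
  have w_rep: "w (repeat_mset k m) = int k * w m" for k m
    by (induction k) (simp_all add: w0 w_add algebra_simps)
  define i j where "i = nat \<bar>w m\<bar>" and "j = nat \<bar>w n\<bar>"
  have "c m n = 0"
  proof (cases "w m = 0")
    case True
    then show ?thesis using c_resp[of m "{#}" n n] w0 c_empty by simp
  next
    case False
    have "of_nat i * c m n = 0"
    proof (cases "w m * w n \<ge> 0")
      case True
      then have "int i * w n = int j * w m"
        unfolding i_def j_def by (auto simp: zero_le_mult_iff)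
      then have "c m (repeat_mset i n) = c m (repeat_mset j m)"
        by (intro c_resp) (simp_all add: w_rep)
      then show ?thesis by (simp add: c_rep) (simp add: c_def)
    next
      case False
      then have "int i * w n + int j * w m = 0"
        unfolding i_def j_def by (auto simp: zero_le_mult_iff not_le mult_less_0_iff)
      then have "c m (repeat_mset i n + repeat_mset j m) = c m {#}"
        by (intro c_resp) (simp_all add: w_rep w_add w0)
      then show ?thesis by (simp add: c_rep c_add c_empty) (simp add: c_def)
    qed
    then show ?thesis using False by (simp add: i_def)
  qed
  then show ?thesis by (simp add: c_def)
qed

context local_potential
begin

lemma simple_symmetric:
  assumes simple: "simple_interaction b \<phi>" and e: "is_end x \<epsilon>"
  shows "symmetric_end x \<epsilon>"
proof -
  obtain \<xi> and \<psi> :: "real \<Rightarrow> int"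
  where ceq: "\<And>m n. cequiv b \<phi> m n \<longleftrightarrow> (\<Sum>s\<in>#m. \<xi> s) = (\<Sum>s\<in>#n. \<xi> s)"
    and inj: "inj_on \<psi> (add_submonoid_generated (range \<xi>))"
    and add: "\<And>u v. u \<in> add_submonoid_generated (range \<xi>) \<Longrightarrow> v \<in> add_submonoid_generated (range \<xi>) \<Longrightarrow>
      \<psi> (u + v) = \<psi> u + \<psi> v"
    using simple_interaction_rank_one[OF simple] by metis
  define w where "w m = \<psi> (\<Sum>s\<in>#m. \<xi> s)" for m
  have w_add: "w (m + n) = w m + w n" for m n
    using add[OF sum_mset_in_generated sum_mset_in_generated] by (simp add: w_def)
  have w_eq: "m \<sim>\<^sub>c n" if "w m = w n" for m n
    using inj_onD[OF inj that[unfolded w_def] sum_mset_in_generated sum_mset_in_generated] ceq by blast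
  have "pairing x \<epsilon> m n = pairing x \<epsilon> n m" for m n
    by (rule rank_one_cocycle_symmetric[OF pairing_cocycle[OF e], of w])
      (use w_add w_eq pairing_cong[OF e] in blast)+
  then show ?thesis by (simp add: symmetric_end_def)
qed

lemma components_eq_reach: "components_of_subset E W = reach E W ` W"
  by (auto simp: components_of_subset_def quotient_def reach_def)

text \<open>Three cases: a ball whose complement has three components, large balls with connected complement, a
simple interaction.  In the last one symmetry is algebraic; the pairings agree because either some
ball disconnects the graph, or all complements of balls are connected.\<close>

lemma pairings_symmetric_and_equal:
  assumes "transferable E \<or> simple_interaction b \<phi>"
  shows "is_end x \<epsilon> \<Longrightarrow> symmetric_end x \<epsilon>"
    and "is_end x \<epsilon> \<Longrightarrow> is_end x \<epsilon>' \<Longrightarrow> pairing x \<epsilon> = pairing x \<epsilon>'"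
proof -
  consider (three) z l where "card (components_of_subset E (- nball E z l)) \<ge> 3"
    | (large) large_connected_complements | (simple) "simple_interaction b \<phi>"
  proof -
    have "thesis" if "R > 0" "card (components_of_subset E (- gball E z R)) \<ge> 3" for z R
      using that three[of z "nat \<lfloor>R\<rfloor>"] gball_nball[of R E z] by simp
    moreover have "thesis" if *: "\<forall>k::nat. \<exists>z R. R > 0 \<and> R \<ge> real k \<and> connected_subset E (- gball E z R)"
    proof (rule large)
      show large_connected_complements
        unfolding large_connected_complements_def
      proof
        fix k
        obtain z R where R: "R > 0" "R \<ge> real k" "connected_subset E (- gball E z R)" using * by blast
        then have "nat \<lfloor>R\<rfloor> \<ge> k" by (simp add: le_nat_iff le_floor_iff)
        then show "\<exists>z l. l \<ge> k \<and> connected_subset E (- nball E z l)"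
          using R gball_nball[of R E z] by (metis order_less_imp_le)
      qed
    qed
    ultimately show thesis using assms simple unfolding transferable_def by blast
  qed
  then have "(\<forall>\<epsilon>. is_end x \<epsilon> \<longrightarrow> symmetric_end x \<epsilon>) \<and>
    (\<forall>\<epsilon> \<epsilon>'. is_end x \<epsilon> \<longrightarrow> is_end x \<epsilon>' \<longrightarrow> pairing x \<epsilon> = pairing x \<epsilon>')"
  proof cases
    case (three z l)
    have sym: "symmetric_end x \<epsilon>" if "is_end x \<epsilon>" for \<epsilon>
      by (rule three_components_symmetric[OF that, of "- nball E z l" z l])
        (use three in \<open>simp_all add: components_eq_reach\<close>)
    have "\<not> connected_subset E (- nball E z l)"
    proof
      assume conn: "connected_subset E (- nball E z l)"
      obtain y where y: "y \<notin> nball E z l" using outside_nball .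
      have "reach E (- nball E z l) ` (- nball E z l) \<subseteq> {reach E (- nball E z l) y}"
        using connected_subset_reach[OF conn order_refl, of y] y reach_eq by blast
      then have "card (reach E (- nball E z l) ` (- nball E z l)) \<le> 1"
        using card_mono[of "{reach E (- nball E z l) y}"] by fastforce
      then show False using three by (simp add: components_eq_reach)
    qed
    then show ?thesis using sym disconnected_complement_pairing_eq[of x z l] by blast
  next
    case large
    then show ?thesis using large_connected_symmetric large_connected_pairing_eq by blast
  next
    case simple
    have sym: "symmetric_end x \<epsilon>" if "is_end x \<epsilon>" for \<epsilon> using simple_symmetric[OF simple that] .
    show ?thesis
    proof (cases "\<exists>z l. \<not> connected_subset E (- nball E z l)")
      case True
      then show ?thesis using sym disconnected_complement_pairing_eq[of x] by blast
    next
      case False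
      then have large_connected_complements unfolding large_connected_complements_def by blast
      then show ?thesis using sym large_connected_pairing_eq by blast
    qed
  qed
  then show "is_end x \<epsilon> \<Longrightarrow> symmetric_end x \<epsilon>"
    and "is_end x \<epsilon> \<Longrightarrow> is_end x \<epsilon>' \<Longrightarrow> pairing x \<epsilon> = pairing x \<epsilon>'" by blast+
qed

lemma pairing_splits:
  assumes "transferable E \<or> simple_interaction b \<phi>"
  obtains g where "\<And>m n. m \<sim>\<^sub>c n \<Longrightarrow> g m = g n"
    "\<And>\<epsilon> m n. is_end x \<epsilon> \<Longrightarrow> pairing x \<epsilon> m n = g (m + n) - g m - g n"
proof -
  obtain \<epsilon> where e: "is_end x \<epsilon>" using end_exists .
  have sym: "pairing x \<epsilon> m n = pairing x \<epsilon> n m" for m n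
    using pairings_symmetric_and_equal(1)[OF assms e] by (simp add: symmetric_end_def)
  obtain g where g: "\<And>m n. pairing x \<epsilon> m n = g (m + n) - g m - g n" "\<And>m n. m \<sim>\<^sub>c n \<Longrightarrow> g m = g n"
  proof (rule symmetric_cocycle_splits[of "pairing x \<epsilon>" "cequiv b \<phi>"])
    show "pairing x \<epsilon> m n = pairing x \<epsilon> m' n" if "m \<sim>\<^sub>c m'" for m m' n
      using pairing_cong[OF e that cequiv_refl] .
  qed (use sym pairing_empty[OF e] pairing_cocycle[OF e] cequiv_sym cequiv_add that in \<open>simp_all\<close>)
  then show ?thesis using that pairings_symmetric_and_equal(2)[OF assms e] by metis
qed

end


section \<open>From additivity at the ends to locality\<close>

context system
begin

text \<open>The threshold \<open>k\<close> may depend on \<open>\<eta>\<close>; this is what the vanishing of all pairings amounts to.\<close>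

definition additive_at_ends :: "'x \<Rightarrow> (('x \<Rightarrow> 's) \<Rightarrow> real) \<Rightarrow> bool" where
  "additive_at_ends p f \<longleftrightarrow> (\<forall>\<epsilon> \<eta>. is_end p \<epsilon> \<longrightarrow> finite (supp b \<eta>) \<longrightarrow>
     (\<exists>k. \<forall>\<zeta>. finite (supp b \<zeta>) \<longrightarrow> supp b \<zeta> \<subseteq> \<epsilon> k \<longrightarrow> f (merge b \<eta> \<zeta>) = f \<eta> + f \<zeta>))"

definition site_local :: "nat \<Rightarrow> (('x \<Rightarrow> 's) \<Rightarrow> real) \<Rightarrow> bool" where
  "site_local r f \<longleftrightarrow> (\<forall>x s \<eta> \<eta>'. finite (supp b \<eta>) \<longrightarrow> finite (supp b \<eta>') \<longrightarrow>
     (\<forall>y\<in>nball E x r. \<eta> y = \<eta>' y) \<longrightarrow> f (\<eta>(x := s)) - f \<eta> = f (\<eta>'(x := s)) - f \<eta>')"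

lemma finite_supp_upd: "finite (supp b \<eta>) \<Longrightarrow> finite (supp b (\<eta>(x := s)))"
  by (rule finite_subset[of _ "insert x (supp b \<eta>)"]) (auto simp: supp_def)

text \<open>The states in a component of the complement of the ball around \<open>x\<close> can be moved inside the component
to an end.  The effect of changing the state at \<open>x\<close> is not altered by this, and at the end they
contribute the same summand with and without the change.\<close>

lemma erase_component:
  assumes loc: "local_gradient r f" and add: "additive_at_ends p f"
    and fin: "finite (supp b \<eta>)" and y: "y \<notin> nball E x r"
  defines "\<theta> \<equiv> \<lambda>z. if z \<in> reach E (- nball E x r) y then b else \<eta> z"
  shows "f (\<eta>(x := s)) - f \<eta> = f (\<theta>(x := s)) - f \<theta>"
proof -
  define C where "C = reach E (- nball E x r) y"
  define \<zeta> where "\<zeta> = (\<lambda>z. if z \<in> C then \<eta> z else b)"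
  define \<theta>' where "\<theta>' = \<theta>(x := s)"
  have C: "C \<subseteq> - nball E x r" unfolding C_def using y by (intro reach_subset) simp
  have connC: "connected_subset E C" unfolding C_def by (rule connected_reach)
  have xC: "x \<notin> C" using C by (auto simp: nball_def)
  have supp: "supp b \<zeta> \<subseteq> C" "supp b \<theta> \<inter> C = {}" "supp b \<theta>' \<inter> C = {}"
    using xC by (auto simp: supp_def \<zeta>_def \<theta>_def \<theta>'_def C_def)
  have fin': "finite (supp b \<zeta>)" "finite (supp b \<theta>)"
    by (rule finite_subset[OF _ fin]; auto simp: supp_def \<zeta>_def \<theta>_def)+
  have fin\<theta>': "finite (supp b \<theta>')" unfolding \<theta>'_def by (rule finite_supp_upd[OF fin'(2)])
  obtain \<epsilon> where e: "is_end p \<epsilon>" "\<And>k. \<epsilon> k \<subseteq> C"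
    using end_in_component[OF y] unfolding C_def by blast
  obtain k where k: "\<And>\<xi>. finite (supp b \<xi>) \<Longrightarrow> supp b \<xi> \<subseteq> \<epsilon> k \<Longrightarrow> f (merge b \<theta> \<xi>) = f \<theta> + f \<xi>"
    using add e(1) fin'(2) unfolding additive_at_ends_def by blast
  obtain k' where k': "\<And>\<xi>. finite (supp b \<xi>) \<Longrightarrow> supp b \<xi> \<subseteq> \<epsilon> k' \<Longrightarrow> f (merge b \<theta>' \<xi>) = f \<theta>' + f \<xi>"
    using add e(1) fin\<theta>' unfolding additive_at_ends_def by blast
  define K where "K = max k k'"
  have "infinite (\<epsilon> K) \<or> size (content b \<zeta>) \<le> card (\<epsilon> K)" using e(1) by (auto simp: is_end_def)
  then obtain \<xi> where \<xi>: "supp b \<xi> \<subseteq> \<epsilon> K" "finite (supp b \<xi>)" "content b \<xi> \<sim>\<^sub>c content b \<zeta>"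
    by (rule realize_content)
  have sub: "supp b \<xi> \<subseteq> \<epsilon> k" "supp b \<xi> \<subseteq> \<epsilon> k'" "supp b \<xi> \<subseteq> C"
    using \<xi>(1) is_end_antimono[OF e(1), of k K] is_end_antimono[OF e(1), of k' K] e(2)[of K]
    by (auto simp: K_def)
  have near: "\<theta>' z = \<theta> z" if "u \<in> C" "gdist E u z \<le> r" for u z
  proof -
    have "z \<noteq> x" using that C gdist_commute[of u x] by (auto simp: nball_def)
    then show ?thesis by (simp add: \<theta>'_def)
  qed
  have "f (merge b \<xi> \<theta>') - f (merge b \<zeta> \<theta>') = f (merge b \<xi> \<theta>) - f (merge b \<zeta> \<theta>)"
    by (rule move_difference[OF loc connC fin'(1) \<xi>(2) supp(1) sub(3) cequiv_sym[OF \<xi>(3)] fin\<theta>' fin'(2) supp(3,2) near])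
  moreover have "merge b \<xi> \<theta>' = merge b \<theta>' \<xi>" "merge b \<xi> \<theta> = merge b \<theta> \<xi>"
    using sub(3) supp by (auto intro!: merge_commute)
  moreover have "f (merge b \<theta>' \<xi>) = f \<theta>' + f \<xi>" "f (merge b \<theta> \<xi>) = f \<theta> + f \<xi>"
    using k k' \<xi>(2) sub by auto
  moreover have "merge b \<zeta> \<theta> = \<eta>" "merge b \<zeta> \<theta>' = \<eta>(x := s)"
    using xC by (auto simp: merge_def \<zeta>_def \<theta>_def \<theta>'_def C_def fun_eq_iff)
  ultimately show ?thesis by (simp add: \<theta>'_def)
qed

text \<open>Components of the complement of the ball are erased one after the other until the configuration is
supported in the ball.\<close>

lemma site_localI:
  assumes loc: "local_gradient r f" and add: "additive_at_ends p f"
  shows "site_local r f"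
proof -
  have erase: "f (\<eta>(x := s)) - f \<eta> = f ((\<lambda>z. if z \<in> nball E x r then \<eta> z else b)(x := s))
      - f (\<lambda>z. if z \<in> nball E x r then \<eta> z else b)" if "finite (supp b \<eta>)" for \<eta> x s
    using that
  proof (induction "card (supp b \<eta> - nball E x r)" arbitrary: \<eta> rule: less_induct)
    case less
    show ?case
    proof (cases "supp b \<eta> \<subseteq> nball E x r")
      case True
      then have "(\<lambda>z. if z \<in> nball E x r then \<eta> z else b) = \<eta>" by (fastforce simp: supp_def fun_eq_iff)
      then show ?thesis by simp
    next
      case False
      then obtain y where y: "y \<in> supp b \<eta>" "y \<notin> nball E x r" by blast
      define \<theta> where "\<theta> = (\<lambda>z. if z \<in> reach E (- nball E x r) y then b else \<eta> z)"
      have sub: "supp b \<theta> \<subseteq> supp b \<eta> - {y}"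
        using reach_self by (auto simp: \<theta>_def supp_def)
      then have "card (supp b \<theta> - nball E x r) < card (supp b \<eta> - nball E x r)"
        using y less.prems by (intro psubset_card_mono) auto
      moreover have "finite (supp b \<theta>)" using sub less.prems by (auto intro: finite_subset)
      moreover have "(\<lambda>z. if z \<in> nball E x r then \<theta> z else b) = (\<lambda>z. if z \<in> nball E x r then \<eta> z else b)"
        using reach_subset[of y "- nball E x r"] y(2) by (auto simp: \<theta>_def fun_eq_iff)
      ultimately show ?thesis
        using less.hyps[of \<theta>] erase_component[OF loc add less.prems y(2), of s] unfolding \<theta>_def by simp
    qed
  qed
  show ?thesis unfolding site_local_def
  proof (intro allI impI)
    fix x s \<eta> \<eta>'
    assume "finite (supp b \<eta>)" "finite (supp b \<eta>')" "\<forall>y\<in>nball E x r. \<eta> y = \<eta>' y"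
    moreover from this(3) have "(\<lambda>z. if z \<in> nball E x r then \<eta> z else b) = (\<lambda>z. if z \<in> nball E x r then \<eta>' z else b)"
      by auto
    ultimately show "f (\<eta>(x := s)) - f \<eta> = f (\<eta>'(x := s)) - f \<eta>'"
      using erase[of \<eta> x s] erase[of \<eta>' x s] by simp
  qed
qed

end

context local_potential
begin

text \<open>The correction \<open>g\<close> depends only on conserved quantities and does not affect the gradient.\<close>

lemma site_local_potential_exists:
  assumes "transferable E \<or> simple_interaction b \<phi>"
  obtains f' where "site_local r f'" "f' (\<lambda>_. b) = 0"
    "\<And>e \<eta>. e \<in> E \<Longrightarrow> finite (supp b \<eta>) \<Longrightarrow> nabla \<phi> e f' \<eta> = nabla \<phi> e f \<eta>"
proof -
  fix p :: 'x
  obtain g where g: "\<And>m n. m \<sim>\<^sub>c n \<Longrightarrow> g m = g n"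
    "\<And>\<epsilon> m n. is_end p \<epsilon> \<Longrightarrow> pairing p \<epsilon> m n = g (m + n) - g m - g n"
    using pairing_splits[OF assms] by metis
  define f' where "f' \<eta> = f \<eta> - g (content b \<eta>)" for \<eta>
  obtain \<epsilon>0 where e0: "is_end p \<epsilon>0" by (rule end_exists)
  have "g {#} = 0" using g(2)[OF e0, of "{#}" "{#}"] pairing_empty[OF e0, of "{#}"] by simp
  then have base: "f' (\<lambda>_. b) = 0" by (simp add: f'_def f_base)
  have grad: "nabla \<phi> e f' \<eta> = nabla \<phi> e f \<eta>" if "e \<in> E" "finite (supp b \<eta>)" for e \<eta>
  proof -
    have "fst e \<noteq> snd e" using that(1) irreflE[of "fst e"] by (cases e) auto
    then have "g (content b (step \<phi> e \<eta>)) = g (content b \<eta>)" by (rule g(1)[OF content_step[OF that(2)]])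
    then show ?thesis by (simp add: nabla_def f'_def)
  qed
  have loc: "local_gradient r f'"
    unfolding local_gradient_def
  proof (intro ballI allI impI)
    fix e \<eta> \<eta>'
    assume *: "e \<in> E" "finite (supp b \<eta>)" "finite (supp b \<eta>')"
      "\<forall>x. gdist E (fst e) x \<le> r \<or> gdist E (snd e) x \<le> r \<longrightarrow> \<eta> x = \<eta>' x"
    then have "nabla \<phi> e f \<eta> = nabla \<phi> e f \<eta>'" using local_f unfolding local_gradient_def by blast
    then show "nabla \<phi> e f' \<eta> = nabla \<phi> e f' \<eta>'" using * grad by simp
  qed
  have "additive_at_ends p f'"
    unfolding additive_at_ends_def
  proof (intro allI impI)
    fix \<epsilon> and \<eta> :: "'x \<Rightarrow> 's" assume e: "is_end p \<epsilon>" and fin: "finite (supp b \<eta>)"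
    obtain k where k: "supp b \<eta> \<subseteq> nball E p k" by (rule finite_in_nball[OF fin])
    have "f' (merge b \<eta> \<zeta>) = f' \<eta> + f' \<zeta>" if \<zeta>: "finite (supp b \<zeta>)" "supp b \<zeta> \<subseteq> \<epsilon> (k + r)" for \<zeta>
    proof -
      have "placed p \<epsilon> k \<eta> \<zeta>" using k \<zeta> by (simp add: placed_def)
      then have "excess \<eta> \<zeta> = g (content b \<eta> + content b \<zeta>) - g (content b \<eta>) - g (content b \<zeta>)"
        using pairing_eq[OF e _ cequiv_refl cequiv_refl, of k \<eta> \<zeta>] g(2)[OF e, of "content b \<eta>" "content b \<zeta>"] by simp
      moreover have "supp b \<eta> \<inter> supp b \<zeta> = {}" using far_from_nball[OF e, of _ k] k \<zeta>(2) by fastforce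
      ultimately show ?thesis using content_merge[OF fin \<zeta>(1)] by (simp add: excess_def f'_def)
    qed
    then show "\<exists>k. \<forall>\<zeta>. finite (supp b \<zeta>) \<longrightarrow> supp b \<zeta> \<subseteq> \<epsilon> k \<longrightarrow> f' (merge b \<eta> \<zeta>) = f' \<eta> + f' \<zeta>" by blast
  qed
  then show ?thesis using that[OF site_localI[OF loc] base grad] by blast
qed

end


section \<open>Potentials of closed forms\<close>

lemma is_path_append: "is_path T x (p @ q) z \<longleftrightarrow> (\<exists>y. is_path T x p y \<and> is_path T y q z)"
  by (induction p arbitrary: x) auto

lemma is_path_exists: "(x, y) \<in> T\<^sup>* \<Longrightarrow> \<exists>p. is_path T x p y"
proof (induction rule: rtrancl_induct)
  case (step y z)
  then obtain p where "is_path T x p y" by blast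
  then have "is_path T x (p @ [(y, z)]) z" using step.hyps by (auto simp: is_path_append)
  then show ?case by blast
qed (rule exI[of _ "[]"], simp)

lemma is_path_reverse:
  assumes "sym T" "\<And>x y. (x, y) \<in> T \<Longrightarrow> \<omega> (y, x) = - \<omega> (x, y)" "is_path T x p y"
  shows "\<exists>q. is_path T y q x \<and> sum_list (map \<omega> q) = - (sum_list (map \<omega> p) :: real)"
  using assms(3)
proof (induction p arbitrary: x)
  case Nil
  then show ?case by (intro exI[of _ "[]"]) simp
next
  case (Cons e p)
  then have e: "e \<in> T" "fst e = x" "is_path T (snd e) p y" by auto
  obtain q where q: "is_path T y q (snd e)" "sum_list (map \<omega> q) = - sum_list (map \<omega> p)"
    using Cons.IH e(3) by blast
  have "(snd e, x) \<in> T" using e(1,2) assms(1) by (auto simp: sym_def)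
  then have "is_path T y (q @ [(snd e, x)]) x" using q(1) by (auto simp: is_path_append)
  moreover have "\<omega> (snd e, x) = - \<omega> e" using assms(2)[of x "snd e"] e(1,2) by auto
  then have "sum_list (map \<omega> (q @ [(snd e, x)])) = - sum_list (map \<omega> (e # p))" using q(2) by simp
  ultimately show ?case by blast
qed

text \<open>In each connected component fix a base point and sum along any path from it.\<close>

lemma closed_cochain_exact:
  fixes \<omega> :: "'a \<times> 'a \<Rightarrow> real"
  assumes sym: "sym T" and anti: "\<And>x y. (x, y) \<in> T \<Longrightarrow> \<omega> (y, x) = - \<omega> (x, y)"
    and closed: "\<And>x p. is_path T x p x \<Longrightarrow> sum_list (map \<omega> p) = 0"
  obtains f where "\<And>x y. (x, y) \<in> T \<Longrightarrow> \<omega> (x, y) = f y - f x"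
proof -
  define rep where "rep x = (SOME z. (z, x) \<in> T\<^sup>*)" for x
  define path where "path x = (SOME p. is_path T (rep x) p x)" for x
  define f where "f x = sum_list (map \<omega> (path x))" for x
  have "(rep x, x) \<in> T\<^sup>*" for x unfolding rep_def by (rule someI[of _ x]) simp
  then have path: "is_path T (rep x) (path x) x" for x
    unfolding path_def by (rule someI_ex[OF is_path_exists])
  have "\<omega> (x, y) = f y - f x" if xy: "(x, y) \<in> T" for x y
  proof -
    have yx: "(y, x) \<in> T" using xy sym by (auto dest: symD)
    have "(z, x) \<in> T\<^sup>* \<longleftrightarrow> (z, y) \<in> T\<^sup>*" for z
      using rtrancl_into_rtrancl[OF _ xy, of z] rtrancl_into_rtrancl[OF _ yx, of z] by blast
    then have rep: "rep x = rep y" by (simp add: rep_def)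
    obtain q where q: "is_path T y q (rep y)" "sum_list (map \<omega> q) = - f y"
      using is_path_reverse[of T \<omega>, OF sym anti path[of y]] unfolding f_def by blast
    have "is_path T (rep x) (path x @ (x, y) # q) (rep x)"
      using path[of x] q(1) xy rep by (auto simp: is_path_append)
    from closed[OF this] show ?thesis using q(2) by (simp add: f_def)
  qed
  then show ?thesis using that by blast
qed

text \<open>The interaction axiom, read along the reversed edge.  Where the interaction acts trivially nothing
is claimed about the reversed edge, hence the second alternative.\<close>

lemma step_reverse:
  assumes "is_interaction \<phi>" "fst e \<noteq> snd e"
  shows "step \<phi> (prod.swap e) (step \<phi> e \<eta>) = \<eta> \<or> step \<phi> e \<eta> = \<eta>"
proof (cases "\<phi> (\<eta> (fst e), \<eta> (snd e)) = (\<eta> (fst e), \<eta> (snd e))")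
  case True
  then show ?thesis by (simp add: step_apply)
next
  case False
  define p where "p = (\<eta> (fst e), \<eta> (snd e))"
  have "prod.swap (\<phi> (prod.swap (\<phi> p))) = p"
    using assms(1) False unfolding is_interaction_def p_def by blast
  then have "\<phi> (snd (\<phi> p), fst (\<phi> p)) = (\<eta> (snd e), \<eta> (fst e))"
    by (cases "\<phi> p"; cases "\<phi> (prod.swap (\<phi> p))") (auto simp: p_def)
  then show ?thesis using assms(2) by (auto simp: step_apply p_def fun_eq_iff)
qed

lemma fin_transitions_step:
  assumes "e \<in> E" "finite (supp b \<eta>)"
  shows "(\<eta>, step \<phi> e \<eta>) \<in> fin_transitions b E \<phi>"
proof -
  have "finite (supp b (step \<phi> e \<eta>))" by (rule finite_subset[OF supp_step]) (use assms in simp)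
  moreover have "(\<eta>, step \<phi> e \<eta>) \<in> transitions UNIV E \<phi>"
    using assms(1) unfolding transitions_def PiE_UNIV_domain by blast
  ultimately show ?thesis using assms by (simp add: fin_transitions_def fin_configs_supp)
qed

lemma (in system) closed_form_potential:
  assumes inter: "is_interaction \<phi>" and form: "is_form b E \<phi> \<omega>" and closed: "closed_form b E \<phi> \<omega>"
  obtains f where "f (\<lambda>_. b) = 0"
    "\<And>e \<eta>. e \<in> E \<Longrightarrow> finite (supp b \<eta>) \<Longrightarrow> \<omega> (\<eta>, step \<phi> e \<eta>) = nabla \<phi> e f \<eta>"
proof -
  define T where "T = fin_transitions b E \<phi>"
  have T: "(\<eta>, step \<phi> e \<eta>) \<in> T" if "e \<in> E" "finite (supp b \<eta>)" for e \<eta>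
    using fin_transitions_step[OF that] by (simp add: T_def)
  have symT: "sym T"
  proof (rule symI)
    fix \<eta> \<eta>' assume "(\<eta>, \<eta>') \<in> T"
    then obtain e where e: "finite (supp b \<eta>)" "finite (supp b \<eta>')" "e \<in> E" "\<eta>' = step \<phi> e \<eta>"
      by (auto simp: T_def fin_transitions_def transitions_def fin_configs_supp)
    have "fst e \<noteq> snd e" using e(3) irreflE[of "fst e"] by (cases e) auto
    then consider "step \<phi> (prod.swap e) \<eta>' = \<eta>" | "\<eta>' = \<eta>" using step_reverse[OF inter] e(4) by blast
    then show "(\<eta>', \<eta>) \<in> T"
    proof cases
      case 1
      have "prod.swap e \<in> E" using e(3) symE by (cases e) (auto dest: symD)
      then show ?thesis using T[OF _ e(2), of "prod.swap e"] 1 by simp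
    next
      case 2
      then show ?thesis using T[OF e(3,1)] e(4) by simp
    qed
  qed
  have anti: "\<omega> (\<eta>', \<eta>) = - \<omega> (\<eta>, \<eta>')" if "(\<eta>, \<eta>') \<in> T" for \<eta> \<eta>'
    using form that unfolding is_form_def T_def by fastforce
  have zero: "sum_list (map \<omega> p) = 0" if "is_path T \<eta> p \<eta>" for \<eta> p
  proof (cases p)
    case (Cons e q)
    then have "\<eta> \<in> fin_configs b" using that by (auto simp: T_def fin_transitions_def)
    then show ?thesis using closed that unfolding closed_form_def T_def by blast
  qed simp
  obtain f where f: "\<And>\<eta> \<eta>'. (\<eta>, \<eta>') \<in> T \<Longrightarrow> \<omega> (\<eta>, \<eta>') = f \<eta>' - f \<eta>"
  proof (rule closed_cochain_exact[of T \<omega>])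
    show "sym T" by (rule symT)
    show "\<omega> (\<eta>', \<eta>) = - \<omega> (\<eta>, \<eta>')" if "(\<eta>, \<eta>') \<in> T" for \<eta> \<eta>' using anti that .
    show "sum_list (map \<omega> p) = 0" if "is_path T \<eta> p \<eta>" for \<eta> p using zero that .
  qed (rule that)
  show ?thesis
  proof (rule that[of "\<lambda>\<eta>. f \<eta> - f (\<lambda>_. b)"])
    fix e and \<eta> :: "'x \<Rightarrow> 's" assume "e \<in> E" "finite (supp b \<eta>)"
    then show "\<omega> (\<eta>, step \<phi> e \<eta>) = nabla \<phi> e (\<lambda>\<eta>. f \<eta> - f (\<lambda>_. b)) \<eta>"
      using f[OF T] by (simp add: nabla_def)
  qed simp
qed


section \<open>Locality and the canonical expansion\<close>

definition truncated :: "'s \<Rightarrow> 'v set \<Rightarrow> ('v \<Rightarrow> 's) \<Rightarrow> 'v \<Rightarrow> 's" where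
  "truncated b A \<eta> = (\<lambda>x. if x \<in> A then \<eta> x else b)"

text \<open>The inclusion-exclusion formula for the terms of the canonical expansion.\<close>

definition moebius :: "'s \<Rightarrow> (('x \<Rightarrow> 's) \<Rightarrow> real) \<Rightarrow> 'x set \<Rightarrow> ('x \<Rightarrow> 's) \<Rightarrow> real" where
  "moebius b F \<Lambda> \<eta> = (-1) ^ card \<Lambda> * (\<Sum>A\<in>Pow \<Lambda>. (-1) ^ card A * F (truncated b A \<eta>))"

lemma alternating_sum_split:
  fixes G :: "'x set \<Rightarrow> real"
  assumes "finite \<Lambda>" "x \<in> \<Lambda>"
  shows "(\<Sum>A\<in>Pow \<Lambda>. (-1) ^ card A * G A) = (\<Sum>A\<in>Pow (\<Lambda> - {x}). (-1) ^ card A * (G A - G (insert x A)))"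
proof -
  define D where "D = \<Lambda> - {x}"
  have D: "\<Lambda> = insert x D" "x \<notin> D" "finite D" using assms by (auto simp: D_def)
  have inj: "inj_on (insert x) (Pow D)" using D(2) by (auto simp: inj_on_def)
  have "(\<Sum>A\<in>Pow \<Lambda>. (-1) ^ card A * G A)
      = (\<Sum>A\<in>Pow D. (-1) ^ card A * G A) + (\<Sum>A\<in>insert x ` Pow D. (-1) ^ card A * G A)"
    unfolding D(1) Pow_insert using D by (intro sum.union_disjoint) auto
  also have "(\<Sum>A\<in>insert x ` Pow D. (-1) ^ card A * G A) = (\<Sum>A\<in>Pow D. - ((-1) ^ card A * G (insert x A)))"
    unfolding sum.reindex[OF inj] comp_def
  proof (rule sum.cong)
    fix A assume "A \<in> Pow D"
    then have "finite A" "x \<notin> A" using D by (auto intro: finite_subset)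
    then show "(-1) ^ card (insert x A) * G (insert x A) = - ((-1) ^ card A * G (insert x A))" by simp
  qed simp
  finally show ?thesis by (simp add: D_def right_diff_distrib sum_negf sum_subtractf)
qed

lemma moebius_zero:
  assumes "finite \<Lambda>" "x \<in> \<Lambda>" "\<eta> x = b" shows "moebius b F \<Lambda> \<eta> = 0"
proof -
  have "truncated b (insert x A) \<eta> = truncated b A \<eta>" for A using assms(3) by (auto simp: truncated_def)
  then show ?thesis unfolding moebius_def alternating_sum_split[OF assms(1,2)] by simp
qed

lemma moebius_expansion:
  fixes b :: 's and F :: "('x \<Rightarrow> 's) \<Rightarrow> real"
  shows "is_expansion b F (moebius b F)"
  unfolding is_expansion_def
proof (intro conjI allI impI ballI)
  fix \<Lambda> :: "'x set" assume fin: "finite \<Lambda>"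
  have dep: "moebius b F \<Lambda> \<eta> = moebius b F \<Lambda> \<eta>'" if "\<forall>x\<in>\<Lambda>. \<eta> x = \<eta>' x" for \<eta> \<eta>'
  proof -
    have "truncated b A \<eta> = truncated b A \<eta>'" if "A \<in> Pow \<Lambda>" for A
      using that \<open>\<forall>x\<in>\<Lambda>. \<eta> x = \<eta>' x\<close> by (auto simp: truncated_def fun_eq_iff)
    then show ?thesis unfolding moebius_def by simp
  qed
  have "moebius b F \<Lambda> \<in> C_on b \<Lambda>" unfolding C_on_def by (intro CollectI ballI impI) (rule dep)
  moreover have "moebius b F \<Lambda> \<eta> = 0" if "\<exists>x\<in>\<Lambda>. \<eta> x = b" for \<eta>
    using that moebius_zero[OF fin] by metis
  ultimately show "moebius b F \<Lambda> \<in> C_exact b \<Lambda>" unfolding C_exact_def by simp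
next
  fix \<eta> :: "'x \<Rightarrow> 's" assume "\<eta> \<in> fin_configs b"
  then have fin: "finite (supp b \<eta>)" by (simp add: fin_configs_supp)
  have "moebius b F \<Lambda> \<eta> = 0" if "\<Lambda> \<in> {\<Lambda>. finite \<Lambda>} - Pow (supp b \<eta>)" for \<Lambda>
    using that moebius_zero[of \<Lambda> _ \<eta> b F] by (auto simp: supp_def)
  then have "(\<Sum>\<^sub>\<infinity>\<Lambda>\<in>{\<Lambda>. finite \<Lambda>}. moebius b F \<Lambda> \<eta>) = (\<Sum>\<^sub>\<infinity>\<Lambda>\<in>Pow (supp b \<eta>). moebius b F \<Lambda> \<eta>)"
    using fin by (intro infsum_cong_neutral) (auto intro: finite_subset)
  also have "\<dots> = (\<Sum>\<Lambda>\<in>Pow (supp b \<eta>). moebius b F \<Lambda> \<eta>)" using fin by (simp add: infsum_finite)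
  also have "\<dots> = F (truncated b (supp b \<eta>) \<eta>)"
    unfolding moebius_def
    by (rule inclusion_exclusion_symmetric[where g = "\<lambda>S. \<Sum>A\<in>Pow S. (-1) ^ card A * F (truncated b A \<eta>)"
          and f = "\<lambda>S. F (truncated b S \<eta>)", OF refl fin, symmetric])
  also have "truncated b (supp b \<eta>) \<eta> = \<eta>" by (auto simp: truncated_def supp_def)
  finally show "F \<eta> = (\<Sum>\<^sub>\<infinity>\<Lambda>\<in>{\<Lambda>. finite \<Lambda>}. moebius b F \<Lambda> \<eta>)" by simp
qed

lemma gdiam_witness:
  assumes "gdiam E \<Lambda> > r" shows "\<exists>x\<in>\<Lambda>. \<exists>y\<in>\<Lambda>. gdist E x y > r"
proof (rule ccontr)
  assume "\<not> (\<exists>x\<in>\<Lambda>. \<exists>y\<in>\<Lambda>. gdist E x y > r)"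
  moreover have "\<Lambda> \<noteq> {}" using assms by (auto simp: gdiam_def)
  ultimately have "gdiam E \<Lambda> \<le> r"
    unfolding gdiam_def by (intro cSUP_least) (auto simp: not_less)
  then show False using assms by simp
qed

context system
begin

text \<open>If \<open>\<Lambda>\<close> contains points \<open>x\<close> and \<open>y\<close> at distance more than \<open>r\<close>, then grouping the subsets of \<open>\<Lambda>\<close> into
squares that differ by \<open>x\<close> and \<open>y\<close> makes the inclusion-exclusion sum cancel: changing the state at
\<open>x\<close> has the same effect whether or not \<open>y\<close> is occupied.\<close>

lemma site_local_C0_unif:
  assumes loc: "site_local r F" and base: "F (\<lambda>_. b) = 0"
  shows "F \<in> C0_unif b E"
proof -
  have "moebius b F \<Lambda> \<eta> = 0" if \<Lambda>: "finite \<Lambda>" "gdiam E \<Lambda> > r" for \<Lambda> \<eta>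
  proof -
    obtain x y where xy: "x \<in> \<Lambda>" "y \<in> \<Lambda>" "gdist E x y > r" using gdiam_witness[OF \<Lambda>(2)] by blast
    then have ne: "x \<noteq> y" by auto
    have square: "F (truncated b A \<eta>) - F (truncated b (insert x A) \<eta>)
        = F (truncated b (insert y A) \<eta>) - F (truncated b (insert x (insert y A)) \<eta>)"
      if A: "A \<subseteq> \<Lambda>" for A
    proof -
      have fin: "finite (supp b (truncated b B \<eta>))" if "B \<subseteq> \<Lambda>" for B
        by (rule finite_subset[OF _ \<Lambda>(1)]) (use that in \<open>auto simp: truncated_def supp_def\<close>)
      have upd: "truncated b (insert x B) \<eta> = (truncated b B \<eta>)(x := \<eta> x)" for B by (auto simp: truncated_def)
      have "F ((truncated b (insert y A) \<eta>)(x := \<eta> x)) - F (truncated b (insert y A) \<eta>)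
          = F ((truncated b A \<eta>)(x := \<eta> x)) - F (truncated b A \<eta>)"
      proof (rule loc[unfolded site_local_def, rule_format])
        fix z assume "z \<in> nball E x r"
        then have "z \<noteq> y" using xy(3) by (auto simp: nball_def)
        then show "truncated b (insert y A) \<eta> z = truncated b A \<eta> z" by (simp add: truncated_def)
      qed (use fin A xy in auto)
      then show ?thesis unfolding upd by simp
    qed
    have "(\<Sum>A\<in>Pow \<Lambda>. (-1) ^ card A * F (truncated b A \<eta>))
        = (\<Sum>A\<in>Pow (\<Lambda> - {x}). (-1) ^ card A * (F (truncated b A \<eta>) - F (truncated b (insert x A) \<eta>)))"
      by (rule alternating_sum_split[OF \<Lambda>(1) xy(1)])
    also have "\<dots> = (\<Sum>A\<in>Pow (\<Lambda> - {x} - {y}). (-1) ^ card A *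
        (F (truncated b A \<eta>) - F (truncated b (insert x A) \<eta>)
          - (F (truncated b (insert y A) \<eta>) - F (truncated b (insert x (insert y A)) \<eta>))))"
      by (rule alternating_sum_split) (use \<Lambda>(1) xy(2) ne in auto)
    also have "\<dots> = 0"
    proof (rule sum.neutral, intro ballI)
      fix A assume "A \<in> Pow (\<Lambda> - {x} - {y})"
      then have "A \<subseteq> \<Lambda>" by blast
      from square[OF this] show "(-1) ^ card A *
        (F (truncated b A \<eta>) - F (truncated b (insert x A) \<eta>)
          - (F (truncated b (insert y A) \<eta>) - F (truncated b (insert x (insert y A)) \<eta>))) = 0" by simp
    qed
    finally show ?thesis unfolding moebius_def by simp
  qed
  then have "\<forall>\<Lambda>. finite \<Lambda> \<and> real (gdiam E \<Lambda>) > real (Suc r) \<longrightarrow> (\<forall>\<eta>\<in>fin_configs b. moebius b F \<Lambda> \<eta> = 0)"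
    by simp
  moreover have "real (Suc r) > 0" by simp
  ultimately have "uniform_function b E F" unfolding uniform_function_def
    using moebius_expansion[of b F] by blast
  then show ?thesis using base by (simp add: C0_unif_def)
qed

end


section \<open>Invariant functions are conserved quantities\<close>

context system
begin

text \<open>A consequence of locality that passes to translates and differences without any estimate of
distances.\<close>

definition additive_far :: "(('x \<Rightarrow> 's) \<Rightarrow> real) \<Rightarrow> bool" where
  "additive_far u \<longleftrightarrow> (\<forall>\<eta>. finite (supp b \<eta>) \<longrightarrow>
     (\<exists>A. finite A \<and> (\<forall>x s. x \<notin> A \<longrightarrow> u (\<eta>(x := s)) = u \<eta> + u ((\<lambda>_. b)(x := s)))))"

lemma site_local_additive_far:
  assumes loc: "site_local r f" and base: "f (\<lambda>_. b) = 0" shows "additive_far f"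
  unfolding additive_far_def
proof (intro allI impI)
  fix \<eta> :: "'x \<Rightarrow> 's" assume fin: "finite (supp b \<eta>)"
  define A where "A = (\<Union>y\<in>supp b \<eta>. nball E y r)"
  have "f (\<eta>(x := s)) = f \<eta> + f ((\<lambda>_. b)(x := s))" if x: "x \<notin> A" for x s
  proof -
    have "f (\<eta>(x := s)) - f \<eta> = f ((\<lambda>_. b)(x := s)) - f (\<lambda>_. b)"
    proof (rule loc[unfolded site_local_def, rule_format])
      fix y assume "y \<in> nball E x r"
      then have "x \<in> nball E y r" using gdist_commute[of x y] by (simp add: nball_def)
      then show "\<eta> y = b" using x unfolding A_def supp_def by blast
    qed (use fin in simp_all)
    then show ?thesis using base by simp
  qed
  moreover have "finite A" unfolding A_def using fin finite_nball by blast
  ultimately show "\<exists>A. finite A \<and> (\<forall>x s. x \<notin> A \<longrightarrow> f (\<eta>(x := s)) = f \<eta> + f ((\<lambda>_. b)(x := s)))" by blast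
qed

text \<open>A function with zero gradient depends only on the conserved quantities.  A configuration may
therefore be rebuilt by adding its states one by one at far away sites, where the function is
additive.\<close>

lemma invariant_is_conserved:
  assumes base: "u (\<lambda>_. b) = 0" and far: "additive_far u"
    and inv: "\<And>e \<eta>. e \<in> E \<Longrightarrow> finite (supp b \<eta>) \<Longrightarrow> u (step \<phi> e \<eta>) = u \<eta>"
  obtains \<xi> where "\<xi> \<in> Consv b \<phi>" "\<And>\<eta>. finite (supp b \<eta>) \<Longrightarrow> u \<eta> = (\<Sum>x\<in>supp b \<eta>. \<xi> (\<eta> x))"
proof -
  have cong: "u \<eta> = u \<eta>'" if "finite (supp b \<eta>)" "finite (supp b \<eta>')" "content b \<eta> \<sim>\<^sub>c content b \<eta>'" for \<eta> \<eta>'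
  proof -
    have "(\<eta>, \<eta>') \<in> (moves UNIV)\<^sup>*"
      by (rule moves_connect[OF connected_UNIV that(1,2) _ _ that(3)]) simp_all
    then show ?thesis
    proof (induction rule: rtrancl_induct)
      case (step \<zeta> \<zeta>')
      then obtain e where "e \<in> E" "finite (supp b \<zeta>)" "\<zeta>' = step \<phi> e \<zeta>"
        unfolding moves_def induced_def by blast
      then show ?case using inv step.IH by simp
    qed simp
  qed
  define p where "p = (undefined :: 'x)"
  define \<xi> where "\<xi> s = u ((\<lambda>_. b)(p := s))" for s
  have single: "u ((\<lambda>_. b)(x := s)) = \<xi> s" for x s
    unfolding \<xi>_def
    by (rule cong) (simp_all add: finite_supp_upd cequiv_common[OF cequiv_single cequiv_single])
  have u: "u \<eta> = (\<Sum>s\<in>#m. \<xi> s)" if "finite (supp b \<eta>)" "content b \<eta> \<sim>\<^sub>c m" for \<eta> m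
    using that
  proof (induction m arbitrary: \<eta>)
    case empty
    then show ?case using cong[of \<eta> "\<lambda>_. b"] base by simp
  next
    case (add s m)
    have "infinite (UNIV :: 'x set) \<or> size m \<le> card (UNIV :: 'x set)" using infinite_UNIV by simp
    then obtain \<zeta> :: "'x \<Rightarrow> 's" where \<zeta>: "supp b \<zeta> \<subseteq> UNIV" "finite (supp b \<zeta>)" "content b \<zeta> \<sim>\<^sub>c m"
      by (rule realize_content)
    obtain A where A: "finite A" "\<And>x s. x \<notin> A \<Longrightarrow> u (\<zeta>(x := s)) = u \<zeta> + u ((\<lambda>_. b)(x := s))"
      using far \<zeta>(2) unfolding additive_far_def by blast
    have "finite (A \<union> supp b \<zeta>)" using A(1) \<zeta>(2) by simp
    then obtain x where x: "x \<notin> A" "x \<notin> supp b \<zeta>"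
      using ex_new_if_finite[OF infinite_UNIV] by blast
    define \<delta> where "\<delta> = (\<lambda>_. b)(x := s)"
    have \<delta>: "finite (supp b \<delta>)" "supp b \<delta> \<subseteq> {x}"
      unfolding \<delta>_def by (simp add: finite_supp_upd) (auto simp: supp_def)
    have merge: "\<zeta>(x := s) = merge b \<delta> \<zeta>"
      using x by (auto simp: \<delta>_def merge_def supp_def fun_eq_iff)
    have "content b (merge b \<delta> \<zeta>) = content b \<delta> + content b \<zeta>"
      using \<delta> \<zeta>(2) x by (intro content_merge) auto
    then have "content b (\<zeta>(x := s)) \<sim>\<^sub>c {#s#} + m"
      unfolding merge using cequiv_add[OF cequiv_single[of b \<phi> x s] \<zeta>(3)] by (simp add: \<delta>_def)
    then have "content b \<eta> \<sim>\<^sub>c content b (\<zeta>(x := s))"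
      using cequiv_common[OF add.prems(2)] by simp
    then have "u \<eta> = u (\<zeta>(x := s))" by (rule cong[OF add.prems(1) finite_supp_upd[OF \<zeta>(2)]])
    then show ?case using A(2)[OF x(1), of s] add.IH[OF \<zeta>(2,3)] single by simp
  qed
  have "(\<lambda>_. b)(p := b) = (\<lambda>_. b)" by auto
  then have \<xi>b: "\<xi> b = 0" using base by (simp add: \<xi>_def)
  have "\<xi> s + \<xi> t = \<xi> (fst (\<phi> (s, t))) + \<xi> (snd (\<phi> (s, t)))" for s t
  proof -
    have "infinite (UNIV :: 'x set) \<or> size {#s, t#} \<le> card (UNIV :: 'x set)" using infinite_UNIV by simp
    then obtain \<zeta> :: "'x \<Rightarrow> 's" where \<zeta>: "supp b \<zeta> \<subseteq> UNIV" "finite (supp b \<zeta>)" "content b \<zeta> \<sim>\<^sub>c {#s, t#}"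
      by (rule realize_content)
    have c: "content b \<zeta> \<sim>\<^sub>c {#fst (\<phi> (s, t)), snd (\<phi> (s, t))#}"
      by (rule cequiv_trans[OF \<zeta>(3)]) (auto simp: cequiv_def Consv_def)
    show ?thesis using u[OF \<zeta>(2,3)] u[OF \<zeta>(2) c] by simp
  qed
  then have "\<xi> \<in> Consv b \<phi>" using \<xi>b by (simp add: Consv_def)
  moreover have "u \<eta> = (\<Sum>x\<in>supp b \<eta>. \<xi> (\<eta> x))" if "finite (supp b \<eta>)" for \<eta>
    using u[OF that cequiv_refl] content_sum[where \<xi> = \<xi>, OF that order_refl \<xi>b] by simp
  ultimately show ?thesis using that by blast
qed

end


section \<open>Coordinates and first moments for a free action\<close>

lemma additive_int_linear:
  fixes h :: "int \<Rightarrow> real"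
  assumes "\<And>m n. h (m + n) = h m + h n" shows "h n = of_int n * h 1"
proof -
  have 0: "h 0 = 0" using assms[of 0 0] by simp
  show ?thesis
  proof (induction n rule: int_induct[of _ 0])
    case base then show ?case by (simp add: 0)
  next
    case (step1 i) then show ?case by (simp add: assms algebra_simps)
  next
    case (step2 i)
    have "h (i - 1) = h i - h 1" using assms[of "i - 1" 1] by simp
    then show ?case using step2 by (simp add: algebra_simps)
  qed
qed

lemma carrier_Zpow: "carrier (Zpow d) = {1..d} \<rightarrow>\<^sub>E UNIV"
  by (simp add: Zpow_def integer_group_def)

lemma mult_Zpow: "\<sigma> \<otimes>\<^bsub>Zpow d\<^esub> \<tau> = (\<lambda>j\<in>{1..d}. \<sigma> j + \<tau> j)"
  by (simp add: Zpow_def integer_group_def)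

lemma group_Zpow: "group (Zpow d)"
  by (simp add: Zpow_def)

definition unit_Zpow :: "nat \<Rightarrow> nat \<Rightarrow> int \<Rightarrow> nat \<Rightarrow> int" where
  "unit_Zpow d j n = (\<lambda>i\<in>{1..d}. if i = j then n else 0)"

lemma additive_Zpow_linear:
  fixes h :: "(nat \<Rightarrow> int) \<Rightarrow> real"
  assumes add: "\<And>\<sigma> \<tau>. \<sigma> \<in> carrier (Zpow d) \<Longrightarrow> \<tau> \<in> carrier (Zpow d) \<Longrightarrow> h (\<sigma> \<otimes>\<^bsub>Zpow d\<^esub> \<tau>) = h \<sigma> + h \<tau>"
    and \<sigma>: "\<sigma> \<in> carrier (Zpow d)"
  shows "h \<sigma> = (\<Sum>j=1..d. of_int (\<sigma> j) * h (unit_Zpow d j 1))"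
proof -
  define trunc where "trunc k = (\<lambda>i\<in>{1..d}. if i \<le> k then \<sigma> i else 0)" for k
  have carr: "trunc k \<in> carrier (Zpow d)" "unit_Zpow d j n \<in> carrier (Zpow d)" for k j n
    by (auto simp: carrier_Zpow trunc_def unit_Zpow_def)
  have zero: "h (trunc 0) = 0"
  proof -
    have "trunc 0 \<otimes>\<^bsub>Zpow d\<^esub> trunc 0 = trunc 0" by (auto simp: mult_Zpow trunc_def fun_eq_iff)
    then show ?thesis using add[OF carr(1) carr(1), of 0 0] by simp
  qed
  have unit: "h (unit_Zpow d j n) = of_int n * h (unit_Zpow d j 1)" for j n
  proof (rule additive_int_linear[of "\<lambda>n. h (unit_Zpow d j n)"])
    fix m n
    have "unit_Zpow d j (m + n) = unit_Zpow d j m \<otimes>\<^bsub>Zpow d\<^esub> unit_Zpow d j n"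
      by (auto simp: mult_Zpow unit_Zpow_def fun_eq_iff)
    then show "h (unit_Zpow d j (m + n)) = h (unit_Zpow d j m) + h (unit_Zpow d j n)"
      using add[OF carr(2) carr(2)] by simp
  qed
  have partial: "h (trunc k) = (\<Sum>j=1..k. of_int (\<sigma> j) * h (unit_Zpow d j 1))" if "k \<le> d" for k
    using that
  proof (induction k)
    case (Suc k)
    have "trunc (Suc k) = trunc k \<otimes>\<^bsub>Zpow d\<^esub> unit_Zpow d (Suc k) (\<sigma> (Suc k))"
      using Suc.prems by (auto simp: mult_Zpow trunc_def unit_Zpow_def fun_eq_iff)
    then have "h (trunc (Suc k)) = h (trunc k) + h (unit_Zpow d (Suc k) (\<sigma> (Suc k)))"
      using add[OF carr(1) carr(2)] by simp
    then show ?case using Suc unit[of "Suc k" "\<sigma> (Suc k)"] by simp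
  qed (simp add: zero)
  have "trunc d = \<sigma>"
  proof
    fix i show "trunc d i = \<sigma> i"
    proof (cases "i \<in> {1..d}")
      case False
      have "\<sigma> i = undefined" by (rule PiE_arb[OF \<sigma>[unfolded carrier_Zpow] False])
      then show ?thesis unfolding trunc_def restrict_def using False by simp
    qed (simp add: trunc_def)
  qed
  then show ?thesis using partial[OF order_refl] by simp
qed

lemma sum_fun_apply: "finite I \<Longrightarrow> (\<Sum>i\<in>I. f i) x = (\<Sum>i\<in>I. f i x)"
  for f :: "'i \<Rightarrow> 'a \<Rightarrow> real"
  by (induction rule: finite_induct) (auto simp: zero_fun_def)

lemma consv_basis_expand:
  assumes "consv_basis b \<phi> I \<xi>" "finite I" "\<zeta> \<in> Consv b \<phi>"
  obtains a where "\<And>s. \<zeta> s = (\<Sum>i\<in>I. a i * \<xi> i s)"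
proof -
  have inj: "inj_on \<xi> I" and "\<zeta> \<in> fun_vs.span (\<xi> ` I)"
    using assms by (auto simp: consv_basis_def)
  then obtain u where "\<zeta> = (\<Sum>v\<in>\<xi> ` I. fun_scale (u v) v)"
    using fun_vs.span_finite[of "\<xi> ` I"] assms(2) by blast
  then have "\<zeta> = (\<Sum>i\<in>I. fun_scale (u (\<xi> i)) (\<xi> i))" by (simp add: sum.reindex[OF inj])
  then have "\<zeta> s = (\<Sum>i\<in>I. u (\<xi> i) * \<xi> i s)" for s
    using assms(2) by (simp add: sum_fun_apply fun_scale_def)
  then show ?thesis by (rule that)
qed

text \<open>On configurations of finite support this is the formal sum over all sites, if the base state has
weight zero.\<close>

definition site_sum :: "'s \<Rightarrow> ('x \<Rightarrow> 's \<Rightarrow> real) \<Rightarrow> ('x \<Rightarrow> 's) \<Rightarrow> real" where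
  "site_sum b w \<eta> = (\<Sum>x\<in>supp b \<eta>. w x (\<eta> x))"

lemma site_sum_superset:
  assumes "finite A" "supp b \<eta> \<subseteq> A" "\<And>x. w x b = 0"
  shows "site_sum b w \<eta> = (\<Sum>x\<in>A. w x (\<eta> x))"
  unfolding site_sum_def using assms by (intro sum.mono_neutral_left) (auto simp: supp_def)

lemma site_sum_upd:
  assumes "finite (supp b \<eta>)" "\<And>x. w x b = 0"
  shows "site_sum b w (\<eta>(x := s)) - site_sum b w \<eta> = w x s - w x (\<eta> x)"
proof -
  define A where "A = insert x (supp b \<eta>)"
  have A: "finite A" "x \<in> A" "supp b (\<eta>(x := s)) \<subseteq> A" "supp b \<eta> \<subseteq> A"
    using assms(1) by (auto simp: A_def supp_def)
  have "(\<Sum>y\<in>A. g y) = g x + (\<Sum>y\<in>A - {x}. g y)" for g :: "'a \<Rightarrow> real"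
    using sum.remove[OF A(1,2)] .
  moreover have "(\<Sum>y\<in>A - {x}. w y ((\<eta>(x := s)) y)) = (\<Sum>y\<in>A - {x}. w y (\<eta> y))"
    by (intro sum.cong) auto
  ultimately show ?thesis
    using site_sum_superset[of A b _ w, OF A(1) _ assms(2)] A(3,4) by simp
qed

lemma consv_sum_finite_support:
  assumes "finite (supp b \<eta>)" "\<xi> b = 0"
  shows "consv_sum \<xi> W \<eta> = (\<Sum>x\<in>supp b \<eta> \<inter> W. \<xi> (\<eta> x))"
proof -
  have "consv_sum \<xi> W \<eta> = (\<Sum>\<^sub>\<infinity>x\<in>supp b \<eta> \<inter> W. \<xi> (\<eta> x))"
    unfolding consv_sum_def
  proof (rule infsum_cong_neutral)
    fix x assume "x \<in> W - supp b \<eta> \<inter> W"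
    then have "\<eta> x = b" by (auto simp: supp_def)
    then show "\<xi> (\<eta> x) = 0" using assms(2) by simp
  qed auto
  then show ?thesis using assms(1) by (simp add: infsum_finite)
qed

text \<open>The sets \<open>W \<tau>\<close> are the fibres of \<open>\<kappa>\<close>, and only finitely many of them meet the support.\<close>

lemma first_moment_eq_site_sum:
  assumes fin: "finite (supp b \<eta>)" and \<xi>: "\<xi> b = 0"
    and \<kappa>: "\<And>x. \<kappa> x \<in> T" "\<And>x \<tau>. \<tau> \<in> T \<Longrightarrow> x \<in> W \<tau> \<longleftrightarrow> \<kappa> x = \<tau>"
  shows "(\<Sum>\<^sub>\<infinity>\<tau>\<in>T. of_int (c \<tau>) * consv_sum \<xi> (W \<tau>) \<eta>) = site_sum b (\<lambda>x s. of_int (c (\<kappa> x)) * \<xi> s) \<eta>"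
proof -
  define S where "S = supp b \<eta>"
  have cs: "consv_sum \<xi> (W \<tau>) \<eta> = (\<Sum>x | x \<in> S \<and> \<kappa> x = \<tau>. \<xi> (\<eta> x))" if "\<tau> \<in> T" for \<tau>
    unfolding consv_sum_finite_support[of b \<eta> \<xi>, OF fin \<xi>] S_def
    by (rule sum.cong) (use \<kappa>(2)[OF that] in auto)
  have "(\<Sum>\<^sub>\<infinity>\<tau>\<in>T. of_int (c \<tau>) * consv_sum \<xi> (W \<tau>) \<eta>)
      = (\<Sum>\<^sub>\<infinity>\<tau>\<in>\<kappa> ` S. of_int (c \<tau>) * consv_sum \<xi> (W \<tau>) \<eta>)"
  proof (rule infsum_cong_neutral)
    fix \<tau> assume \<tau>: "\<tau> \<in> T - \<kappa> ` S"
    then have "{x. x \<in> S \<and> \<kappa> x = \<tau>} = {}" by auto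
    then show "of_int (c \<tau>) * consv_sum \<xi> (W \<tau>) \<eta> = 0" using cs[of \<tau>] \<tau> by (simp only: sum.empty) simp
  qed (use \<kappa>(1) in auto)
  also have "\<dots> = (\<Sum>\<tau>\<in>\<kappa> ` S. of_int (c \<tau>) * consv_sum \<xi> (W \<tau>) \<eta>)"
    using fin by (simp add: S_def infsum_finite)
  also have "\<dots> = (\<Sum>\<tau>\<in>\<kappa> ` S. \<Sum>x | x \<in> S \<and> \<kappa> x = \<tau>. of_int (c (\<kappa> x)) * \<xi> (\<eta> x))"
  proof (rule sum.cong)
    fix \<tau> assume "\<tau> \<in> \<kappa> ` S"
    then have "\<tau> \<in> T" using \<kappa>(1) by auto
    then show "of_int (c \<tau>) * consv_sum \<xi> (W \<tau>) \<eta> = (\<Sum>x | x \<in> S \<and> \<kappa> x = \<tau>. of_int (c (\<kappa> x)) * \<xi> (\<eta> x))"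
      by (simp add: cs sum_distrib_left)
  qed simp
  also have "\<dots> = (\<Sum>x\<in>S. of_int (c (\<kappa> x)) * \<xi> (\<eta> x))"
    by (rule sum.image_gen[symmetric]) (simp add: fin S_def)
  finally show ?thesis by (simp add: site_sum_def S_def)
qed

text \<open>The fundamental domain identifies every orbit with the group; \<open>\<kappa> x\<close> is the element that corresponds
to \<open>x\<close>.\<close>

lemma orbit_coordinates:
  fixes \<alpha> :: "'g \<Rightarrow> 'x \<Rightarrow> 'x"
  assumes act: "group_action G UNIV \<alpha>" and free: "free_action G \<alpha>" and dom: "fundamental_domain G \<alpha> \<Lambda>0"
  obtains \<kappa> where "\<And>x. \<kappa> x \<in> carrier G"
    "\<And>x \<tau>. \<tau> \<in> carrier G \<Longrightarrow> x \<in> \<alpha> \<tau> ` \<Lambda>0 \<longleftrightarrow> \<kappa> x = \<tau>"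
    "\<And>x \<sigma>. \<sigma> \<in> carrier G \<Longrightarrow> \<kappa> (\<alpha> \<sigma> x) = \<sigma> \<otimes>\<^bsub>G\<^esub> \<kappa> x"
proof -
  interpret act: group_action G UNIV \<alpha> by fact
  interpret G: group G using act.group_hom by (rule group_hom.axioms(1))
  have comp: "\<alpha> (g \<otimes>\<^bsub>G\<^esub> h) x = \<alpha> g (\<alpha> h x)" if "g \<in> carrier G" "h \<in> carrier G" for g h x
    using act.composition_rule[of x g h] that by simp
  have one: "\<alpha> \<one>\<^bsub>G\<^esub> x = x" for x using act.id_eq_one by (metis UNIV_I restrict_apply)
  have ex: "\<exists>\<tau>\<in>carrier G. x \<in> \<alpha> \<tau> ` \<Lambda>0" for x
  proof -
    have "orbit G \<alpha> x \<in> orbits G UNIV \<alpha>" by (auto simp: orbits_def)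
    then obtain y where "y \<in> \<Lambda>0" "y \<in> orbit G \<alpha> x" using dom unfolding fundamental_domain_def by blast
    then obtain g where g: "g \<in> carrier G" "\<alpha> g x \<in> \<Lambda>0" unfolding orbit_def by blast
    have "\<alpha> (inv\<^bsub>G\<^esub> g) (\<alpha> g x) = x" using comp[of "inv\<^bsub>G\<^esub> g" g x] g(1) one by simp
    then show ?thesis using g by (intro bexI[of _ "inv\<^bsub>G\<^esub> g"] image_eqI[of _ _ "\<alpha> g x"]) auto
  qed
  have uniq: "\<sigma> = \<tau>" if st: "\<sigma> \<in> carrier G" "\<tau> \<in> carrier G" "x \<in> \<alpha> \<sigma> ` \<Lambda>0" "x \<in> \<alpha> \<tau> ` \<Lambda>0" for x \<sigma> \<tau>
  proof -
    obtain y z where yz: "y \<in> \<Lambda>0" "z \<in> \<Lambda>0" "x = \<alpha> \<sigma> y" "x = \<alpha> \<tau> z" using st by blast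
    have undo: "\<alpha> (inv\<^bsub>G\<^esub> g) (\<alpha> g v) = v" if "g \<in> carrier G" for g v
      using comp[of "inv\<^bsub>G\<^esub> g" g v] that one by simp
    have "y = \<alpha> (inv\<^bsub>G\<^esub> \<sigma>) x" "z = \<alpha> (inv\<^bsub>G\<^esub> \<tau>) x" using undo st yz by metis+
    then have "y \<in> orbit G \<alpha> x" "z \<in> orbit G \<alpha> x" using st(1,2) unfolding orbit_def by blast+
    moreover have "orbit G \<alpha> x \<in> orbits G UNIV \<alpha>" by (auto simp: orbits_def)
    ultimately have "y = z" using dom yz(1,2) unfolding fundamental_domain_def by blast
    then show ?thesis using free st(1,2) yz unfolding free_action_def by metis
  qed
  define \<kappa> where "\<kappa> x = (SOME \<tau>. \<tau> \<in> carrier G \<and> x \<in> \<alpha> \<tau> ` \<Lambda>0)" for x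
  have \<kappa>: "\<kappa> x \<in> carrier G \<and> x \<in> \<alpha> (\<kappa> x) ` \<Lambda>0" for x
    unfolding \<kappa>_def by (rule someI_ex) (use ex in blast)
  have \<kappa>_iff: "x \<in> \<alpha> \<tau> ` \<Lambda>0 \<longleftrightarrow> \<kappa> x = \<tau>" if "\<tau> \<in> carrier G" for x \<tau>
    using \<kappa> uniq that by blast
  have "\<kappa> (\<alpha> \<sigma> x) = \<sigma> \<otimes>\<^bsub>G\<^esub> \<kappa> x" if "\<sigma> \<in> carrier G" for x \<sigma>
  proof -
    obtain y where y: "y \<in> \<Lambda>0" "x = \<alpha> (\<kappa> x) y" using \<kappa> by blast
    have "\<alpha> \<sigma> x = \<alpha> (\<sigma> \<otimes>\<^bsub>G\<^esub> \<kappa> x) y" using comp[OF that, of "\<kappa> x" y] \<kappa> y(2) by simp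
    then show ?thesis using \<kappa>_iff[of "\<sigma> \<otimes>\<^bsub>G\<^esub> \<kappa> x" "\<alpha> \<sigma> x"] \<kappa> that y(1) by blast
  qed
  then show ?thesis using that[of \<kappa>] \<kappa> \<kappa>_iff by blast
qed

lemma finite_supp_comp: "bij g \<Longrightarrow> finite (supp b (\<eta> \<circ> g)) \<longleftrightarrow> finite (supp b \<eta>)"
proof -
  assume g: "bij g"
  have "supp b (\<eta> \<circ> g) = g -` supp b \<eta>" by (auto simp: supp_def)
  then show ?thesis using finite_vimage_iff[OF g] by simp
qed

lemma site_sum_comp:
  assumes "bij g" shows "site_sum b w (\<eta> \<circ> g) = site_sum b (\<lambda>y. w (inv_into UNIV g y)) \<eta>"
proof -
  have "bij_betw g (supp b (\<eta> \<circ> g)) (supp b \<eta>)"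
    using assms by (auto simp: bij_betw_def supp_def inj_on_def bij_def surj_def image_iff)
  then have "(\<Sum>x\<in>supp b (\<eta> \<circ> g). w (inv_into UNIV g (g x)) (\<eta> (g x))) = (\<Sum>y\<in>supp b \<eta>. w (inv_into UNIV g y) (\<eta> y))"
    by (rule sum.reindex_bij_betw)
  then show ?thesis using assms by (simp add: site_sum_def bij_is_inj)
qed

lemma step_comp:
  assumes "bij g" "e = (g (fst e'), g (snd e'))"
  shows "step \<phi> e \<eta> \<circ> g = step \<phi> e' (\<eta> \<circ> g)"
  using assms(1) by (auto simp: assms(2) step_apply fun_eq_iff bij_is_inj inj_eq)


section \<open>The shift cocycle of a potential\<close>

lemma group_action_bij:
  assumes "group_action G UNIV \<alpha>" "\<sigma> \<in> carrier G" shows "bij (\<alpha> \<sigma>)"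
  using group_action.inj_prop[OF assms] group_action.surj_prop[OF assms] by (simp add: bij_def)

context system
begin

lemma additive_far_comp:
  assumes far: "additive_far f" and g: "bij g"
  shows "additive_far (\<lambda>\<eta>. f (\<eta> \<circ> g))"
  unfolding additive_far_def
proof (intro allI impI)
  fix \<eta> :: "'x \<Rightarrow> 's" assume "finite (supp b \<eta>)"
  then have "finite (supp b (\<eta> \<circ> g))" by (rule finite_supp_comp[OF g, THEN iffD2])
  from far[unfolded additive_far_def, rule_format, OF this]
  obtain A where A: "finite A" "\<And>x s. x \<notin> A \<Longrightarrow> f ((\<eta> \<circ> g)(x := s)) = f (\<eta> \<circ> g) + f ((\<lambda>_. b)(x := s))"
    by (elim exE conjE) simp
  have upd: "\<zeta>(g y := s) \<circ> g = (\<zeta> \<circ> g)(y := s)" for \<zeta> :: "'x \<Rightarrow> 's" and y s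
    using g by (auto simp: fun_eq_iff bij_is_inj inj_eq)
  have "f (\<eta>(x := s) \<circ> g) = f (\<eta> \<circ> g) + f ((\<lambda>_. b)(x := s) \<circ> g)" if x: "x \<notin> g ` A" for x s
  proof -
    obtain y where y: "x = g y" using bij_is_surj[OF g] by (rule surjE)
    then have "y \<notin> A" using x by blast
    then have "f (\<eta>(g y := s) \<circ> g) = f (\<eta> \<circ> g) + f ((\<lambda>_. b)(g y := s) \<circ> g)"
      unfolding upd using A(2) by (simp add: comp_def)
    then show ?thesis by (simp add: y)
  qed
  then show "\<exists>A. finite A \<and> (\<forall>x s. x \<notin> A \<longrightarrow> f (\<eta>(x := s) \<circ> g) = f (\<eta> \<circ> g) + f ((\<lambda>_. b)(x := s) \<circ> g))"
    using A(1) by (intro exI[of _ "g ` A"]) blast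
qed

lemma additive_far_diff:
  assumes "additive_far f" "additive_far h" shows "additive_far (\<lambda>\<eta>. f \<eta> - h \<eta>)"
  unfolding additive_far_def
proof (intro allI impI)
  fix \<eta> :: "'x \<Rightarrow> 's" assume fin: "finite (supp b \<eta>)"
  obtain A where A: "finite A" "\<And>x s. x \<notin> A \<Longrightarrow> f (\<eta>(x := s)) = f \<eta> + f ((\<lambda>_. b)(x := s))"
    using assms(1) fin unfolding additive_far_def by blast
  obtain B where B: "finite B" "\<And>x s. x \<notin> B \<Longrightarrow> h (\<eta>(x := s)) = h \<eta> + h ((\<lambda>_. b)(x := s))"
    using assms(2) fin unfolding additive_far_def by blast
  show "\<exists>A. finite A \<and> (\<forall>x s. x \<notin> A \<longrightarrow> f (\<eta>(x := s)) - h (\<eta>(x := s))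
      = f \<eta> - h \<eta> + (f ((\<lambda>_. b)(x := s)) - h ((\<lambda>_. b)(x := s))))"
    using A B by (intro exI[of _ "A \<union> B"]) simp
qed

text \<open>The homomorphism property is the cocycle identity for the translates of \<open>f\<close>, in which the action
on the conserved quantities is trivial: a sum over all sites does not change under translation.\<close>

lemma shift_cocycle:
  assumes act: "group_action G UNIV \<alpha>" and loc: "site_local r f" and base: "f (\<lambda>_. b) = 0"
    and equiv: "\<And>\<sigma> e \<eta>. \<sigma> \<in> carrier G \<Longrightarrow> e \<in> E \<Longrightarrow> finite (supp b \<eta>) \<Longrightarrow>
      f (step \<phi> e \<eta> \<circ> \<alpha> \<sigma>) - f (\<eta> \<circ> \<alpha> \<sigma>) = f (step \<phi> e \<eta>) - f \<eta>"
  obtains X where "\<And>\<sigma>. \<sigma> \<in> carrier G \<Longrightarrow> X \<sigma> \<in> Consv b \<phi>"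
    "\<And>\<sigma> \<eta>. \<sigma> \<in> carrier G \<Longrightarrow> finite (supp b \<eta>) \<Longrightarrow> f (\<eta> \<circ> \<alpha> \<sigma>) = f \<eta> + site_sum b (\<lambda>_. X \<sigma>) \<eta>"
    "\<And>\<sigma> \<tau> s. \<sigma> \<in> carrier G \<Longrightarrow> \<tau> \<in> carrier G \<Longrightarrow> X (\<sigma> \<otimes>\<^bsub>G\<^esub> \<tau>) s = X \<sigma> s + X \<tau> s"
proof -
  interpret act: group_action G UNIV \<alpha> by fact
  interpret G: group G using act.group_hom by (rule group_hom.axioms(1))
  have bij: "bij (\<alpha> \<sigma>)" if "\<sigma> \<in> carrier G" for \<sigma> using group_action_bij[OF act that] .
  have ex: "\<exists>\<xi>. \<xi> \<in> Consv b \<phi> \<and> (\<forall>\<eta>. finite (supp b \<eta>) \<longrightarrow> f (\<eta> \<circ> \<alpha> \<sigma>) = f \<eta> + site_sum b (\<lambda>_. \<xi>) \<eta>)"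
    if \<sigma>: "\<sigma> \<in> carrier G" for \<sigma>
  proof -
    define u where "u \<eta> = f (\<eta> \<circ> \<alpha> \<sigma>) - f \<eta>" for \<eta>
    have far: "additive_far u"
      unfolding u_def using site_local_additive_far[OF loc base]
      by (intro additive_far_diff additive_far_comp bij \<sigma>)
    have u0: "u (\<lambda>_. b) = 0" by (simp add: u_def comp_def)
    have inv: "u (step \<phi> e \<eta>) = u \<eta>" if "e \<in> E" "finite (supp b \<eta>)" for e \<eta>
      using equiv[OF \<sigma> that] by (simp add: u_def)
    obtain \<xi> where "\<xi> \<in> Consv b \<phi>" "\<And>\<eta>. finite (supp b \<eta>) \<Longrightarrow> u \<eta> = (\<Sum>x\<in>supp b \<eta>. \<xi> (\<eta> x))"
      using invariant_is_conserved[OF u0 far inv] by blast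
    then show ?thesis by (intro exI[of _ \<xi>]) (force simp: u_def site_sum_def)
  qed
  define X where "X \<sigma> = (SOME \<xi>. \<xi> \<in> Consv b \<phi> \<and> (\<forall>\<eta>. finite (supp b \<eta>) \<longrightarrow> f (\<eta> \<circ> \<alpha> \<sigma>) = f \<eta> + site_sum b (\<lambda>_. \<xi>) \<eta>))" for \<sigma>
  have X: "X \<sigma> \<in> Consv b \<phi> \<and> (\<forall>\<eta>. finite (supp b \<eta>) \<longrightarrow> f (\<eta> \<circ> \<alpha> \<sigma>) = f \<eta> + site_sum b (\<lambda>_. X \<sigma>) \<eta>)"
    if "\<sigma> \<in> carrier G" for \<sigma>
    unfolding X_def by (rule someI_ex[OF ex[OF that]])
  have X_eq: "f (\<eta> \<circ> \<alpha> \<sigma>) = f \<eta> + site_sum b (\<lambda>_. X \<sigma>) \<eta>" if "\<sigma> \<in> carrier G" "finite (supp b \<eta>)" for \<sigma> \<eta>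
    using X that by blast
  have X_add: "X (\<sigma> \<otimes>\<^bsub>G\<^esub> \<tau>) s = X \<sigma> s + X \<tau> s" if st: "\<sigma> \<in> carrier G" "\<tau> \<in> carrier G" for \<sigma> \<tau> s
  proof -
    define \<eta> where "\<eta> = (\<lambda>_. b)((undefined :: 'x) := s)"
    have fin: "finite (supp b \<eta>)" unfolding \<eta>_def by (rule finite_supp_upd) simp
    have fin': "finite (supp b (\<eta> \<circ> \<alpha> \<sigma>))" by (rule finite_supp_comp[OF bij[OF st(1)], THEN iffD2, OF fin])
    have "\<alpha> (\<sigma> \<otimes>\<^bsub>G\<^esub> \<tau>) = \<alpha> \<sigma> \<circ> \<alpha> \<tau>"
      using act.composition_rule[OF _ st] by (simp add: fun_eq_iff)
    then have "f (\<eta> \<circ> \<alpha> (\<sigma> \<otimes>\<^bsub>G\<^esub> \<tau>)) = f ((\<eta> \<circ> \<alpha> \<sigma>) \<circ> \<alpha> \<tau>)" by (simp add: comp_assoc)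
    then have "site_sum b (\<lambda>_. X (\<sigma> \<otimes>\<^bsub>G\<^esub> \<tau>)) \<eta> = site_sum b (\<lambda>_. X \<sigma>) \<eta> + site_sum b (\<lambda>_. X \<tau>) (\<eta> \<circ> \<alpha> \<sigma>)"
      using X_eq[OF G.m_closed[OF st] fin] X_eq[OF st(2) fin'] X_eq[OF st(1) fin] by simp
    also have "site_sum b (\<lambda>_. X \<tau>) (\<eta> \<circ> \<alpha> \<sigma>) = site_sum b (\<lambda>_. X \<tau>) \<eta>"
      using site_sum_comp[OF bij[OF st(1)]] .
    finally have sums: "site_sum b (\<lambda>_. X (\<sigma> \<otimes>\<^bsub>G\<^esub> \<tau>)) \<eta> = site_sum b (\<lambda>_. X \<sigma>) \<eta> + site_sum b (\<lambda>_. X \<tau>) \<eta>" .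
    have Xb: "X \<rho> b = 0" if "\<rho> \<in> carrier G" for \<rho> using X[OF that] by (simp add: Consv_def)
    have "site_sum b (\<lambda>_. X \<rho>) \<eta> = X \<rho> s" if "\<rho> \<in> carrier G" for \<rho>
      using site_sum_upd[of b "\<lambda>_. b" "\<lambda>_. X \<rho>" undefined s] Xb[OF that]
      by (simp add: \<eta>_def) (simp add: site_sum_def)
    then show ?thesis using sums st G.m_closed[OF st] by simp
  qed
  show ?thesis using that[of X] X X_eq X_add by blast
qed

lemma site_local_add_site_sum:
  assumes loc: "site_local r f" and w: "\<And>x. w x b = 0"
  shows "site_local r (\<lambda>\<eta>. f \<eta> + site_sum b w \<eta>)"
  unfolding site_local_def
proof (intro allI impI)
  fix x s and \<eta> \<eta>' :: "'x \<Rightarrow> 's"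
  assume *: "finite (supp b \<eta>)" "finite (supp b \<eta>')" "\<forall>y\<in>nball E x r. \<eta> y = \<eta>' y"
  have "f (\<eta>(x := s)) - f \<eta> = f (\<eta>'(x := s)) - f \<eta>'"
    using loc * unfolding site_local_def by blast
  moreover have "\<eta> x = \<eta>' x" using *(3) by (simp add: nball_def)
  ultimately show "f (\<eta>(x := s)) + site_sum b w (\<eta>(x := s)) - (f \<eta> + site_sum b w \<eta>)
      = f (\<eta>'(x := s)) + site_sum b w (\<eta>'(x := s)) - (f \<eta>' + site_sum b w \<eta>')"
    using site_sum_upd[of b \<eta> w, OF *(1) w, of x s] site_sum_upd[of b \<eta>' w, OF *(2) w, of x s] by simp
qed

end

lemma site_sum_sum:
  "site_sum b (\<lambda>x s. \<Sum>i\<in>I. w i x s) \<eta> = (\<Sum>i\<in>I. site_sum b (w i) \<eta>)"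
  unfolding site_sum_def by (rule sum.swap)

lemma site_sum_scale: "site_sum b (\<lambda>x s. c * w x s) \<eta> = c * site_sum b w \<eta>"
  by (simp add: site_sum_def sum_distrib_left)


section \<open>Closed shift-invariant forms\<close>

theorem theorem5:
  fixes E :: "('x \<times> 'x) set"
    and b :: 's
    and \<phi> :: "'s \<times> 's \<Rightarrow> 's \<times> 's"
    and d :: nat
    and \<alpha> :: "(nat \<Rightarrow> int) \<Rightarrow> 'x \<Rightarrow> 'x"
    and \<Lambda>0 :: "'x set"
    and \<xi> :: "nat \<Rightarrow> 's \<Rightarrow> real"
    and \<omega> :: "('x \<Rightarrow> 's) \<times> ('x \<Rightarrow> 's) \<Rightarrow> real"
  assumes "is_locale UNIV E"
    and "is_interaction \<phi>"
    and "irreducibly_quantified b \<phi>"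
    and "transferable E \<or> (simple_interaction b \<phi> \<and> weakly_transferable E)"
    and "acts_on_graph (Zpow d) E \<alpha>"
    and "free_action (Zpow d) \<alpha>"
    and "fundamental_domain (Zpow d) \<alpha> \<Lambda>0"
    and "consv_finite_dim b \<phi>"
    and "consv_basis b \<phi> {1..consv_dim b \<phi>} \<xi>"
    and "is_form b E \<phi> \<omega>"
    and "\<forall>e\<in>E. form_component \<phi> \<omega> e \<in> C_loc b"
    and "shift_invariant_form (Zpow d) \<alpha> b E \<phi> \<omega>"
    and "closed_form b E \<phi> \<omega>"
    and "uniform_form b E \<phi> \<omega>"
  shows "\<exists>(a :: nat \<Rightarrow> nat \<Rightarrow> real) F.
           F \<in> C0_unif b E \<and> shift_invariant_function (Zpow d) \<alpha> b F \<and>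
           (\<forall>e\<in>E. \<forall>\<eta>\<in>fin_configs b.
              form_component \<phi> \<omega> e \<eta> =
              nabla \<phi> e
                (\<lambda>\<zeta>. F \<zeta> + (\<Sum>i=1..consv_dim b \<phi>. \<Sum>j=1..d. a i j *
                   (\<Sum>\<^sub>\<infinity>\<tau>\<in>carrier (Zpow d). of_int (\<tau> j) * consv_sum (\<xi> i) (\<alpha> \<tau> ` \<Lambda>0) \<zeta>)))
                \<eta>)"
proof -
  define G where "G = Zpow d"
  define c where "c = consv_dim b \<phi>"
  have "weakly_transferable E" using assms(4) by (auto simp: transferable_def)
  then interpret system E b \<phi>
    using assms(1,3) by unfold_locales
  have act: "group_action G UNIV \<alpha>" and graph: "\<And>g x y. g \<in> carrier G \<Longrightarrow> (x, y) \<in> E \<Longrightarrow> (\<alpha> g x, \<alpha> g y) \<in> E"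
    using assms(5) by (auto simp: acts_on_graph_def G_def)
  interpret G: group G unfolding G_def by (rule group_Zpow)
  interpret act: group_action G UNIV \<alpha> by fact
  obtain f0 where f0: "f0 (\<lambda>_. b) = 0"
    "\<And>e \<eta>. e \<in> E \<Longrightarrow> finite (supp b \<eta>) \<Longrightarrow> \<omega> (\<eta>, step \<phi> e \<eta>) = nabla \<phi> e f0 \<eta>"
    using closed_form_potential[OF assms(2,10,13)] by blast
  obtain R where R: "R > 0" "\<And>e. e \<in> E \<Longrightarrow> form_component \<phi> \<omega> e \<in> C_on b (edge_ball E e R)"
    using assms(14) unfolding uniform_form_def by blast
  define r where "r = nat \<lfloor>R\<rfloor>"
  have edge_ball: "edge_ball E e R = nball E (fst e) r \<union> nball E (snd e) r" for e
    using R(1) by (simp add: edge_ball_def gball_nball r_def)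
  have "local_gradient r f0"
    unfolding local_gradient_def
  proof (intro ballI allI impI)
    fix e and \<eta> \<eta>' :: "'x \<Rightarrow> 's"
    assume e: "e \<in> E" and fin: "finite (supp b \<eta>)" "finite (supp b \<eta>')"
      and agree: "\<forall>x. gdist E (fst e) x \<le> r \<or> gdist E (snd e) x \<le> r \<longrightarrow> \<eta> x = \<eta>' x"
    have "form_component \<phi> \<omega> e \<eta> = form_component \<phi> \<omega> e \<eta>'"
    proof (rule R(2)[OF e, unfolded C_on_def, THEN CollectD, rule_format])
      fix x assume "x \<in> edge_ball E e R"
      then show "\<eta> x = \<eta>' x" using agree unfolding edge_ball by (auto simp: nball_def)
    qed (use fin in \<open>simp_all add: fin_configs_supp\<close>)
    then show "nabla \<phi> e f0 \<eta> = nabla \<phi> e f0 \<eta>'"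
      using f0(2)[OF e] fin by (simp add: form_component_def)
  qed
  then interpret local_potential E b \<phi> f0 r
    using f0(1) by unfold_locales
  have "transferable E \<or> simple_interaction b \<phi>" using assms(4) by blast
  then obtain f where loc: "site_local r f" and f_base: "f (\<lambda>_. b) = 0"
    and f_grad: "\<And>e \<eta>. e \<in> E \<Longrightarrow> finite (supp b \<eta>) \<Longrightarrow> nabla \<phi> e f \<eta> = nabla \<phi> e f0 \<eta>"
    using site_local_potential_exists by blast
  have \<omega>: "\<omega> (\<eta>, step \<phi> e \<eta>) = f (step \<phi> e \<eta>) - f \<eta>" if "e \<in> E" "finite (supp b \<eta>)" for e \<eta>
    using f0(2)[OF that] f_grad[OF that] by (simp add: nabla_def)
  have bij: "bij (\<alpha> \<sigma>)" if "\<sigma> \<in> carrier G" for \<sigma> using group_action_bij[OF act that] .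
  have equiv: "f (step \<phi> e \<eta> \<circ> \<alpha> \<sigma>) - f (\<eta> \<circ> \<alpha> \<sigma>) = f (step \<phi> e \<eta>) - f \<eta>"
    if \<sigma>: "\<sigma> \<in> carrier G" and e: "e \<in> E" and fin: "finite (supp b \<eta>)" for \<sigma> e \<eta>
  proof -
    define g where "g = inv\<^bsub>G\<^esub> \<sigma>"
    have g: "g \<in> carrier G" using \<sigma> by (simp add: g_def)
    \<comment> \<open>Translating a configuration moves the edge in the opposite direction.\<close>
    define e' where "e' = (\<alpha> g (fst e), \<alpha> g (snd e))"
    have e': "e' \<in> E" unfolding e'_def by (rule graph[OF g]) (simp add: e)
    have one: "\<alpha> \<one>\<^bsub>G\<^esub> v = v" for v using act.id_eq_one by (metis UNIV_I restrict_apply)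
    have "\<alpha> \<sigma> (\<alpha> g v) = v" for v
      using act.composition_rule[of v \<sigma> g] \<sigma> g one by (simp add: g_def)
    then have "e = (\<alpha> \<sigma> (fst e'), \<alpha> \<sigma> (snd e'))" by (simp add: e'_def)
    then have step: "step \<phi> e \<eta> \<circ> \<alpha> \<sigma> = step \<phi> e' (\<eta> \<circ> \<alpha> \<sigma>)" by (rule step_comp[OF bij[OF \<sigma>]])
    have fin': "finite (supp b (\<eta> \<circ> \<alpha> \<sigma>))" by (rule finite_supp_comp[OF bij[OF \<sigma>], THEN iffD2, OF fin])
    have "\<omega> (\<eta> \<circ> \<alpha> \<sigma>, step \<phi> e \<eta> \<circ> \<alpha> \<sigma>) = \<omega> (\<eta>, step \<phi> e \<eta>)"
      using assms(12) \<sigma> fin_transitions_step[OF e fin, of \<phi>]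
      unfolding shift_invariant_form_def G_def by fastforce
    then show ?thesis using \<omega>[OF e fin] \<omega>[OF e' fin'] step by simp
  qed
  obtain X where X: "\<And>\<sigma>. \<sigma> \<in> carrier G \<Longrightarrow> X \<sigma> \<in> Consv b \<phi>"
    "\<And>\<sigma> \<eta>. \<sigma> \<in> carrier G \<Longrightarrow> finite (supp b \<eta>) \<Longrightarrow> f (\<eta> \<circ> \<alpha> \<sigma>) = f \<eta> + site_sum b (\<lambda>_. X \<sigma>) \<eta>"
    "\<And>\<sigma> \<tau> s. \<sigma> \<in> carrier G \<Longrightarrow> \<tau> \<in> carrier G \<Longrightarrow> X (\<sigma> \<otimes>\<^bsub>G\<^esub> \<tau>) s = X \<sigma> s + X \<tau> s"
    using shift_cocycle[OF act loc f_base equiv] by blast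
  obtain \<kappa> where \<kappa>: "\<And>x. \<kappa> x \<in> carrier G"
    "\<And>x \<tau>. \<tau> \<in> carrier G \<Longrightarrow> x \<in> \<alpha> \<tau> ` \<Lambda>0 \<longleftrightarrow> \<kappa> x = \<tau>"
    "\<And>x \<sigma>. \<sigma> \<in> carrier G \<Longrightarrow> \<kappa> (\<alpha> \<sigma> x) = \<sigma> \<otimes>\<^bsub>G\<^esub> \<kappa> x"
    using orbit_coordinates[OF act] assms(6,7) unfolding G_def by blast
  \<comment> \<open>Since \<open>X\<close> is additive, this weight changes by \<open>X \<sigma>\<close> when \<open>x\<close> is translated by \<open>\<sigma>\<close>, which compensates the change of \<open>f\<close>.\<close>
  define w where "w x s = X (\<kappa> x) s" for x s
  have w_base: "w x b = 0" for x using X(1)[OF \<kappa>(1)[of x]] by (simp add: w_def Consv_def)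
  define F where "F \<eta> = f \<eta> + site_sum b w \<eta>" for \<eta>
  have "F \<in> C0_unif b E"
    unfolding F_def by (rule site_local_C0_unif[OF site_local_add_site_sum[OF loc]])
      (simp_all add: w_base f_base site_sum_def)
  moreover have "shift_invariant_function G \<alpha> b F"
    unfolding shift_invariant_function_def
  proof (intro ballI)
    fix \<sigma> and \<eta> :: "'x \<Rightarrow> 's" assume \<sigma>: "\<sigma> \<in> carrier G" and "\<eta> \<in> fin_configs b"
    then have fin: "finite (supp b \<eta>)" by (simp add: fin_configs_supp)
    have "w (inv_into UNIV (\<alpha> \<sigma>) y) s = w y s - X \<sigma> s" for y s
    proof -
      define x where "x = inv_into UNIV (\<alpha> \<sigma>) y"
      have y: "y = \<alpha> \<sigma> x" using bij[OF \<sigma>] by (simp add: x_def bij_is_surj surj_f_inv_f)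
      have "w y s = X \<sigma> s + w x s" unfolding w_def y \<kappa>(3)[OF \<sigma>] by (rule X(3)[OF \<sigma> \<kappa>(1)])
      then show ?thesis by (simp add: x_def)
    qed
    then have "site_sum b w (\<eta> \<circ> \<alpha> \<sigma>) = site_sum b w \<eta> - site_sum b (\<lambda>_. X \<sigma>) \<eta>"
      unfolding site_sum_comp[OF bij[OF \<sigma>]] by (simp add: site_sum_def sum_subtractf)
    then show "F (\<eta> \<circ> \<alpha> \<sigma>) = F \<eta>" using X(2)[OF \<sigma> fin] by (simp add: F_def)
  qed
  moreover have "\<exists>a. \<forall>\<eta>. finite (supp b \<eta>) \<longrightarrow> f \<eta> = F \<eta> + (\<Sum>i=1..c. \<Sum>j=1..d. a i j *
      (\<Sum>\<^sub>\<infinity>\<tau>\<in>carrier G. of_int (\<tau> j) * consv_sum (\<xi> i) (\<alpha> \<tau> ` \<Lambda>0) \<eta>))"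
  proof -
    have unit: "unit_Zpow d j 1 \<in> carrier G" for j by (auto simp: G_def carrier_Zpow unit_Zpow_def)
    have "\<exists>a. \<forall>s. X (unit_Zpow d j 1) s = (\<Sum>i=1..c. a i * \<xi> i s)" for j
      using consv_basis_expand[OF assms(9) _ X(1)[OF unit]] unfolding c_def by blast
    then obtain a where a: "\<And>j s. X (unit_Zpow d j 1) s = (\<Sum>i=1..c. a j i * \<xi> i s)" by metis
    have \<xi>_base: "\<xi> i b = 0" if "i \<in> {1..c}" for i
      using assms(9) fun_vs.span_base[of "\<xi> i" "\<xi> ` {1..c}"] that
      by (auto simp: consv_basis_def c_def Consv_def)
    have X_expand: "X \<sigma> s = (\<Sum>i=1..c. \<Sum>j=1..d. a j i * (of_int (\<sigma> j) * \<xi> i s))" if "\<sigma> \<in> carrier G" for \<sigma> s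
    proof -
      have "X \<sigma> s = (\<Sum>j=1..d. of_int (\<sigma> j) * X (unit_Zpow d j 1) s)"
        by (rule additive_Zpow_linear[of d "\<lambda>\<sigma>. X \<sigma> s"]) (use X(3) that in \<open>auto simp: G_def\<close>)
      also have "\<dots> = (\<Sum>j=1..d. \<Sum>i=1..c. a j i * (of_int (\<sigma> j) * \<xi> i s))"
        by (simp add: a sum_distrib_left mult_ac)
      also have "\<dots> = (\<Sum>i=1..c. \<Sum>j=1..d. a j i * (of_int (\<sigma> j) * \<xi> i s))" by (rule sum.swap)
      finally show ?thesis .
    qed
    have "site_sum b w \<eta> = (\<Sum>i=1..c. \<Sum>j=1..d. a j i *
        (\<Sum>\<^sub>\<infinity>\<tau>\<in>carrier G. of_int (\<tau> j) * consv_sum (\<xi> i) (\<alpha> \<tau> ` \<Lambda>0) \<eta>))"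
      if fin: "finite (supp b \<eta>)" for \<eta>
    proof -
      have "site_sum b w \<eta> = (\<Sum>i=1..c. \<Sum>j=1..d. a j i * site_sum b (\<lambda>x s. of_int (\<kappa> x j) * \<xi> i s) \<eta>)"
        unfolding w_def X_expand[OF \<kappa>(1)] site_sum_sum site_sum_scale ..
      also have "\<dots> = (\<Sum>i=1..c. \<Sum>j=1..d. a j i *
        (\<Sum>\<^sub>\<infinity>\<tau>\<in>carrier G. of_int (\<tau> j) * consv_sum (\<xi> i) (\<alpha> \<tau> ` \<Lambda>0) \<eta>))"
      proof (intro sum.cong refl)
        fix i j assume "i \<in> {1..c}"
        then have "\<xi> i b = 0" by (rule \<xi>_base)
        then have "(\<Sum>\<^sub>\<infinity>\<tau>\<in>carrier G. of_int (\<tau> j) * consv_sum (\<xi> i) (\<alpha> \<tau> ` \<Lambda>0) \<eta>)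
            = site_sum b (\<lambda>x s. of_int (\<kappa> x j) * \<xi> i s) \<eta>"
          by (rule first_moment_eq_site_sum[where \<xi> = "\<xi> i" and b = b and c = "\<lambda>\<tau>. \<tau> j" and \<kappa> = \<kappa>,
                OF fin _ \<kappa>(1,2)])
        then show "a j i * site_sum b (\<lambda>x s. of_int (\<kappa> x j) * \<xi> i s) \<eta> = a j i *
            (\<Sum>\<^sub>\<infinity>\<tau>\<in>carrier G. of_int (\<tau> j) * consv_sum (\<xi> i) (\<alpha> \<tau> ` \<Lambda>0) \<eta>)" by simp
      qed
      finally show ?thesis .
    qed
    \<comment> \<open>The first moments were added to \<open>f\<close> to obtain \<open>F\<close>, hence the sign.\<close>
    then show ?thesis
      by (intro exI[of _ "\<lambda>i j. - a j i"]) (simp add: F_def sum_negf)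
  qed
  then obtain a where a: "\<And>\<eta>. finite (supp b \<eta>) \<Longrightarrow> f \<eta> = F \<eta> + (\<Sum>i=1..c. \<Sum>j=1..d. a i j *
      (\<Sum>\<^sub>\<infinity>\<tau>\<in>carrier G. of_int (\<tau> j) * consv_sum (\<xi> i) (\<alpha> \<tau> ` \<Lambda>0) \<eta>))" by blast
  have "\<forall>e\<in>E. \<forall>\<eta>\<in>fin_configs b. form_component \<phi> \<omega> e \<eta> = nabla \<phi> e
      (\<lambda>\<zeta>. F \<zeta> + (\<Sum>i=1..c. \<Sum>j=1..d. a i j *
        (\<Sum>\<^sub>\<infinity>\<tau>\<in>carrier G. of_int (\<tau> j) * consv_sum (\<xi> i) (\<alpha> \<tau> ` \<Lambda>0) \<zeta>))) \<eta>"
  proof (intro ballI)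
    fix e and \<eta> :: "'x \<Rightarrow> 's" assume e: "e \<in> E" and "\<eta> \<in> fin_configs b"
    then have fin: "finite (supp b \<eta>)" by (simp add: fin_configs_supp)
    have fin': "finite (supp b (step \<phi> e \<eta>))" by (rule finite_subset[OF supp_step]) (use fin in simp)
    show "form_component \<phi> \<omega> e \<eta> = nabla \<phi> e
      (\<lambda>\<zeta>. F \<zeta> + (\<Sum>i=1..c. \<Sum>j=1..d. a i j *
        (\<Sum>\<^sub>\<infinity>\<tau>\<in>carrier G. of_int (\<tau> j) * consv_sum (\<xi> i) (\<alpha> \<tau> ` \<Lambda>0) \<zeta>))) \<eta>"
      unfolding form_component_def nabla_def a[OF fin, symmetric] a[OF fin', symmetric] by (rule \<omega>[OF e fin])
  qed
  ultimately show ?thesis unfolding G_def c_def by blast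
qed

end
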